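(* Let $(\mathcal S,\mathcal F,\mu,\prec)$ be an ordered probability space and $W$ a kernel on it. Then there is a proper poset limit $\Pi_W\in\mathcal P_\infty$ such that: (i) $P(n,W)\to\Pi_W$ almost surely in $\overline{\mathcal P}$ as $n\to\infty$ (here $P(n,W)$ is regarded as an unlabelled finite poset, i.e. an element of $\mathcal P\subset\overline{\mathcal P}$); (ii) for every finite poset $Q$, with ground set labelled $\{1,\dots,|Q|\}$, $$t(Q,\Pi_W)=\int_{\mathcal S^{|Q|}}\prod_{(i,j):\,i<_Q j}W(x_i,x_j)\,d\mu(x_1)\cdots d\mu(x_{|Q|}).$$ Moreover, every proper poset limit $\Pi\in\mathcal P_\infty$ can be represented in this way, i.e. $\Pi=\Pi_W$ for some kernel $W$ on some ordered probability space.
   Context: A poset is a nonempty set (its ground set) with a strict partial order $<$. For finite posets $Q,P$: $t(Q,P)$ is the proportion of all maps $\varphi$ from the ground set of $Q$ to that of $P$ that are poset homomorphisms ($x<_Q y\Rightarrow \varphi(x)<_P\varphi(y)$); $t_{\mathrm{inj}}(Q,P)$ is the proportion of injective maps that are homomorphisms; $t_{\mathrm{ind}}(Q,P)$ is the proportion of injective maps with $x<_Qy\iff\varphi(x)<_P\varphi(y)$; if $|Q|>|P|$ set $t_{\mathrm{inj}}(Q,P)=t_{\mathrm{ind}}(Q,P)=0$. Let $\mathcal P$ be the countable set of isomorphism classes of finite nonempty posets. The map $P\mapsto\big((t(Q,P))_{Q\in\mathcal P},|P|^{-1}\big)\in[0,1]^{\mathcal P}\times[0,1]$ is injective; identify $\mathcal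 P$ with its image, let $\overline{\mathcal P}$ be its closure in the product topology (a compact metrizable space), and let $\mathcal P_\infty=\overline{\mathcal P}\setminus\mathcal P$ (proper poset limits). The functions $t(Q,\cdot),t_{\mathrm{inj}}(Q,\cdot),t_{\mathrm{ind}}(Q,\cdot)$ extend continuously to $\overline{\mathcal P}$; an element of $\mathcal P_\infty$ is determined by the values $t(Q,\cdot)$, $Q\in\mathcal P$. An ordered probability space $(\mathcal S,\mathcal F,\mu,\prec)$ is a probability space with a strict partial order $\prec$ on $\mathcal S$ such that $\{(x,y):x\prec y\}\in\mathcal F\times\mathcal F$. A kernel on it is a measurable $W:\mathcal S\times\mathcal S\to[0,1]$ such that for all $x,y,z\in\mathcal S$: $W(x,y)>0\Rightarrow x\prec y$, and ($W(x,y)>0$ and $W(y,z)>0$) $\Rightarrow W(x,z)=1$. For $n\in\mathbb N\cup\{\infty\}$ let $[n]=\{1,\dots,n\}$ ($[\infty]=\mathbb N$). The random poset $P(n,W)$ on $[n]$ is defined by taking i.i.d. $X_1,X_2,\dots\sim\mu$ and independent i.i.d. $\xi_{ij}\sim U(0,1)$, $i,j\in\mathbb N$, and declaring $i\prec j$ iff $\xi_{ij}<W(X_i,X_j)$. *)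

theory Defs
  imports "HOL-Probability.Probability"
begin

text \<open>A labelled finite poset is a pair (n, R): ground set {0..<n}, strict order R.\<close>
type_synonym lposet = "nat \<times> (nat \<Rightarrow> nat \<Rightarrow> bool)"

definition valid_poset :: "lposet \<Rightarrow> bool" where
  "valid_poset P \<longleftrightarrow> (case P of (n, R) \<Rightarrow>
     1 \<le> n \<and> (\<forall>x y. R x y \<longrightarrow> x < n \<and> y < n) \<and> (\<forall>x. \<not> R x x) \<and>
     (\<forall>x y z. R x y \<longrightarrow> R y z \<longrightarrow> R x z))"

definition hom_density :: "lposet \<Rightarrow> lposet \<Rightarrow> real" where
  "hom_density Q P = (case Q of (k, R) \<Rightarrow> case P of (m, S) \<Rightarrow>
     real (card {\<phi> \<in> {..<k} \<rightarrow>\<^sub>E {..<m}. \<forall>x y. R x y \<longrightarrow> S (\<phi> x) (\<phi> y)}) / real m ^ k)"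

text \<open>The point of [0,1]^{\<P>} x [0,1] associated with a finite poset; coordinates are indexed
  by labelled posets (those not being valid posets get the constant coordinate 0).\<close>
type_synonym poset_pt = "(lposet \<Rightarrow> real) \<times> real"

definition poset_point :: "lposet \<Rightarrow> poset_pt" where
  "poset_point P = ((\<lambda>Q. if valid_poset Q then hom_density Q P else 0), 1 / real (fst P))"

definition finite_poset_points :: "poset_pt set" where
  "finite_poset_points = poset_point ` {P. valid_poset P}"

definition proper_poset_limits :: "poset_pt set" where
  "proper_poset_limits = closure finite_poset_points - finite_poset_points"

definition ordered_prob_space :: "'a measure \<Rightarrow> ('a \<Rightarrow> 'a \<Rightarrow> bool) \<Rightarrow> bool" where
  "ordered_prob_space M prec \<longleftrightarrow> prob_space M \<and>
     (\<forall>x\<in>space M. \<not> prec x x) \<and>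
     (\<forall>x\<in>space M. \<forall>y\<in>space M. \<forall>z\<in>space M. prec x y \<longrightarrow> prec y z \<longrightarrow> prec x z) \<and>
     {(x, y) \<in> space M \<times> space M. prec x y} \<in> sets (M \<Otimes>\<^sub>M M)"

definition poset_kernel :: "'a measure \<Rightarrow> ('a \<Rightarrow> 'a \<Rightarrow> bool) \<Rightarrow> ('a \<Rightarrow> 'a \<Rightarrow> real) \<Rightarrow> bool" where
  "poset_kernel M prec W \<longleftrightarrow>
     (\<lambda>(x, y). W x y) \<in> borel_measurable (M \<Otimes>\<^sub>M M) \<and>
     (\<forall>x\<in>space M. \<forall>y\<in>space M. 0 \<le> W x y \<and> W x y \<le> 1) \<and>
     (\<forall>x\<in>space M. \<forall>y\<in>space M. W x y > 0 \<longrightarrow> prec x y) \<and>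
     (\<forall>x\<in>space M. \<forall>y\<in>space M. \<forall>z\<in>space M. W x y > 0 \<longrightarrow> W y z > 0 \<longrightarrow> W x z = 1)"

definition rposet_space :: "'a measure \<Rightarrow> ((nat \<Rightarrow> 'a) \<times> (nat \<times> nat \<Rightarrow> real)) measure" where
  "rposet_space M = (PiM UNIV (\<lambda>_::nat. M)) \<Otimes>\<^sub>M
                    (PiM UNIV (\<lambda>_::nat \<times> nat. uniform_measure lborel {0..1::real}))"

text \<open>P(n,W) on the ground set {0..<n} (i.e. [n] shifted by one): i \<prec> j iff xi_ij < W(X_i,X_j).\<close>
definition rposet :: "('a \<Rightarrow> 'a \<Rightarrow> real) \<Rightarrow> nat \<Rightarrow> (nat \<Rightarrow> 'a) \<times> (nat \<times> nat \<Rightarrow> real) \<Rightarrow> lposet" where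
  "rposet W n \<omega> = (n, \<lambda>i j. i < n \<and> j < n \<and> snd \<omega> (i, j) < W (fst \<omega> i) (fst \<omega> j))"

definition kernel_density :: "'a measure \<Rightarrow> ('a \<Rightarrow> 'a \<Rightarrow> real) \<Rightarrow> lposet \<Rightarrow> real" where
  "kernel_density M W Q = (case Q of (k, R) \<Rightarrow>
     integral\<^sup>L (PiM {..<k} (\<lambda>_. M))
       (\<lambda>x. \<Prod>(i, j) \<in> {(i, j). i < k \<and> j < k \<and> R i j}. W (x i) (x j)))"

end

theory Submission
  imports Defs
begin

text \<open>
  Sampling from a kernel. The square of the number of homomorphisms from \<open>Q\<close> counts homomorphisms
  from two disjoint copies of \<open>Q\<close>, and non-injective maps are negligible, so the density of \<open>Q\<close> in
  \<open>P(n,W)\<close> has second central moment \<open>O(1/n)\<close>. This gives almost sure convergence along squares, and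
  monotonicity of the number of homomorphisms in \<open>n\<close> fills the gaps.

  Representing a limit. A greedy energy increment gives every finite poset a nested sequence of vertex
  colourings whose level \<open>l\<close> approximates the order relation in cut norm up to \<open>2 / sqrt l\<close>,
  uniformly over all posets. Along a subsequence, all class sizes and all densities between classes converge.
  Realising the limiting class sizes by nested intervals of \<open>[0,1)\<close>, the limiting densities
  form an \<open>L\<^sup>2\<close>-bounded martingale of step kernels, whose limit has the prescribed densities by
  the counting lemma. Comparing the densities of the path, the transitive triangle and the directed
  triangle shows that the limit is transitive and acyclic almost everywhere. Replacing it by \<open>0\<close> at
  non-Lebesgue points makes these properties hold everywhere, so \<open>W(x,y) > 0\<close> is itself the
  required strict order.
\<close>

section \<open>Weak regularity and counting for finite relations\<close>

text \<open>Cut-norm limits forget the joint behaviour of \<open>f (u, v)\<close> and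
  \<open>f (v, u)\<close>: a uniformly random orientation has no 2-cycles, yet it is close in cut
  norm to the constant 1/2, whose 2-cycle density is 1/4. Counting therefore works only for edge
  sets without antiparallel pairs, and acyclicity of the limit has to be read off the directed
  triangle instead of the 2-cycle. Irreflexivity comes back at a diagonal point by letting all three
  vertices of the triangle run through the cell of that point. The kernel axioms concern every
  triple, and a null set of bad triples does not by itself single out a null set of pairs on which
  to alter the kernel; hence the choice of a representative through Lebesgue points. The number 4 is
  the number of pieces into which a class falls when it is split by membership in the two sides of a
  cut, so parent colours are obtained by \<open>div 4\<close>. The error at level \<open>l\<close>
  has to be independent of the poset because the limit over posets is taken at fixed
  \<open>l\<close>, before \<open>l\<close> grows.\<close>

definition cmean :: "'x set \<Rightarrow> ('x \<Rightarrow> 'c) \<Rightarrow> ('x \<Rightarrow> real) \<Rightarrow> 'c \<Rightarrow> real" where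
  "cmean X c f a = (\<Sum>x\<in>{x\<in>X. c x = a}. f x) / real (card {x\<in>X. c x = a})"

text \<open>Averaging over classes is the orthogonal projection onto functions of the colour, and
  this is its characteristic property. It holds class by class, since \<open>h (c x)\<close> is
  constant there.\<close>

lemma cmean_adjoint:
  assumes "finite X"
  shows "(\<Sum>x\<in>X. cmean X c f (c x) * h (c x)) = (\<Sum>x\<in>X. f x * h (c x))"
proof -
  have "(\<Sum>x\<in>{x\<in>X. c x = a}. cmean X c f (c x) * h (c x)) = (\<Sum>x\<in>{x\<in>X. c x = a}. f x * h (c x))"
    (is "?l = ?r") if "a \<in> c ` X" for a
  proof -
    have ne: "real (card {x\<in>X. c x = a}) \<noteq> 0"
      using that assms by auto
    have "?l = (\<Sum>x\<in>{x\<in>X. c x = a}. cmean X c f a * h a)"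
      by (intro sum.cong) auto
    also have "\<dots> = (\<Sum>x\<in>{x\<in>X. c x = a}. f x) * h a"
      using ne by (simp add: cmean_def)
    also have "\<dots> = ?r"
      unfolding sum_distrib_right by (intro sum.cong) auto
    finally show ?thesis .
  qed
  then show ?thesis
    using assms by (simp add: sum.image_gen[where S=X and g=c])
qed

lemma cmean_self:
  assumes "finite X" "x \<in> X"
  shows "cmean X c (\<lambda>y. h (c y)) (c x) = h (c x)"
proof -
  have "(\<Sum>y\<in>{y\<in>X. c y = c x}. h (c y)) = (\<Sum>y\<in>{y\<in>X. c y = c x}. h (c x))"
    by (intro sum.cong) auto
  moreover have "card {y\<in>X. c y = c x} \<noteq> 0" using assms by auto
  ultimately show ?thesis by (simp add: cmean_def)
qed

lemma cmean_range:
  assumes "\<And>x. x \<in> X \<Longrightarrow> 0 \<le> f x \<and> f x \<le> 1"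
  shows "0 \<le> cmean X c f a \<and> cmean X c f a \<le> 1"
proof -
  have "(\<Sum>x\<in>{x\<in>X. c x = a}. f x) \<le> (\<Sum>x\<in>{x\<in>X. c x = a}. 1)"
    by (intro sum_mono) (use assms in auto)
  moreover have "0 \<le> (\<Sum>x\<in>{x\<in>X. c x = a}. f x)"
    by (intro sum_nonneg) (use assms in auto)
  \<comment> \<open>A class of cardinality 0 (empty or infinite) has mean 0, because division by 0
    yields 0.\<close>
  ultimately show ?thesis unfolding cmean_def
    by (cases "card {x\<in>X. c x = a} = 0") (auto simp: divide_le_eq simp del: card_eq_0_iff)
qed

lemma cmean_diff:
  "cmean X c (\<lambda>x. f x - g x) a = cmean X c f a - cmean X c g a"
  by (simp add: cmean_def sum_subtractf diff_divide_distrib)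

lemma cmean_tensor:
  "cmean (V \<times> V) (map_prod c c) (\<lambda>(u, v). a u * b v) (p, q) = cmean V c a p * cmean V c b q"
proof -
  have "{x \<in> V \<times> V. map_prod c c x = (p, q)} = {u\<in>V. c u = p} \<times> {v\<in>V. c v = q}"
    by auto
  then show ?thesis
    by (simp add: cmean_def card_cartesian_product sum_product sum.cartesian_product)
qed

text \<open>Pythagoras: the coarse mean is a function of the fine colour, so adjointness turns the
  mixed term into \<open>f\<close> against the coarse mean, and a second use turns that into the
  coarse energy.\<close>

lemma cmean_energy:
  assumes fin: "finite X" and ref: "\<And>x. x \<in> X \<Longrightarrow> c x = g (c' x)"
  shows "(\<Sum>x\<in>X. (cmean X c' f (c' x) - cmean X c f (c x))\<^sup>2)
    = (\<Sum>x\<in>X. (cmean X c' f (c' x))\<^sup>2) - (\<Sum>x\<in>X. (cmean X c f (c x))\<^sup>2)"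
proof -
  have "(\<Sum>x\<in>X. cmean X c' f (c' x) * cmean X c f (g (c' x))) = (\<Sum>x\<in>X. f x * cmean X c f (g (c' x)))"
    by (rule cmean_adjoint[OF fin])
  then have "(\<Sum>x\<in>X. cmean X c' f (c' x) * cmean X c f (c x)) = (\<Sum>x\<in>X. f x * cmean X c f (c x))"
    using ref by simp
  also have "\<dots> = (\<Sum>x\<in>X. cmean X c f (c x) * cmean X c f (c x))"
    by (rule cmean_adjoint[OF fin, symmetric])
  finally show ?thesis
    by (simp add: power2_eq_square algebra_simps sum.distrib sum_subtractf sum_distrib_left[symmetric])
qed

section \<open>Cut-norm bounds and their behaviour under refinement\<close>

definition cut_bounded :: "'v set \<Rightarrow> ('v \<times> 'v \<Rightarrow> real) \<Rightarrow> real \<Rightarrow> bool" where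
  "cut_bounded V D K \<longleftrightarrow> (\<forall>a b. (\<forall>v\<in>V. 0 \<le> a v \<and> a v \<le> 1) \<longrightarrow> (\<forall>v\<in>V. 0 \<le> b v \<and> b v \<le> 1) \<longrightarrow>
     \<bar>\<Sum>(u, v)\<in>V \<times> V. a u * b v * D (u, v)\<bar> \<le> K)"

text \<open>A sum linear in the weights is largest for weight 1 where \<open>g\<close> is positive
  and weight 0 elsewhere.\<close>

lemma sum_weighted_le_sum_subset:
  fixes a g :: "'v \<Rightarrow> real"
  assumes "finite V" "\<And>v. v \<in> V \<Longrightarrow> 0 \<le> a v \<and> a v \<le> 1"
  obtains S where "S \<subseteq> V" "(\<Sum>v\<in>V. a v * g v) \<le> (\<Sum>v\<in>S. g v)"
proof
  show "{v\<in>V. g v > 0} \<subseteq> V" by auto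
  have "(\<Sum>v\<in>V. a v * g v) \<le> (\<Sum>v\<in>V. if g v > 0 then g v else 0)"
  proof (intro sum_mono)
    fix v assume "v \<in> V"
    then show "a v * g v \<le> (if g v > 0 then g v else 0)"
      using assms(2)[of v] by (auto simp: mult_le_cancel_right1 mult_nonneg_nonpos)
  qed
  also have "\<dots> = (\<Sum>v\<in>{v\<in>V. g v > 0}. g v)"
    using assms(1) by (simp add: sum.inter_filter)
  finally show "(\<Sum>v\<in>V. a v * g v) \<le> (\<Sum>v\<in>{v\<in>V. g v > 0}. g v)" .
qed

text \<open>The form is linear in each test function, so its extremes occur at indicators. The
  definition admits tests with values in [0,1] because class averages of indicators, and the
  products left after fixing vertices in the counting lemma, are of this kind.\<close>

lemma cut_bounded_setsI:
  assumes fin: "finite V" and K: "\<And>S T. S \<subseteq> V \<Longrightarrow> T \<subseteq> V \<Longrightarrow> \<bar>\<Sum>x\<in>S \<times> T. D x\<bar> \<le> K"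
  shows "cut_bounded V D K"
proof -
  \<comment> \<open>One-sided version, applied to \<open>D\<close> and to \<open>- D\<close>: the
    two signs have different optimal sets.\<close>
  have *: "(\<Sum>(u, v)\<in>V \<times> V. a u * b v * D (u, v)) \<le> K"
    if a: "\<forall>v\<in>V. 0 \<le> a v \<and> a v \<le> 1" and b: "\<forall>v\<in>V. 0 \<le> b v \<and> b v \<le> 1"
      and K: "\<And>S T. S \<subseteq> V \<Longrightarrow> T \<subseteq> V \<Longrightarrow> (\<Sum>x\<in>S \<times> T. D x) \<le> K"
    for a b and D :: "'a \<times> 'a \<Rightarrow> real"
  proof -
    have "(\<Sum>(u, v)\<in>V \<times> V. a u * b v * D (u, v)) = (\<Sum>u\<in>V. a u * (\<Sum>v\<in>V. b v * D (u, v)))"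
      by (simp add: sum.cartesian_product[symmetric] sum_distrib_left mult.assoc)
    also obtain S where S: "S \<subseteq> V" "\<dots> \<le> (\<Sum>u\<in>S. \<Sum>v\<in>V. b v * D (u, v))"
      using sum_weighted_le_sum_subset[OF fin, of a "\<lambda>u. \<Sum>v\<in>V. b v * D (u, v)"] a by auto
    note S(2)
    also have "(\<Sum>u\<in>S. \<Sum>v\<in>V. b v * D (u, v)) = (\<Sum>v\<in>V. b v * (\<Sum>u\<in>S. D (u, v)))"
      by (subst sum.swap) (simp add: sum_distrib_left)
    also obtain T where T: "T \<subseteq> V" "\<dots> \<le> (\<Sum>v\<in>T. \<Sum>u\<in>S. D (u, v))"
      using sum_weighted_le_sum_subset[OF fin, of b "\<lambda>v. \<Sum>u\<in>S. D (u, v)"] b by auto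
    note T(2)
    also have "(\<Sum>v\<in>T. \<Sum>u\<in>S. D (u, v)) = (\<Sum>x\<in>S \<times> T. D x)"
      by (subst sum.swap) (simp add: sum.cartesian_product)
    also have "\<dots> \<le> K" using K[OF S(1) T(1)] .
    finally show ?thesis .
  qed
  show ?thesis
    unfolding cut_bounded_def
  proof (intro allI impI)
    fix a b :: "'a \<Rightarrow> real"
    assume a: "\<forall>v\<in>V. 0 \<le> a v \<and> a v \<le> 1" and b: "\<forall>v\<in>V. 0 \<le> b v \<and> b v \<le> 1"
    have "(\<Sum>(u, v)\<in>V \<times> V. a u * b v * D (u, v)) \<le> K"
      by (rule *[OF a b]) (use K in \<open>fastforce simp: abs_le_iff\<close>)
    moreover have "(\<Sum>(u, v)\<in>V \<times> V. a u * b v * (- D (u, v))) \<le> K"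
      by (rule *[OF a b, of "\<lambda>x. - D x"]) (use K in \<open>fastforce simp: abs_le_iff sum_negf\<close>)
    moreover have "(\<Sum>(u, v)\<in>V \<times> V. a u * b v * (- D (u, v))) = - (\<Sum>(u, v)\<in>V \<times> V. a u * b v * D (u, v))"
      unfolding sum_negf[symmetric] by (intro sum.cong) auto
    ultimately show "\<bar>\<Sum>(u, v)\<in>V \<times> V. a u * b v * D (u, v)\<bar> \<le> K" by linarith
  qed
qed

abbreviation pair_mean :: "'v set \<Rightarrow> ('v \<Rightarrow> nat) \<Rightarrow> ('v \<times> 'v \<Rightarrow> real) \<Rightarrow> 'v \<times> 'v \<Rightarrow> real" where
  "pair_mean V c f x \<equiv> cmean (V \<times> V) (map_prod c c) f (map_prod c c x)"

text \<open>Averaging is self-adjoint and maps a product of test functions to a product of test functions.\<close>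

lemma cut_bounded_refine:
  assumes fin: "finite V" and ref: "\<And>v. v \<in> V \<Longrightarrow> c v = g (c' v)"
    and K: "cut_bounded V (\<lambda>x. f x - pair_mean V c f x) K"
  shows "cut_bounded V (\<lambda>x. f x - pair_mean V c' f x) (2 * K)"
  unfolding cut_bounded_def
proof (intro allI impI)
  fix a b :: "'a \<Rightarrow> real"
  assume a: "\<forall>v\<in>V. 0 \<le> a v \<and> a v \<le> 1" and b: "\<forall>v\<in>V. 0 \<le> b v \<and> b v \<le> 1"
  define X where "X = V \<times> V"
  have finX: "finite X" using fin by (simp add: X_def)
  define C where "C = map_prod c c"
  define C' where "C' = map_prod c' c'"
  define D where "D x = f x - cmean X C f (C x)" for x
  define h where "h x = a (fst x) * b (snd x)" for x
  define a' b' where "a' v = cmean V c' a (c' v)" and "b' v = cmean V c' b (c' v)" for v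
  have C: "C x = map_prod g g (C' x)" if "x \<in> X" for x
    using that ref by (auto simp: C_def C'_def X_def)
  \<comment> \<open>The coarse mean is a function of the fine colour, so fine averaging leaves it
    unchanged.\<close>
  have D': "cmean X C' D (C' x) = cmean X C' f (C' x) - cmean X C f (C x)" if "x \<in> X" for x
  proof -
    have "cmean X C' (\<lambda>x. cmean X C f (C x)) (C' x) = cmean X C' (\<lambda>x. cmean X C f (map_prod g g (C' x))) (C' x)"
      unfolding cmean_def[where c=C'] using C by (intro arg_cong2[where f="(/)"] sum.cong) auto
    also have "\<dots> = cmean X C f (C x)" using cmean_self[OF finX that] C[OF that] by simp
    finally show ?thesis unfolding D_def cmean_diff by simp
  qed
  have h': "cmean X C' h (C' x) = a' (fst x) * b' (snd x)" if "x \<in> X" for x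
    using cmean_tensor[of V c' a b "c' (fst x)" "c' (snd x)"]
    by (simp add: h_def[abs_def] X_def C'_def a'_def b'_def case_prod_unfold map_prod_def)
  have 1: "\<bar>\<Sum>x\<in>X. h x * D x\<bar> \<le> K"
    using K a b unfolding cut_bounded_def D_def h_def X_def C_def case_prod_unfold by auto
  have "\<forall>v\<in>V. 0 \<le> a' v \<and> a' v \<le> 1" "\<forall>v\<in>V. 0 \<le> b' v \<and> b' v \<le> 1"
    using cmean_range[of V a c'] cmean_range[of V b c'] a b by (auto simp: a'_def b'_def)
  then have 2: "\<bar>\<Sum>x\<in>X. a' (fst x) * b' (snd x) * D x\<bar> \<le> K"
    using K unfolding cut_bounded_def D_def X_def C_def case_prod_unfold by auto
  have "(\<Sum>x\<in>X. h x * cmean X C' D (C' x)) = (\<Sum>x\<in>X. cmean X C' h (C' x) * cmean X C' D (C' x))"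
    by (rule cmean_adjoint[OF finX, symmetric])
  also have "\<dots> = (\<Sum>x\<in>X. cmean X C' D (C' x) * cmean X C' h (C' x))"
    by (simp add: mult.commute)
  also have "\<dots> = (\<Sum>x\<in>X. D x * cmean X C' h (C' x))"
    by (rule cmean_adjoint[OF finX])
  also have "\<dots> = (\<Sum>x\<in>X. a' (fst x) * b' (snd x) * D x)"
    by (intro sum.cong) (auto simp: h' mult.commute)
  finally have 3: "(\<Sum>x\<in>X. h x * cmean X C' D (C' x)) = (\<Sum>x\<in>X. a' (fst x) * b' (snd x) * D x)" .
  \<comment> \<open>The new error is \<open>D\<close> minus its fine average. Each of the two parts
    is at most \<open>K\<close> in absolute value when tested, which is the origin of the factor
    2.\<close>
  have "(\<Sum>x\<in>X. h x * (f x - cmean X C' f (C' x))) = (\<Sum>x\<in>X. h x * D x) - (\<Sum>x\<in>X. h x * cmean X C' D (C' x))"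
    unfolding sum_subtractf[symmetric]
    by (intro sum.cong refl) (simp add: D' D_def right_diff_distrib)
  with 1 2 3 have "\<bar>\<Sum>x\<in>X. h x * (f x - cmean X C' f (C' x))\<bar> \<le> 2 * K" by linarith
  then show "\<bar>\<Sum>(u, v)\<in>V \<times> V. a u * b v * (f (u, v) - pair_mean V c' f (u, v))\<bar> \<le> 2 * K"
    by (simp add: X_def h_def C'_def case_prod_unfold map_prod_def)
qed

lemma cut_bounded_mono: "cut_bounded V D K \<Longrightarrow> K \<le> L \<Longrightarrow> cut_bounded V D L"
  unfolding cut_bounded_def by (meson order_trans)

section \<open>Energy increment and nested regular colourings\<close>

text \<open>The next colouring splits every class by the pair of sets on which the current error is
  largest.\<close>

lemma colouring_step:
  fixes V :: "'v set" and f :: "'v \<times> 'v \<Rightarrow> real" and c :: "'v \<Rightarrow> nat"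
  assumes fin: "finite V"
  defines "E \<equiv> \<lambda>c. \<Sum>x\<in>V \<times> V. (pair_mean V c f x)\<^sup>2"
  obtains c' K where "\<And>v. c v = c' v div 4" "cut_bounded V (\<lambda>x. f x - pair_mean V c f x) K" "0 \<le> K"
    "K\<^sup>2 \<le> (real (card V))\<^sup>2 * (E c' - E c)"
proof -
  define X where "X = V \<times> V"
  have finX: "finite X" using fin by (simp add: X_def)
  define F where "F p = \<bar>\<Sum>x\<in>fst p \<times> snd p. f x - pair_mean V c f x\<bar>" for p
  define Ps where "Ps = Pow V \<times> Pow V"
  have P: "finite (F ` Ps)" "F ` Ps \<noteq> {}" using fin by (auto simp: Ps_def)
  obtain p where p: "p \<in> Ps" "F p = Max (F ` Ps)"
    using Max_in[OF P] by (metis imageE)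
  have ST: "fst p \<subseteq> V" "snd p \<subseteq> V" using p by (auto simp: Ps_def)
  \<comment> \<open>The new base-4 digit consists of two bits recording membership in the two sides
    of the extremal pair \<open>p\<close>.\<close>
  define c' where "c' v = 4 * c v + ((if v \<in> fst p then 2 else 0) + (if v \<in> snd p then 1 else 0))" for v
  have div: "c' v div 4 = c v" for v by (simp add: c'_def)
  have fstp: "v \<in> fst p \<longleftrightarrow> 2 \<le> c' v mod 4" and sndp: "v \<in> snd p \<longleftrightarrow> odd (c' v)" for v
    by (auto simp: c'_def)
  show thesis
  proof
    show "c v = c' v div 4" for v using div[of v] by simp
    show "0 \<le> F p" by (simp add: F_def)
    show "cut_bounded V (\<lambda>x. f x - pair_mean V c f x) (F p)"
    proof (rule cut_bounded_setsI[OF fin])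
      fix S T assume "S \<subseteq> V" "T \<subseteq> V"
      then have "F (S, T) \<le> F p" unfolding p(2) using P by (intro Max_ge) (auto simp: Ps_def)
      then show "\<bar>\<Sum>x\<in>S \<times> T. f x - pair_mean V c f x\<bar> \<le> F p" by (simp add: F_def)
    qed
    define C where "C = map_prod c c"
    define C' where "C' = map_prod c' c'"
    \<comment> \<open>The indicator of the extremal rectangle is a function of the fine colours, so
      its pairing with \<open>f\<close> does not change when \<open>f\<close> is replaced by its
      fine mean.\<close>
    define H where "H y = (if 2 \<le> fst y mod 4 \<and> odd (snd y) then 1 else 0 :: real)" for y :: "nat \<times> nat"
    have H: "H (C' x) = indicator (fst p \<times> snd p) x" for x
      by (cases x) (simp add: H_def C'_def fstp sndp indicator_def)
    have CC': "C x = map_prod (\<lambda>n. n div 4) (\<lambda>n. n div 4) (C' x)" for x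
      by (cases x) (simp add: C_def C'_def div)
    have sub: "fst p \<times> snd p \<subseteq> X" using ST by (auto simp: X_def)
    have "(\<Sum>x\<in>fst p \<times> snd p. f x - pair_mean V c f x) = (\<Sum>x\<in>X. (f x - cmean X C f (C x)) * H (C' x))"
      unfolding H using finX sub by (simp add: X_def C_def indicator_def sum.If_cases Int_absorb1 Int_commute if_distrib[where f="\<lambda>t. _ * t"] cong: if_cong)
    also have "\<dots> = (\<Sum>x\<in>X. f x * H (C' x)) - (\<Sum>x\<in>X. cmean X C f (C x) * H (C' x))"
      by (simp add: left_diff_distrib sum_subtractf)
    also have "\<dots> = (\<Sum>x\<in>X. cmean X C' f (C' x) * H (C' x)) - (\<Sum>x\<in>X. cmean X C f (C x) * H (C' x))"
      by (simp add: cmean_adjoint[OF finX])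
    also have "\<dots> = (\<Sum>x\<in>X. (cmean X C' f (C' x) - cmean X C f (C x)) * H (C' x))"
      by (simp add: left_diff_distrib sum_subtractf)
    finally have "(F p)\<^sup>2 = (\<Sum>x\<in>X. (cmean X C' f (C' x) - cmean X C f (C x)) * H (C' x))\<^sup>2"
      by (simp add: F_def)
    \<comment> \<open>The squared norm of the rectangle indicator is at most the size of
      \<open>V \<times> V\<close>, which gives the factor
      \<open>(real (card V))\<^sup>2\<close>.\<close>
    also have "\<dots> \<le> (\<Sum>x\<in>X. (cmean X C' f (C' x) - cmean X C f (C x))\<^sup>2) * (\<Sum>x\<in>X. (H (C' x))\<^sup>2)"
      by (rule Cauchy_Schwarz_ineq_sum)
    also have "\<dots> \<le> (\<Sum>x\<in>X. (cmean X C' f (C' x) - cmean X C f (C x))\<^sup>2) * (\<Sum>x\<in>X. 1)"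
      by (intro mult_left_mono sum_mono sum_nonneg) (auto simp: H_def)
    also have "(\<Sum>x\<in>X. (cmean X C' f (C' x) - cmean X C f (C x))\<^sup>2) = E c' - E c"
      using cmean_energy[OF finX, of C "map_prod (\<lambda>n. n div 4) (\<lambda>n. n div 4)" C' f] CC'
      by (simp add: E_def X_def C_def C'_def)
    finally show "(F p)\<^sup>2 \<le> (real (card V))\<^sup>2 * (E c' - E c)"
      by (simp add: X_def card_cartesian_product power2_eq_square mult.commute mult.left_commute)
  qed
qed

text \<open>With \<open>m\<close> vertices the energy stays between 0 and \<open>m\<^sup>2\<close>,
  so the squared cut errors of levels below \<open>l\<close> add up to at most
  \<open>m\<^sup>2 * m\<^sup>2\<close>. Hence one of these levels has error at most
  \<open>m\<^sup>2 / sqrt l\<close>, and passing from it to its refinement at level \<open>l\<close>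
  costs the factor 2.\<close>

lemma regular_colourings:
  fixes V :: "'v set" and f :: "'v \<times> 'v \<Rightarrow> real"
  assumes fin: "finite V" and f: "\<And>x. x \<in> V \<times> V \<Longrightarrow> 0 \<le> f x \<and> f x \<le> 1"
  obtains c :: "nat \<Rightarrow> 'v \<Rightarrow> nat"
  where "\<And>v. c 0 v = 0" "\<And>l v. c l v = c (Suc l) v div 4"
    "\<And>l. l > 0 \<Longrightarrow> cut_bounded V (\<lambda>x. f x - pair_mean V (c l) f x) (2 * (real (card V))\<^sup>2 / sqrt (real l))"
proof -
  define E where "E c = (\<Sum>x\<in>V \<times> V. (pair_mean V c f x)\<^sup>2)" for c
  define m where "m = real (card V)"
  define step where "step c c' K \<longleftrightarrow> (\<forall>v. c v = c' v div 4) \<and> cut_bounded V (\<lambda>x. f x - pair_mean V c f x) K \<and>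
    0 \<le> K \<and> K\<^sup>2 \<le> m\<^sup>2 * (E c' - E c)" for c c' :: "'v \<Rightarrow> nat" and K
  have "\<exists>c' K. step c c' K" for c :: "'v \<Rightarrow> nat"
    by (rule colouring_step[OF fin, of c f]) (auto simp: step_def E_def m_def)
  then obtain nxt Kc where nxt: "\<And>c. step c (nxt c) (Kc c)"
    by metis
  define c where "c l = (nxt ^^ l) (\<lambda>_::'v. 0::nat)" for l
  define K where "K l = Kc (c l)" for l
  have c0: "c 0 = (\<lambda>_. 0)" by (simp add: c_def)
  have "step (c l) (c (Suc l)) (K l)" for l
    using nxt[of "c l"] by (simp add: c_def K_def)
  then have cs: "\<And>l v. c l v = c (Suc l) v div 4"
    and cb: "\<And>l. cut_bounded V (\<lambda>x. f x - pair_mean V (c l) f x) (K l)" "\<And>l. 0 \<le> K l"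
    and en: "\<And>l. (K l)\<^sup>2 \<le> m\<^sup>2 * (E (c (Suc l)) - E (c l))"
    unfolding step_def by blast+
  have E_le: "E c' \<le> m\<^sup>2" for c'
  proof -
    have "E c' \<le> (\<Sum>x\<in>V \<times> V. 1)"
      unfolding E_def using cmean_range[of "V \<times> V" f "map_prod c' c'"] f
      by (intro sum_mono) (auto simp: power_le_one)
    then show ?thesis by (simp add: m_def card_cartesian_product power2_eq_square)
  qed
  have refine: "c j v = c (j + d) v div 4 ^ d" for j d v
    by (induction d) (auto simp: cs[of "j + _"] div_mult2_eq[symmetric] mult.commute)
  have sumK: "(\<Sum>j<l. (K j)\<^sup>2) \<le> m\<^sup>2 * m\<^sup>2" for l
  proof -
    have "(\<Sum>j<l. (K j)\<^sup>2) \<le> (\<Sum>j<l. m\<^sup>2 * (E (c (Suc j)) - E (c j)))" by (intro sum_mono en)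
    also have "\<dots> = m\<^sup>2 * (E (c l) - E (c 0))"
      using sum_lessThan_telescope[of "\<lambda>j. E (c j)" l] by (simp add: sum_distrib_left[symmetric])
    also have "\<dots> \<le> m\<^sup>2 * m\<^sup>2"
    proof (intro mult_left_mono)
      have "0 \<le> E (c 0)" unfolding E_def by (intro sum_nonneg) auto
      then show "E (c l) - E (c 0) \<le> m\<^sup>2" using E_le[of "c l"] by linarith
    qed auto
    finally show ?thesis .
  qed
  show thesis
  proof
    show "c 0 v = 0" "c l v = c (Suc l) v div 4" for l v using c0 cs[of l v] by simp_all
    fix l :: nat assume l: "l > 0"
    have "\<exists>j<l. K j \<le> m\<^sup>2 / sqrt l"
    proof (rule ccontr)
      assume "\<not> ?thesis"
      then have *: "m\<^sup>2 / sqrt l < K j" if "j < l" for j using that by force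
      have "(\<Sum>j<l. (m\<^sup>2 / sqrt l)\<^sup>2) < (\<Sum>j<l. (K j)\<^sup>2)"
        using * l by (intro sum_strict_mono power_strict_mono) auto
      then show False using sumK[of l] l by (simp add: power_divide power2_eq_square)
    qed
    then obtain j where j: "j < l" "K j \<le> m\<^sup>2 / sqrt l" by auto
    have "cut_bounded V (\<lambda>x. f x - pair_mean V (c l) f x) (2 * K j)"
      using refine[of j _ "l - j"] j(1)
      by (intro cut_bounded_refine[OF fin _ cb(1), where g="\<lambda>n. n div 4 ^ (l - j)"]) auto
    then show "cut_bounded V (\<lambda>x. f x - pair_mean V (c l) f x) (2 * (real (card V))\<^sup>2 / sqrt (real l))"
      by (rule cut_bounded_mono) (use j in \<open>auto simp: m_def\<close>)
  qed
qed

section \<open>The counting lemma for the cut norm\<close>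

lemma sum_PiE_insert:
  assumes "i \<notin> I"
  shows "(\<Sum>\<phi>\<in>PiE (insert i I) S. h \<phi>) = (\<Sum>u\<in>S i. \<Sum>\<psi>\<in>PiE I S. h (\<psi>(i := u)))"
proof -
  have "(\<Sum>\<phi>\<in>PiE (insert i I) S. h \<phi>) = (\<Sum>(u, \<psi>)\<in>S i \<times> PiE I S. h (\<psi>(i := u)))"
    unfolding PiE_insert_eq using inj_combinator[OF assms, of S]
    by (subst sum.reindex) (auto simp: case_prod_unfold)
  then show ?thesis by (simp add: sum.cartesian_product)
qed

definition oriented :: "nat \<Rightarrow> (nat \<times> nat) set \<Rightarrow> bool" where
  "oriented k E \<longleftrightarrow> E \<subseteq> {..<k} \<times> {..<k} \<and> (\<forall>(i, j)\<in>E. i \<noteq> j \<and> (j, i) \<notin> E)"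

text \<open>Every edge carries its own factor, so that factors can be exchanged one at a time. If
  all of them are the indicator of one relation, this is the number of homomorphisms.\<close>

definition edge_sum :: "'v set \<Rightarrow> nat \<Rightarrow> (nat \<times> nat) set \<Rightarrow> (nat \<times> nat \<Rightarrow> 'v \<times> 'v \<Rightarrow> real) \<Rightarrow> real" where
  "edge_sum V k E F = (\<Sum>\<phi>\<in>{..<k} \<rightarrow>\<^sub>E V. \<Prod>e\<in>E. F e (map_prod \<phi> \<phi> e))"

text \<open>With all vertices other than the ends of the edge \<open>(i, j)\<close> fixed, the remaining factors form a
  product of a function of \<open>\<phi> i\<close> and a function of \<open>\<phi> j\<close>; this fails for an edge set that also
  contains \<open>(j, i)\<close>.\<close>

lemma edge_sum_swap:
  assumes fin: "finite V" and E: "oriented k E" and ij: "(i, j) \<in> E"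
    and F: "\<And>e x. e \<in> E \<Longrightarrow> x \<in> V \<times> V \<Longrightarrow> 0 \<le> F e x \<and> F e x \<le> 1"
    and FG: "\<And>e. e \<in> E - {(i, j)} \<Longrightarrow> F e = G e"
    and K: "cut_bounded V (\<lambda>x. F (i, j) x - G (i, j) x) (\<kappa> * (real (card V))\<^sup>2)"
  shows "\<bar>edge_sum V k E F - edge_sum V k E G\<bar> \<le> \<kappa> * real (card V) ^ k"
proof -
  have EE: "E \<subseteq> {..<k} \<times> {..<k}" and Eo: "\<And>i j. (i, j) \<in> E \<Longrightarrow> i \<noteq> j \<and> (j, i) \<notin> E"
    using E by (auto simp: oriented_def)
  have finE: "finite E" using EE by (rule finite_subset) auto
  have ne: "i \<noteq> j" "i < k" "j < k" using Eo ij EE by auto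
  define I where "I = {..<k} - {i, j}"
  have I: "{..<k} = insert i (insert j I)" "i \<notin> insert j I" "j \<notin> I" "finite I"
    using ne by (auto simp: I_def)
  have cardI: "card I + 2 = k"
    using card_insert_disjoint[of "insert j I" i] card_insert_disjoint[of I j] I by (metis add_2_eq_Suc' card_lessThan finite_insert)
  define D where "D x = F (i, j) x - G (i, j) x" for x
  \<comment> \<open>The factors over \<open>E1\<close> do not involve the vertex \<open>j\<close>.
    Those over \<open>E2\<close> touch \<open>j\<close> and hence avoid \<open>i\<close>: an edge on
    both could only be \<open>(i, j)\<close>, which is removed, or \<open>(j, i)\<close>, which
    orientation forbids.\<close>
  define E1 where "E1 = {e\<in>E - {(i, j)}. fst e \<noteq> j \<and> snd e \<noteq> j}"
  define E2 where "E2 = {e\<in>E - {(i, j)}. \<not> (fst e \<noteq> j \<and> snd e \<noteq> j)}"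
  define H where "H E \<phi> = (\<Prod>e\<in>E. F e (map_prod \<phi> \<phi> e))" for E and \<phi> :: "nat \<Rightarrow> 'a"
  have Hr: "0 \<le> H E' \<phi> \<and> H E' \<phi> \<le> 1" if "\<phi> \<in> {..<k} \<rightarrow>\<^sub>E V" "E' \<subseteq> E" for E' \<phi>
  proof -
    have "0 \<le> F e (map_prod \<phi> \<phi> e) \<and> F e (map_prod \<phi> \<phi> e) \<le> 1" if "e \<in> E'" for e
      using that \<open>E' \<subseteq> E\<close> EE \<open>\<phi> \<in> _\<close> by (intro F) (auto simp: PiE_iff map_prod_def)
    then show ?thesis unfolding H_def by (auto intro!: prod_nonneg prod_le_1)
  qed
  have split: "(\<Prod>e\<in>E - {(i, j)}. F e (map_prod \<phi> \<phi> e)) = H E1 \<phi> * H E2 \<phi>" for \<phi>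
  proof -
    have "E - {(i, j)} = E1 \<union> E2" "E1 \<inter> E2 = {}" "finite E1" "finite E2"
      using finE by (auto simp: E1_def E2_def)
    then show ?thesis by (simp add: H_def prod.union_disjoint)
  qed
  have "edge_sum V k E F - edge_sum V k E G = (\<Sum>\<phi>\<in>{..<k} \<rightarrow>\<^sub>E V. D (\<phi> i, \<phi> j) * (H E1 \<phi> * H E2 \<phi>))"
    unfolding edge_sum_def sum_subtractf[symmetric]
  proof (intro sum.cong refl)
    fix \<phi>
    have "(\<Prod>e\<in>E - {(i, j)}. G e (map_prod \<phi> \<phi> e)) = (\<Prod>e\<in>E - {(i, j)}. F e (map_prod \<phi> \<phi> e))"
      by (intro prod.cong) (auto simp: FG)
    then show "(\<Prod>e\<in>E. F e (map_prod \<phi> \<phi> e)) - (\<Prod>e\<in>E. G e (map_prod \<phi> \<phi> e)) = D (\<phi> i, \<phi> j) * (H E1 \<phi> * H E2 \<phi>)"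
      by (simp add: prod.remove[OF finE ij] split D_def left_diff_distrib)
  qed
  also have "\<dots> = (\<Sum>u\<in>V. \<Sum>v\<in>V. \<Sum>\<psi>\<in>I \<rightarrow>\<^sub>E V. H E1 (\<psi>(j := v, i := u)) * H E2 (\<psi>(j := v, i := u)) * D (u, v))"
    unfolding I(1) sum_PiE_insert[OF I(2)] sum_PiE_insert[OF I(3)] using ne by (simp add: mult_ac)
  also have "\<dots> = (\<Sum>u\<in>V. \<Sum>\<psi>\<in>I \<rightarrow>\<^sub>E V. \<Sum>v\<in>V. H E1 (\<psi>(j := v, i := u)) * H E2 (\<psi>(j := v, i := u)) * D (u, v))"
    by (intro sum.cong refl sum.swap)
  also have "\<dots> = (\<Sum>\<psi>\<in>I \<rightarrow>\<^sub>E V. \<Sum>u\<in>V. \<Sum>v\<in>V. H E1 (\<psi>(j := v, i := u)) * H E2 (\<psi>(j := v, i := u)) * D (u, v))"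
    by (rule sum.swap)
  also have "\<dots> = (\<Sum>\<psi>\<in>I \<rightarrow>\<^sub>E V. \<Sum>(u, v)\<in>V \<times> V. H E1 (\<psi>(j := v, i := u)) * H E2 (\<psi>(j := v, i := u)) * D (u, v))"
    by (simp add: sum.cartesian_product)
  finally have eq: "edge_sum V k E F - edge_sum V k E G = \<dots>" .
  have "\<bar>\<Sum>(u, v)\<in>V \<times> V. H E1 (\<psi>(j := v, i := u)) * H E2 (\<psi>(j := v, i := u)) * D (u, v)\<bar> \<le> \<kappa> * (real (card V))\<^sup>2"
    if psi: "\<psi> \<in> I \<rightarrow>\<^sub>E V" for \<psi>
  proof (cases "V = {}")
    case True
    then show ?thesis by simp
  next
    case False
    \<comment> \<open>An arbitrary vertex, inserted into the coordinate on which a factor does not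
      depend.\<close>
    then obtain w where w: "w \<in> V" by auto
    have upd: "\<psi>(j := v, i := u) \<in> {..<k} \<rightarrow>\<^sub>E V" if "u \<in> V" "v \<in> V" for u v
      using that psi I by (auto simp: PiE_iff extensional_def)
    have 1: "H E1 (\<psi>(j := v, i := u)) = H E1 (\<psi>(j := w, i := u))" for u v
      unfolding H_def by (intro prod.cong arg_cong2[where f=F]) (auto simp: E1_def map_prod_def split: prod.splits)
    have E2i: "fst e \<noteq> i \<and> snd e \<noteq> i" if "e \<in> E2" for e
      using that Eo[of "fst e" "snd e"] Eo[OF ij] by (cases e) (auto simp: E2_def)
    have 2: "H E2 (\<psi>(j := v, i := u)) = H E2 (\<psi>(j := v, i := w))" for u v
      unfolding H_def using E2i by (intro prod.cong arg_cong2[where f=F]) (auto simp: map_prod_def split: prod.splits dest: E2i)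
    have "\<bar>\<Sum>(u, v)\<in>V \<times> V. H E1 (\<psi>(j := w, i := u)) * H E2 (\<psi>(j := v, i := w)) * D (u, v)\<bar> \<le> \<kappa> * (real (card V))\<^sup>2"
    proof (rule K[unfolded cut_bounded_def D_def[symmetric], rule_format])
      show "0 \<le> H E1 (\<psi>(j := w, i := u)) \<and> H E1 (\<psi>(j := w, i := u)) \<le> 1" if "u \<in> V" for u
        by (intro Hr upd that w) (auto simp: E1_def)
      show "0 \<le> H E2 (\<psi>(j := v, i := w)) \<and> H E2 (\<psi>(j := v, i := w)) \<le> 1" if "v \<in> V" for v
        by (intro Hr upd that w) (auto simp: E2_def)
    qed
    moreover have "(\<Sum>(u, v)\<in>V \<times> V. H E1 (\<psi>(j := w, i := u)) * H E2 (\<psi>(j := v, i := w)) * D (u, v))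
        = (\<Sum>(u, v)\<in>V \<times> V. H E1 (\<psi>(j := v, i := u)) * H E2 (\<psi>(j := v, i := u)) * D (u, v))"
    proof (intro sum.cong refl)
      fix x :: "'a \<times> 'a"
      show "(case x of (u, v) \<Rightarrow> H E1 (\<psi>(j := w, i := u)) * H E2 (\<psi>(j := v, i := w)) * D (u, v))
          = (case x of (u, v) \<Rightarrow> H E1 (\<psi>(j := v, i := u)) * H E2 (\<psi>(j := v, i := u)) * D (u, v))"
        using 1[of "snd x" "fst x"] 2[of "snd x" "fst x"] by (simp add: case_prod_unfold)
    qed
    ultimately show ?thesis by simp
  qed
  then have "\<bar>edge_sum V k E F - edge_sum V k E G\<bar> \<le> (\<Sum>\<psi>\<in>I \<rightarrow>\<^sub>E V. \<kappa> * (real (card V))\<^sup>2)"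
    unfolding eq by (intro order_trans[OF sum_abs sum_mono])
  also have "\<dots> = \<kappa> * real (card V) ^ k"
    using I(4) by (simp add: card_PiE power_add power2_eq_square flip: cardI)
  finally show ?thesis .
qed

text \<open>Hybrid argument: induction on the set \<open>A\<close> of edges that carry
  \<open>f\<close> while the others carry \<open>g\<close>; each exchange costs one application of
  \<open>edge_sum_swap\<close>.\<close>

lemma edge_sum_cut:
  assumes fin: "finite V" and E: "oriented k E"
    and f: "\<And>x. x \<in> V \<times> V \<Longrightarrow> 0 \<le> f x \<and> f x \<le> 1" and g: "\<And>x. x \<in> V \<times> V \<Longrightarrow> 0 \<le> g x \<and> g x \<le> 1"
    and K: "cut_bounded V (\<lambda>x. f x - g x) (\<kappa> * (real (card V))\<^sup>2)"
  shows "\<bar>edge_sum V k E (\<lambda>_. f) - edge_sum V k E (\<lambda>_. g)\<bar> \<le> real (card E) * \<kappa> * real (card V) ^ k"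
proof -
  have finE: "finite E" using E by (auto simp: oriented_def intro: finite_subset)
  have "\<bar>edge_sum V k E (\<lambda>e. if e \<in> A then f else g) - edge_sum V k E (\<lambda>_. g)\<bar> \<le> real (card A) * \<kappa> * real (card V) ^ k"
    if "finite A" "A \<subseteq> E" for A
    using that
  proof (induction A)
    case (insert e A)
    have "\<bar>edge_sum V k E (\<lambda>e'. if e' \<in> insert e A then f else g) - edge_sum V k E (\<lambda>e. if e \<in> A then f else g)\<bar>
        \<le> \<kappa> * real (card V) ^ k"
      using insert.prems insert.hyps f g K
      by (intro edge_sum_swap[OF fin E, of "fst e" "snd e"]) auto
    with insert show ?case by (auto simp: algebra_simps abs_le_iff)
  qed simp
  from this[OF finE order_refl]
  have "\<bar>edge_sum V k E (\<lambda>e. if e \<in> E then f else g) - edge_sum V k E (\<lambda>_. g)\<bar> \<le> real (card E) * \<kappa> * real (card V) ^ k" .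
  moreover have "edge_sum V k E (\<lambda>e. if e \<in> E then f else g) = edge_sum V k E (\<lambda>_. f)"
    by (simp add: edge_sum_def)
  ultimately show ?thesis by simp
qed

text \<open>The maps with a given colour vector \<open>s\<close> form a product of colour classes,
  so their number is the product of the class sizes.\<close>

lemma sum_PiE_colours:
  assumes fin: "finite V" "finite I" and c: "\<And>v. v \<in> V \<Longrightarrow> c v \<in> B" "finite B"
  shows "(\<Sum>\<phi>\<in>I \<rightarrow>\<^sub>E V. h (\<lambda>i\<in>I. c (\<phi> i))) = (\<Sum>s\<in>I \<rightarrow>\<^sub>E B. (\<Prod>i\<in>I. real (card {v\<in>V. c v = s i})) * h s)"
proof -
  have "(\<Sum>\<phi>\<in>I \<rightarrow>\<^sub>E V. h (\<lambda>i\<in>I. c (\<phi> i))) = (\<Sum>s\<in>I \<rightarrow>\<^sub>E B. \<Sum>\<phi>\<in>{\<phi>\<in>I \<rightarrow>\<^sub>E V. (\<lambda>i\<in>I. c (\<phi> i)) = s}. h (\<lambda>i\<in>I. c (\<phi> i)))"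
    using fin c by (intro sum.group[symmetric] finite_PiE) (auto simp: PiE_iff)
  also have "\<dots> = (\<Sum>s\<in>I \<rightarrow>\<^sub>E B. (\<Prod>i\<in>I. real (card {v\<in>V. c v = s i})) * h s)"
  proof (intro sum.cong refl)
    fix s assume s: "s \<in> I \<rightarrow>\<^sub>E B"
    have "{\<phi>\<in>I \<rightarrow>\<^sub>E V. (\<lambda>i\<in>I. c (\<phi> i)) = s} = (\<Pi>\<^sub>E i\<in>I. {v\<in>V. c v = s i})"
      using s by (auto simp: PiE_iff fun_eq_iff extensional_def restrict_def)
    then have "card {\<phi>\<in>I \<rightarrow>\<^sub>E V. (\<lambda>i\<in>I. c (\<phi> i)) = s} = (\<Prod>i\<in>I. card {v\<in>V. c v = s i})"
      using fin by (simp add: card_PiE)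
    moreover have "(\<Sum>\<phi>\<in>{\<phi>\<in>I \<rightarrow>\<^sub>E V. (\<lambda>i\<in>I. c (\<phi> i)) = s}. h (\<lambda>i\<in>I. c (\<phi> i)))
        = (\<Sum>\<phi>\<in>{\<phi>\<in>I \<rightarrow>\<^sub>E V. (\<lambda>i\<in>I. c (\<phi> i)) = s}. h s)"
      by (intro sum.cong) auto
    ultimately show "(\<Sum>\<phi>\<in>{\<phi>\<in>I \<rightarrow>\<^sub>E V. (\<lambda>i\<in>I. c (\<phi> i)) = s}. h (\<lambda>i\<in>I. c (\<phi> i))) = (\<Prod>i\<in>I. real (card {v\<in>V. c v = s i})) * h s"
      by simp
  qed
  finally show ?thesis .
qed

section \<open>Limits of step kernels\<close>

text \<open>By monotone convergence the sum has finite integral and is therefore finite almost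
  everywhere. This yields all almost sure limits below: of the step kernels, of their local
  oscillations, and of the sampled densities along squares.\<close>

lemma AE_summable_of_summable_integral:
  fixes g :: "nat \<Rightarrow> 'a \<Rightarrow> real"
  assumes int: "\<And>k. integrable M (g k)" and nonneg: "\<And>k x. x \<in> space M \<Longrightarrow> 0 \<le> g k x"
    and sm: "summable (\<lambda>k. \<integral>x. g k x \<partial>M)"
  shows "AE x in M. summable (\<lambda>k. g k x)"
proof -
  have [measurable]: "\<And>k. g k \<in> borel_measurable M" using int by auto
  have "(\<integral>\<^sup>+x. (\<Sum>k. ennreal (g k x)) \<partial>M) = (\<Sum>k. \<integral>\<^sup>+x. ennreal (g k x) \<partial>M)"
    by (rule nn_integral_suminf) auto
  also have "\<dots> = (\<Sum>k. ennreal (\<integral>x. g k x \<partial>M))"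
    using int nonneg by (intro suminf_cong nn_integral_eq_integral) auto
  also have "\<dots> \<noteq> \<infinity>"
    using sm nonneg by (subst suminf_ennreal2) (auto intro!: integral_nonneg)
  finally have "AE x in M. (\<Sum>k. ennreal (g k x)) \<noteq> \<infinity>"
    by (intro nn_integral_PInf_AE) auto
  then show ?thesis
  proof (rule AE_mp, intro AE_I2 impI)
    fix x assume "x \<in> space M" "(\<Sum>k. ennreal (g k x)) \<noteq> \<infinity>"
    then show "summable (\<lambda>k. g k x)"
      using nonneg by (intro summable_suminf_not_top) auto
  qed
qed

text \<open>Integration of the arithmetic-geometric inequality between \<open>c\<close> and
  \<open>(f x)\<^sup>2 / c\<close>.\<close>

lemma (in prob_space) integral_abs_le_of_square:
  fixes f :: "'a \<Rightarrow> real"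
  assumes "integrable M f" "integrable M (\<lambda>x. (f x)\<^sup>2)" "(\<integral>x. (f x)\<^sup>2 \<partial>M) \<le> c\<^sup>2" "c > 0"
  shows "(\<integral>x. \<bar>f x\<bar> \<partial>M) \<le> c"
proof -
  have "\<bar>f x\<bar> \<le> (c + (f x)\<^sup>2 / c) / 2" for x
  proof -
    have "0 \<le> (\<bar>f x\<bar> - c)\<^sup>2" by simp
    then have "2 * c * \<bar>f x\<bar> \<le> c\<^sup>2 + (f x)\<^sup>2" by (simp add: power2_diff mult_ac)
    then show ?thesis using assms(4) by (simp add: field_simps power2_eq_square)
  qed
  then have "(\<integral>x. \<bar>f x\<bar> \<partial>M) \<le> (\<integral>x. (c + (f x)\<^sup>2 / c) / 2 \<partial>M)"
    using assms by (intro integral_mono) auto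
  also have "\<dots> = (c + (\<integral>x. (f x)\<^sup>2 \<partial>M) / c) / 2"
    using assms by (simp add: prob_space)
  also have "\<dots> \<le> c" using assms(3,4) by (simp add: field_simps power2_eq_square)
  finally show ?thesis .
qed

text \<open>Measurability is asked only of the fibres over \<open>B\<close>, and values outside
  \<open>B\<close> are allowed on a null set; this suits colourings with exceptional
  colours.\<close>

lemma (in prob_space) integral_finitely_valued:
  fixes h :: "'b \<Rightarrow> real"
  assumes "finite B" "\<And>s. s \<in> B \<Longrightarrow> {x\<in>space M. C x = s} \<in> sets M"
    and ae: "AE x in M. C x \<in> B" and m: "(\<lambda>x. h (C x)) \<in> borel_measurable M"
  shows "(\<integral>x. h (C x) \<partial>M) = (\<Sum>s\<in>B. measure M {x\<in>space M. C x = s} * h s)"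
proof -
  have "AE x in M. h (C x) = (\<Sum>s\<in>B. indicator {x\<in>space M. C x = s} x * h s)"
    using ae
  proof (rule AE_mp, intro AE_I2 impI)
    fix x assume x: "x \<in> space M" "C x \<in> B"
    have "(\<Sum>s\<in>B. indicator {x\<in>space M. C x = s} x * h s) = (\<Sum>s\<in>B. if s = C x then h s else 0)"
      using x by (intro sum.cong) (auto simp: indicator_def)
    then show "h (C x) = (\<Sum>s\<in>B. indicator {x\<in>space M. C x = s} x * h s)"
      using x assms(1) by simp
  qed
  then have "(\<integral>x. h (C x) \<partial>M) = (\<integral>x. (\<Sum>s\<in>B. indicator {x\<in>space M. C x = s} x * h s) \<partial>M)"
    using assms(2) m by (intro integral_cong_AE borel_measurable_sum borel_measurable_times borel_measurable_indicator) auto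
  also have "\<dots> = (\<Sum>s\<in>B. (\<integral>x. indicator {x\<in>space M. C x = s} x * h s \<partial>M))"
    using assms(2) by (intro Bochner_Integration.integral_sum integrable_mult_left)
      (auto intro!: integrable_real_indicator simp: emeasure_eq_measure)
  also have "\<dots> = (\<Sum>s\<in>B. measure M {x\<in>space M. C x = s} * h s)"
  proof (intro sum.cong refl)
    fix s assume "s \<in> B"
    have "{x\<in>space M. C x = s} \<inter> space M = {x\<in>space M. C x = s}" by auto
    then show "(\<integral>x. indicator {x\<in>space M. C x = s} x * h s \<partial>M) = measure M {x\<in>space M. C x = s} * h s"
      by simp
  qed
  finally show ?thesis .
qed

section \<open>Realising nested class sizes on the unit interval\<close>

text \<open>Points of \<open>[0, 1)\<close> are coloured so that the colour classes of each level are consecutive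
  intervals of the prescribed lengths \<open>\<mu> l a\<close>; points outside get colours of measure zero.\<close>

lemma interval_colouring:
  fixes \<mu> :: "nat \<Rightarrow> nat \<Rightarrow> real"
  assumes nn: "\<And>l a. 0 \<le> \<mu> l a" and one: "\<And>l. (\<Sum>a<4^l. \<mu> l a) = 1"
    and ref: "\<And>l a. a < 4^l \<Longrightarrow> \<mu> l a = (\<Sum>r<4. \<mu> (Suc l) (4 * a + r))"
  defines "N \<equiv> uniform_measure lborel {0..<1::real}"
  obtains col :: "nat \<Rightarrow> real \<Rightarrow> nat"
  where "\<And>l. col l \<in> measurable N (count_space UNIV)" "\<And>l x. col l x = col (Suc l) x div 4"
    "\<And>l. AE x in N. col l x < 4 ^ l" "\<And>l a. a < 4^l \<Longrightarrow> measure N {x. col l x = a} = \<mu> l a"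
proof -
  define A where "A l a = (\<Sum>b<a. \<mu> l b)" for l a
  \<comment> \<open>Negative points get colour 0, and points from 1 on get the extra colour
    \<open>4 ^ l\<close>, which is again compatible with \<open>div 4\<close>. Both sets of points
    are null for \<open>N\<close>.\<close>
  define col where "col l x = (if x < 1 then LEAST a. x < A l (Suc a) else 4 ^ l)" for l and x :: real
  have A0: "A l 0 = 0" and A1: "A l (4 ^ l) = 1" for l by (simp_all add: A_def one)
  have Amono: "mono (A l)" for l
    unfolding A_def using nn by (intro monoI sum_mono2) auto
  have AS: "A (Suc l) (4 * a) = A l a" if "a \<le> 4 ^ l" for l a
    using that
  proof (induction a)
    case (Suc a)
    have "A (Suc l) (4 * Suc a) = A (Suc l) (4 * a) + (\<Sum>r<4. \<mu> (Suc l) (4 * a + r))"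
      by (simp add: A_def numeral_eq_Suc)
    also have "\<dots> = A l (Suc a)" using Suc ref[of a l] by (simp add: A_def)
    finally show ?case .
  qed (simp add: A0)
  \<comment> \<open>Bounding the colour from above is more robust than fixing it: the equivalence
    holds also when classes are empty and \<open>A l\<close> repeats values. It is used for
    measurability as well as for compatibility of the levels.\<close>
  have le_iff: "col l x \<le> a \<longleftrightarrow> x < A l (Suc a)" if "x < 1" "a < 4 ^ l" for l x a
  proof -
    have ex: "x < A l (Suc (4 ^ l - 1))" using that A1[of l] by simp
    show ?thesis
    proof
      assume "col l x \<le> a"
      moreover have "x < A l (Suc (LEAST a. x < A l (Suc a)))"
        by (rule LeastI[of "\<lambda>a. x < A l (Suc a)"]) (rule ex)
      ultimately show "x < A l (Suc a)"
        using that monoD[OF Amono, of "Suc (col l x)" "Suc a" l] by (simp add: col_def)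
    next
      assume "x < A l (Suc a)"
      then show "col l x \<le> a" using that by (auto simp: col_def intro: Least_le)
    qed
  qed
  have lt: "col l x < 4 ^ l" if "x < 1" for l x
  proof -
    have p: "0 < (4::nat) ^ l" by simp
    then have "col l x \<le> 4 ^ l - 1"
      using le_iff[OF that, of "4 ^ l - 1" l] that A1[of l] by simp
    then show ?thesis using p by linarith
  qed
  have eq_iff: "col l x = a \<longleftrightarrow> x < A l (Suc a) \<and> (a = 0 \<or> A l a \<le> x)" if "x < 1" "a < 4 ^ l" for l x a
    using le_iff[OF that] le_iff[OF that(1), of "a - 1" l] that(2) by (cases a) (auto simp: not_less)
  have ge1: "col l x = 4 ^ l" if "\<not> x < 1" for l x using that by (simp add: col_def)
  have cdiv: "col l x = col (Suc l) x div 4" for l x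
  proof (cases "x < 1")
    case True
    have *: "col (Suc l) x div 4 \<le> a \<longleftrightarrow> col l x \<le> a" if "a < 4 ^ l" for a
    proof -
      have "col (Suc l) x div 4 \<le> a \<longleftrightarrow> col (Suc l) x \<le> 4 * a + 3" by linarith
      also have "\<dots> \<longleftrightarrow> x < A (Suc l) (4 * Suc a)"
        using le_iff[OF True, of "4 * a + 3" "Suc l"] that by (simp add: numeral_eq_Suc)
      also have "\<dots> \<longleftrightarrow> col l x \<le> a"
        using le_iff[OF True that] AS[of "Suc a" l] that by simp
      finally show ?thesis .
    qed
    have "col (Suc l) x div 4 < 4 ^ l" using lt[OF True, of "Suc l"] by (simp add: div_less_iff_less_mult mult.commute)
    then show ?thesis using *[of "col l x"] *[of "col (Suc l) x div 4"] lt[OF True, of l] by simp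
  qed (simp add: ge1)
  have set_eq: "{x. col l x = a} \<inter> {0..<1} = {A l a..<A l (Suc a)}" if "a < 4 ^ l" for l a
  proof -
    have "A l a \<ge> 0" "A l (Suc a) \<le> 1"
      using monoD[OF Amono, of 0 a l] monoD[OF Amono, of "Suc a" "4 ^ l" l] that A0 A1 by auto
    then show ?thesis using eq_iff[OF _ that] A0[of l] by (cases "a = 0") force+
  qed
  have sets: "{x. col l x = a} \<in> sets borel" for l a
  proof -
    have 1: "{x. col l x = a} = ({x. x < 1} \<inter> {x. x < A l (Suc a)} \<inter> {x. a = 0 \<or> A l a \<le> x}) \<union> ({x. x \<ge> 1} \<inter> {x. a = 4 ^ l})" if "a < 4 ^ l"
    proof (rule set_eqI)
      fix x
      show "x \<in> {x. col l x = a} \<longleftrightarrow> x \<in> ({x. x < 1} \<inter> {x. x < A l (Suc a)} \<inter> {x. a = 0 \<or> A l a \<le> x}) \<union> ({x. x \<ge> 1} \<inter> {x. a = 4 ^ l})"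
        using eq_iff[OF _ that, of x] ge1[of x l] that by (cases "x < 1") auto
    qed
    have 2: "{x. col l x = a} = {x. x \<ge> 1} \<inter> {x. a = 4 ^ l}" if "\<not> a < 4 ^ l"
    proof (rule set_eqI)
      fix x
      show "x \<in> {x. col l x = a} \<longleftrightarrow> x \<in> {x. x \<ge> 1} \<inter> {x. a = 4 ^ l}"
        using lt[of x l] ge1[of x l] that by (cases "x < 1") auto
    qed
    show ?thesis by (cases "a < 4 ^ l") (simp_all add: 1 2)
  qed
  show thesis
  proof
    show "col l \<in> measurable N (count_space UNIV)" for l
      using sets[of l] by (subst measurable_count_space_eq2_countable) (auto simp: N_def vimage_def)
    show "col l x = col (Suc l) x div 4" for l x by (rule cdiv)
    show "AE x in N. col l x < 4 ^ l" for l
      unfolding N_def by (intro AE_uniform_measureI AE_I2) (auto intro: lt)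
    fix l a :: nat assume a: "a < 4 ^ l"
    have "measure N {x. col l x = a} = measure lborel ({0..<1} \<inter> {x. col l x = a}) / measure lborel {0..<1::real}"
      unfolding N_def by (rule measure_uniform_measure) (use sets in auto)
    also have "\<dots> = A l (Suc a) - A l a"
      using set_eq[OF a] monoD[OF Amono, of a "Suc a" l] by (simp add: Int_commute)
    also have "\<dots> = \<mu> l a" by (simp add: A_def)
    finally show "measure N {x. col l x = a} = \<mu> l a" .
  qed
qed

section \<open>Nested cells and the martingale of step kernels\<close>

lemma sum_div4:
  fixes F :: "nat \<Rightarrow> real"
  shows "(\<Sum>a<4 ^ Suc l. F a) = (\<Sum>a<4 ^ l. \<Sum>r<4. F (4 * a + r))"
proof -
  have "(\<Sum>a<4 * n. F a) = (\<Sum>a<n. \<Sum>r<4. F (4 * a + r))" for n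
    by (induction n) (simp_all add: numeral_eq_Suc add_ac)
  then show ?thesis by simp
qed

text \<open>Here \<open>\<nu> l a b\<close> is the mass that the kernel to be constructed puts on
  the product of two cells. The bound \<open>\<nu>_le\<close> keeps densities in [0,1], and the
  additivity \<open>\<nu>_split\<close> makes them a martingale.\<close>

locale nested_cells = prob_space N for N :: "'a measure" +
  fixes col :: "nat \<Rightarrow> 'a \<Rightarrow> nat" and \<nu> :: "nat \<Rightarrow> nat \<Rightarrow> nat \<Rightarrow> real" and \<mu> :: "nat \<Rightarrow> nat \<Rightarrow> real"
  assumes col [measurable]: "\<And>l. col l \<in> measurable N (count_space UNIV)"
    and col_div: "\<And>l x. col l x = col (Suc l) x div 4"
    and col_less: "\<And>l. AE x in N. col l x < 4 ^ l"
    and \<mu>: "\<And>l a. \<mu> l a = measure N {x\<in>space N. col l x = a}"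
    and \<nu>_nonneg: "\<And>l a b. 0 \<le> \<nu> l a b" and \<nu>_le: "\<And>l a b. \<nu> l a b \<le> \<mu> l a * \<mu> l b"
    and \<nu>_split: "\<And>l a b. a < 4 ^ l \<Longrightarrow> b < 4 ^ l \<Longrightarrow>
      \<nu> l a b = (\<Sum>r<4. \<Sum>s<4. \<nu> (Suc l) (4 * a + r) (4 * b + s))"
begin

definition w :: "nat \<Rightarrow> nat \<Rightarrow> nat \<Rightarrow> real" where
  "w l a b = \<nu> l a b / (\<mu> l a * \<mu> l b)"

definition U :: "nat \<Rightarrow> 'a \<times> 'a \<Rightarrow> real" where
  "U l p = w l (col l (fst p)) (col l (snd p))"

abbreviation N2 :: "('a \<times> 'a) measure" where "N2 \<equiv> N \<Otimes>\<^sub>M N"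

sublocale P: pair_prob_space N N ..

lemma \<mu>_nonneg: "0 \<le> \<mu> l a" by (simp add: \<mu>)

lemma w_range: "0 \<le> w l a b \<and> w l a b \<le> 1"
  unfolding w_def using \<nu>_nonneg[of l a b] \<nu>_le[of l a b] \<mu>_nonneg[of l a] \<mu>_nonneg[of l b]
  by (cases "\<mu> l a = 0 \<or> \<mu> l b = 0") (auto simp: divide_le_eq less_le)

text \<open>On a null product of cells the default density 0 is consistent, since
  \<open>\<nu>_le\<close> forces the mass to vanish there.\<close>

lemma w_mult: "\<mu> l a * \<mu> l b * w l a b = \<nu> l a b"
  unfolding w_def using \<nu>_nonneg[of l a b] \<nu>_le[of l a b] by (cases "\<mu> l a * \<mu> l b = 0") auto

lemma U_range: "0 \<le> U l p \<and> U l p \<le> 1"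
  unfolding U_def by (rule w_range)

lemma measurable_cells:
  "(\<lambda>p. h (col l (fst p)) (col l (snd p)) :: real) \<in> borel_measurable N2"
  by measurable

lemma U_measurable [measurable]: "U l \<in> borel_measurable N2"
  unfolding U_def[abs_def] by (rule measurable_cells)

lemma integrable_bounded:
  fixes f :: "'a \<times> 'a \<Rightarrow> real"
  assumes "f \<in> borel_measurable N2" "\<And>p. p \<in> space N2 \<Longrightarrow> \<bar>f p\<bar> \<le> B"
  shows "integrable N2 f"
  using assms by (intro P.integrable_const_bound[of _ B]) auto

lemma integral_cells:
  "(\<integral>p. h (col l (fst p)) (col l (snd p)) \<partial>N2) = (\<Sum>a<4 ^ l. \<Sum>b<4 ^ l. \<mu> l a * \<mu> l b * h a b)"
proof -
  define C where "C p = (col l (fst p), col l (snd p))" for p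
  define B where "B = {..<4 ^ l :: nat} \<times> {..<4 ^ l :: nat}"
  have set_eq: "{p\<in>space N2. C p = s} = {x\<in>space N. col l x = fst s} \<times> {x\<in>space N. col l x = snd s}" for s
    by (auto simp: C_def space_pair_measure)
  have "AE p in N2. C p \<in> B"
  proof (rule P.AE_pair_measure)
    show "AE x in N. AE y in N. C (x, y) \<in> B"
      using col_less[of l] by (auto simp: C_def B_def elim!: AE_mp)
  qed (simp add: C_def B_def)
  then have "(\<integral>p. case_prod h (C p) \<partial>N2) = (\<Sum>s\<in>B. measure N2 {p\<in>space N2. C p = s} * case_prod h s)"
    by (intro P.integral_finitely_valued) (auto simp: B_def set_eq C_def)
  also have "\<dots> = (\<Sum>s\<in>B. \<mu> l (fst s) * \<mu> l (snd s) * case_prod h s)"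
    unfolding set_eq by (intro sum.cong refl) (simp add: \<mu> measure_def emeasure_pair_measure_Times enn2real_mult)
  also have "\<dots> = (\<Sum>a<4 ^ l. \<Sum>b<4 ^ l. \<mu> l a * \<mu> l b * h a b)"
    by (simp add: B_def sum.cartesian_product case_prod_unfold)
  finally show ?thesis by (simp add: C_def)
qed

lemma col_div_pow: "col l x = col (l + d) x div 4 ^ d"
proof (induction d)
  case (Suc d)
  then show ?case by (simp add: col_div[of "l + d"] div_mult2_eq[symmetric] mult.commute)
qed simp

text \<open>The martingale property in weak form, with test functions constant on cells of level
  \<open>l\<close>. By \<open>w_mult\<close> both integrals are sums of cell masses, and masses are
  additive.\<close>

lemma martingale_step:
  "(\<integral>p. U (Suc l) p * h (col l (fst p)) (col l (snd p)) \<partial>N2) = (\<integral>p. U l p * h (col l (fst p)) (col l (snd p)) \<partial>N2)"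
proof -
  have "(\<integral>p. U (Suc l) p * h (col l (fst p)) (col l (snd p)) \<partial>N2)
    = (\<Sum>a<4 ^ Suc l. \<Sum>b<4 ^ Suc l. \<mu> (Suc l) a * \<mu> (Suc l) b * (w (Suc l) a b * h (a div 4) (b div 4)))"
    unfolding U_def col_div[of l] by (rule integral_cells)
  also have "\<dots> = (\<Sum>a<4 ^ Suc l. \<Sum>b<4 ^ Suc l. \<nu> (Suc l) a b * h (a div 4) (b div 4))"
    by (simp add: mult.assoc[symmetric] w_mult)
  also have "\<dots> = (\<Sum>a<4 ^ l. \<Sum>r<4. \<Sum>b<4 ^ l. \<Sum>s<4. \<nu> (Suc l) (4 * a + r) (4 * b + s) * h a b)"
    unfolding sum_div4 by (intro sum.cong refl) simp
  also have "\<dots> = (\<Sum>a<4 ^ l. \<Sum>b<4 ^ l. \<Sum>r<4. \<Sum>s<4. \<nu> (Suc l) (4 * a + r) (4 * b + s) * h a b)"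
    by (intro sum.cong refl sum.swap)
  also have "\<dots> = (\<Sum>a<4 ^ l. \<Sum>b<4 ^ l. \<nu> l a b * h a b)"
    by (intro sum.cong refl) (simp add: \<nu>_split sum_distrib_right)
  also have "\<dots> = (\<Sum>a<4 ^ l. \<Sum>b<4 ^ l. \<mu> l a * \<mu> l b * (w l a b * h a b))"
    by (simp add: mult.assoc[symmetric] w_mult)
  also have "\<dots> = (\<integral>p. U l p * h (col l (fst p)) (col l (snd p)) \<partial>N2)"
    unfolding U_def by (rule integral_cells[symmetric])
  finally show ?thesis .
qed

lemma martingale:
  assumes "l \<le> m"
  shows "(\<integral>p. U m p * h (col l (fst p)) (col l (snd p)) \<partial>N2) = (\<integral>p. U l p * h (col l (fst p)) (col l (snd p)) \<partial>N2)"
  using assms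
proof (induction m rule: dec_induct)
  case (step m)
  have "col l x = col m x div 4 ^ (m - l)" for x
    using col_div_pow[of l x "m - l"] step by simp
  then have "(\<integral>p. U (Suc m) p * h (col l (fst p)) (col l (snd p)) \<partial>N2) = (\<integral>p. U m p * h (col l (fst p)) (col l (snd p)) \<partial>N2)"
    using martingale_step[of m "\<lambda>a b. h (a div 4 ^ (m - l)) (b div 4 ^ (m - l))"] by simp
  then show ?case using step by simp
qed simp

definition energy :: "nat \<Rightarrow> real" where "energy l = (\<integral>p. (U l p)\<^sup>2 \<partial>N2)"

text \<open>Orthogonality of martingale increments: \<open>U l\<close> is itself constant on cells
  of level \<open>l\<close>, so it may serve as the test function in
  \<open>martingale\<close>.\<close>

lemma energy_diff:
  assumes "l \<le> m"
  shows "(\<integral>p. (U m p - U l p)\<^sup>2 \<partial>N2) = energy m - energy l"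
proof -
  have b: "\<bar>U l p * U m p\<bar> \<le> 1" "\<bar>U m p * U l p\<bar> \<le> 1" for l m p
    using U_range[of l p] U_range[of m p] by (auto simp: abs_mult mult_le_one)
  have int: "integrable N2 (\<lambda>p. U l p * U m p)" for l m
    by (rule integrable_bounded[of _ 1]) (auto intro: b)
  have "(\<integral>p. U m p * U l p \<partial>N2) = (\<integral>p. U l p * U l p \<partial>N2)"
    using martingale[OF assms, of "w l"] by (simp add: U_def[of l])
  moreover have "(\<integral>p. (U m p - U l p)\<^sup>2 \<partial>N2) = (\<integral>p. (U m p * U m p + U l p * U l p) - 2 * (U m p * U l p) \<partial>N2)"
    by (intro Bochner_Integration.integral_cong refl) (simp add: power2_eq_square algebra_simps)
  ultimately show ?thesis
    using int by (simp add: energy_def power2_eq_square)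
qed

lemma energy_mono: "l \<le> m \<Longrightarrow> energy l \<le> energy m"
  using energy_diff[of l m] Bochner_Integration.integral_nonneg[of N2 "\<lambda>p. (U m p - U l p)\<^sup>2"] by auto

lemma energy_le_1: "energy l \<le> 1"
proof -
  have "energy l \<le> (\<integral>p. 1 \<partial>N2)" unfolding energy_def
    using U_range[of l] by (intro integral_mono integrable_bounded[of _ 1]) (auto simp: power_le_one)
  then show ?thesis by (simp add: P.prob_space)
qed

text \<open>The energies increase to a limit \<open>e\<close>, and the defect
  \<open>e - energy l\<close> bounds the squared L2 distance from level \<open>l\<close> to every
  later level. A defect of \<open>(1 / 16) ^ k\<close> thus gives L1 distance
  \<open>(1 / 4) ^ k\<close>, which is summable. Taking the least admissible level makes
  \<open>r\<close> monotone.\<close>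

lemma fast_subsequence:
  obtains r where "mono r" "\<And>k. k \<le> r k" "\<And>j k. k \<le> j \<Longrightarrow> (\<integral>p. \<bar>U (r j) p - U (r k) p\<bar> \<partial>N2) \<le> (1 / 4) ^ k"
proof -
  obtain e where e: "energy \<longlonglongrightarrow> e" and le: "\<And>l. energy l \<le> e"
    using incseq_convergent[of energy 1] energy_mono energy_le_1 by (metis incseq_def incseq_le)
  define Q where "Q k l \<longleftrightarrow> k \<le> l \<and> e - energy l \<le> (1 / 16) ^ k" for k l
  have "\<exists>l. Q k l" for k
  proof -
    have "eventually (\<lambda>l. e - (1 / 16) ^ k < energy l) sequentially"
      by (rule order_tendstoD(1)[OF e]) simp
    then have "eventually (\<lambda>l. Q k l) sequentially"
      using eventually_ge_at_top[of k] by eventually_elim (simp add: Q_def)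
    then show ?thesis by (auto dest: eventually_happens)
  qed
  then have Q: "Q k (LEAST l. Q k l)" for k by (metis LeastI)
  define r where "r k = (LEAST l. Q k l)" for k
  show thesis
  proof
    show "mono r"
    proof (rule mono_iff_le_Suc[THEN iffD2], rule allI)
      fix k
      have "(1 / 16) ^ Suc k \<le> (1 / 16 :: real) ^ k" by (simp add: field_simps)
      then have "Q k (r (Suc k))" using Q[of "Suc k"] unfolding r_def Q_def by linarith
      then show "r k \<le> r (Suc k)" unfolding r_def by (rule Least_le)
    qed
    then show "k \<le> r k" for k using Q[of k] by (simp add: r_def Q_def)
    fix j k :: nat assume "k \<le> j"
    then have rr: "r k \<le> r j" using \<open>mono r\<close> by (simp add: monoD)
    have "energy (r j) - energy (r k) \<le> (1 / 16) ^ k"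
      using Q[of k] le[of "r j"] unfolding r_def Q_def by linarith
    also have "(1 / 16) ^ k = ((1 / 4 :: real) ^ k)\<^sup>2"
      by (simp add: power_mult[symmetric] power_mult_distrib power2_eq_square flip: power_mult_distrib)
    finally have "(\<integral>p. (U (r j) p - U (r k) p)\<^sup>2 \<partial>N2) \<le> ((1 / 4) ^ k)\<^sup>2"
      using energy_diff[OF rr] by simp
    moreover have "\<bar>U l p - U m p\<bar> \<le> 1" for l m p
      using U_range[of l p] U_range[of m p] by auto
    ultimately show "(\<integral>p. \<bar>U (r j) p - U (r k) p\<bar> \<partial>N2) \<le> (1 / 4) ^ k"
      by (intro P.integral_abs_le_of_square integrable_bounded[of _ 1]) (auto simp: abs_square_le_1)
  qed
qed

end

section \<open>The limit kernel and its Lebesgue points\<close>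

lemma measurable_convergent_real:
  fixes f :: "nat \<Rightarrow> 'a \<Rightarrow> real"
  assumes [measurable]: "\<And>i. f i \<in> borel_measurable M"
  shows "Measurable.pred M (\<lambda>x. convergent (\<lambda>i. f i x))"
  unfolding pred_def Cauchy_convergent_iff[symmetric] by measurable

context nested_cells
begin

definition cell :: "nat \<Rightarrow> 'a \<Rightarrow> 'a \<Rightarrow> 'a \<times> 'a \<Rightarrow> real" where
  "cell l x y p = of_bool (col l (fst p) = col l x \<and> col l (snd p) = col l y)"

definition vol :: "nat \<Rightarrow> 'a \<Rightarrow> real" where "vol l x = \<mu> l (col l x)"

lemma cell_range: "0 \<le> cell l x y p \<and> cell l x y p \<le> 1" by (simp add: cell_def)

lemma cell_measurable [measurable]: "cell l x y \<in> borel_measurable N2"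
  unfolding cell_def[abs_def] by (rule measurable_cells[of "\<lambda>a b. of_bool (a = col l x \<and> b = col l y)"])

lemma integral_cell: "(\<integral>p. cell l x y p \<partial>N2) = vol l x * vol l y"
proof -
  have eq: "{p\<in>space N2. col l (fst p) = col l x \<and> col l (snd p) = col l y}
    = {u\<in>space N. col l u = col l x} \<times> {v\<in>space N. col l v = col l y}"
    by (auto simp: space_pair_measure)
  have "(\<integral>p. cell l x y p \<partial>N2) = (\<integral>p. indicator {p\<in>space N2. col l (fst p) = col l x \<and> col l (snd p) = col l y} p \<partial>N2)"
    by (intro Bochner_Integration.integral_cong) (auto simp: cell_def indicator_def)
  also have "\<dots> = measure N2 {p\<in>space N2. col l (fst p) = col l x \<and> col l (snd p) = col l y}"
    by (simp add: Int_absorb2 subset_eq)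
  also have "\<dots> = vol l x * vol l y"
    unfolding eq by (simp add: vol_def \<mu> measure_def emeasure_pair_measure_Times enn2real_mult)
  finally show ?thesis .
qed

text \<open>The kernel is redefined to be \<open>0\<close> at every point that is not a Lebesgue point of the a.e. limit
  (with respect to the cells). At a point of positive value the kernel is thus nearly constant on
  small cells, which lets almost everywhere statements be turned into pointwise ones.\<close>

lemma limit_kernel:
  obtains W r where "W \<in> borel_measurable N2" "\<And>p. 0 \<le> W p \<and> W p \<le> 1" "\<And>k. k \<le> r k"
    "AE p in N2. (\<lambda>k. U (r k) p) \<longlonglongrightarrow> W p"
    "\<And>x y. 0 < W (x, y) \<Longrightarrow> \<exists>D. D \<longlonglongrightarrow> 0 \<and> (\<forall>\<^sub>F k in sequentially. 0 < vol (r k) x \<and> 0 < vol (r k) y \<and>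
      (\<integral>p. cell (r k) x y p * \<bar>W p - W (x, y)\<bar> \<partial>N2) \<le> vol (r k) x * vol (r k) y * D k)"
    "\<And>x y D. D \<longlonglongrightarrow> 0 \<Longrightarrow> (\<forall>\<^sub>F k in sequentially. 0 < vol (r k) x \<and> 0 < vol (r k) y \<and>
      (\<integral>p. cell (r k) x y p * (1 - W p) \<partial>N2) \<le> vol (r k) x * vol (r k) y * D k) \<Longrightarrow> W (x, y) = 1"
proof -
  obtain r where r: "mono r" "\<And>k. k \<le> r k"
    and fast: "\<And>j k. k \<le> j \<Longrightarrow> (\<integral>p. \<bar>U (r j) p - U (r k) p\<bar> \<partial>N2) \<le> (1 / 4) ^ k"
    by (rule fast_subsequence) (rule that)
  \<comment> \<open>With default 0 off the convergence set, a positive value of \<open>V\<close>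
    certifies convergence at that very point.\<close>
  define V where "V p = (if convergent (\<lambda>k. U (r k) p) then lim (\<lambda>k. U (r k) p) else 0)" for p
  have [measurable]: "Measurable.pred N2 (\<lambda>p. convergent (\<lambda>k. U (r k) p))"
    by (intro measurable_convergent_real U_measurable)
  have V_m [measurable]: "V \<in> borel_measurable N2" unfolding V_def[abs_def] by measurable
  have V_lim: "(\<lambda>k. U (r k) p) \<longlonglongrightarrow> V p" if "convergent (\<lambda>k. U (r k) p)" for p
    using that by (simp add: V_def convergent_LIMSEQ_iff)
  have V_range: "0 \<le> V p \<and> V p \<le> 1" for p
  proof (cases "convergent (\<lambda>k. U (r k) p)")
    case True
    show ?thesis
      using LIMSEQ_le_const[OF V_lim[OF True], of 0] LIMSEQ_le_const2[OF V_lim[OF True], of 1] U_range by auto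
  qed (simp add: V_def)
  have dist1: "\<bar>U l p - U m p\<bar> \<le> 1" "\<bar>V p - U m p\<bar> \<le> 1" for l m p
    using U_range[of l p] U_range[of m p] V_range[of p] by auto
  have geo: "summable (\<lambda>k. (1 / 4 :: real) ^ k)" by (simp add: summable_geometric)
  have "AE p in N2. summable (\<lambda>k. \<bar>U (r (Suc k)) p - U (r k) p\<bar>)"
  proof (rule AE_summable_of_summable_integral)
    show "integrable N2 (\<lambda>p. \<bar>U (r (Suc k)) p - U (r k) p\<bar>)" for k
      using dist1 by (intro integrable_bounded[of _ 1]) auto
    show "summable (\<lambda>k. \<integral>p. \<bar>U (r (Suc k)) p - U (r k) p\<bar> \<partial>N2)"
      by (rule summable_comparison_test'[OF geo, of 0]) (use fast in auto)
  qed auto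
  then have conv: "AE p in N2. convergent (\<lambda>k. U (r k) p)"
  proof (rule AE_mp, intro AE_I2 impI)
    fix p assume "summable (\<lambda>k. \<bar>U (r (Suc k)) p - U (r k) p\<bar>)"
    then have "summable (\<lambda>k. U (r (Suc k)) p - U (r k) p)" by (rule summable_rabs_cancel)
    then have "convergent (\<lambda>n. U (r n) p - U (r 0) p)"
      unfolding summable_iff_convergent using sum_lessThan_telescope[of "\<lambda>k. U (r k) p"] by simp
    then have "convergent (\<lambda>n. (U (r n) p - U (r 0) p) + U (r 0) p)"
      by (intro convergent_add convergent_const)
    then show "convergent (\<lambda>k. U (r k) p)" by simp
  qed
  \<comment> \<open>Dominated convergence in the form used for the L1 distance to
    \<open>U (r k)\<close> and for the cell means of \<open>V\<close>.\<close>
  have limit: "(\<lambda>j. \<integral>p. f (U (r j) p) p \<partial>N2) \<longlonglongrightarrow> (\<integral>p. f (V p) p \<partial>N2)"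
    if f: "\<And>t p. 0 \<le> t \<Longrightarrow> t \<le> 1 \<Longrightarrow> \<bar>f t p\<bar> \<le> 1" "\<And>p. continuous_on UNIV (\<lambda>t. f t p)"
      "\<And>g. g \<in> borel_measurable N2 \<Longrightarrow> (\<lambda>p. f (g p) p) \<in> borel_measurable N2"
    for f :: "real \<Rightarrow> 'a \<times> 'a \<Rightarrow> real"
  proof (rule integral_dominated_convergence[where w="\<lambda>_. 1"])
    show "AE p in N2. (\<lambda>j. f (U (r j) p) p) \<longlonglongrightarrow> f (V p) p"
      using conv
    proof (rule AE_mp, intro AE_I2 impI)
      fix p assume "convergent (\<lambda>k. U (r k) p)"
      from V_lim[OF this] show "(\<lambda>j. f (U (r j) p) p) \<longlonglongrightarrow> f (V p) p"
        by (rule continuous_on_tendsto_compose[OF f(2)]) auto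
    qed
    show "AE p in N2. norm (f (U (r j) p) p) \<le> 1" for j using f(1) U_range by auto
  qed (use f(3) in auto)
  have L1: "(\<integral>p. \<bar>V p - U (r k) p\<bar> \<partial>N2) \<le> (1 / 4) ^ k" for k
  proof (rule LIMSEQ_le_const2)
    show "(\<lambda>j. \<integral>p. \<bar>U (r j) p - U (r k) p\<bar> \<partial>N2) \<longlonglongrightarrow> (\<integral>p. \<bar>V p - U (r k) p\<bar> \<partial>N2)"
    proof (rule limit[of "\<lambda>t p. \<bar>t - U (r k) p\<bar>"])
      show "\<bar>\<bar>t - U (r k) p\<bar>\<bar> \<le> 1" if "0 \<le> t" "t \<le> 1" for t p using U_range[of "r k" p] that by auto
    qed (auto intro!: continuous_intros)
    show "\<exists>n. \<forall>j\<ge>n. (\<integral>p. \<bar>U (r j) p - U (r k) p\<bar> \<partial>N2) \<le> (1 / 4) ^ k" using fast[of k] by auto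
  qed
  define I where "I k a b = (\<integral>p. of_bool (col (r k) (fst p) = a \<and> col (r k) (snd p) = b) * \<bar>V p - U (r k) p\<bar> \<partial>N2)" for k a b
  have I_nonneg: "0 \<le> I k a b" for k a b unfolding I_def by (intro Bochner_Integration.integral_nonneg) auto
  \<comment> \<open>The mean of \<open>\<bar>V p - U (r k) p\<bar>\<close> over a product of cells.
    \<open>\<Delta> k p\<close> is this local oscillation around \<open>p\<close>, and the Lebesgue
    points are those where it tends to 0.\<close>
  define \<delta> where "\<delta> k a b = I k a b / (\<mu> (r k) a * \<mu> (r k) b)" for k a b
  define \<Delta> where "\<Delta> k p = \<delta> k (col (r k) (fst p)) (col (r k) (snd p))" for k p
  have \<delta>_nonneg: "0 \<le> \<delta> k a b" for k a b
    unfolding \<delta>_def using \<mu>_nonneg I_nonneg by (intro divide_nonneg_nonneg mult_nonneg_nonneg) auto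
  have \<Delta>_m [measurable]: "\<Delta> k \<in> borel_measurable N2" for k
    unfolding \<Delta>_def[abs_def] by (rule measurable_cells)
  have int_I: "integrable N2 (\<lambda>p. of_bool (col (r k) (fst p) = a \<and> col (r k) (snd p) = b) * \<bar>V p - U (r k) p\<bar>)" for k a b
    using dist1 by (intro integrable_bounded[of _ 1]) auto
  \<comment> \<open>Replacing a non-negative function by its cell averages, with default 0 on null
    cells, does not increase its integral.\<close>
  have int_\<Delta>: "(\<integral>p. \<Delta> k p \<partial>N2) \<le> (1 / 4) ^ k" for k
  proof -
    have "(\<integral>p. \<Delta> k p \<partial>N2) = (\<Sum>a<4 ^ r k. \<Sum>b<4 ^ r k. \<mu> (r k) a * \<mu> (r k) b * \<delta> k a b)"
      unfolding \<Delta>_def by (rule integral_cells)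
    also have "\<dots> \<le> (\<Sum>a<4 ^ r k. \<Sum>b<4 ^ r k. I k a b)"
      by (intro sum_mono) (auto simp: \<delta>_def I_nonneg)
    also have "\<dots> = (\<Sum>a<4 ^ r k. (\<integral>p. (\<Sum>b<4 ^ r k. of_bool (col (r k) (fst p) = a \<and> col (r k) (snd p) = b) * \<bar>V p - U (r k) p\<bar>) \<partial>N2))"
      unfolding I_def by (intro sum.cong refl Bochner_Integration.integral_sum[symmetric] int_I)
    also have "\<dots> = (\<integral>p. (\<Sum>a<4 ^ r k. \<Sum>b<4 ^ r k. of_bool (col (r k) (fst p) = a \<and> col (r k) (snd p) = b) * \<bar>V p - U (r k) p\<bar>) \<partial>N2)"
      by (intro Bochner_Integration.integral_sum[symmetric] Bochner_Integration.integrable_sum int_I)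
    also have "\<dots> \<le> (\<integral>p. \<bar>V p - U (r k) p\<bar> \<partial>N2)"
    proof (rule integral_mono)
      show "integrable N2 (\<lambda>p. \<Sum>a<4 ^ r k. \<Sum>b<4 ^ r k. of_bool (col (r k) (fst p) = a \<and> col (r k) (snd p) = b) * \<bar>V p - U (r k) p\<bar>)"
        using int_I by (intro Bochner_Integration.integrable_sum)
      show "integrable N2 (\<lambda>p. \<bar>V p - U (r k) p\<bar>)"
        using dist1 by (intro integrable_bounded[of _ 1]) auto
      fix p
      have le1: "(\<Sum>a<n. of_bool (c = a) :: real) \<le> 1" for n c :: nat
        by (cases "c < n") (auto simp: of_bool_def)
      have "(\<Sum>a<4 ^ r k. \<Sum>b<4 ^ r k. of_bool (col (r k) (fst p) = a \<and> col (r k) (snd p) = b) :: real)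
        = (\<Sum>a<4 ^ r k. of_bool (col (r k) (fst p) = a)) * (\<Sum>b<4 ^ r k. of_bool (col (r k) (snd p) = b))"
        unfolding sum_product by (intro sum.cong refl) (simp only: of_bool_conj)
      also have "\<dots> \<le> 1 * 1" by (intro mult_mono le1 sum_nonneg) auto
      finally have *: "(\<Sum>a<4 ^ r k. \<Sum>b<4 ^ r k. of_bool (col (r k) (fst p) = a \<and> col (r k) (snd p) = b) :: real) \<le> 1" by simp
      show "(\<Sum>a<4 ^ r k. \<Sum>b<4 ^ r k. of_bool (col (r k) (fst p) = a \<and> col (r k) (snd p) = b) * \<bar>V p - U (r k) p\<bar>) \<le> \<bar>V p - U (r k) p\<bar>"
        using mult_right_mono[OF *, of "\<bar>V p - U (r k) p\<bar>"] by (simp add: sum_distrib_right)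
    qed
    also have "\<dots> \<le> (1 / 4) ^ k" by (rule L1)
    finally show ?thesis .
  qed
  have \<Delta>_lim: "AE p in N2. (\<lambda>k. \<Delta> k p) \<longlonglongrightarrow> 0"
  proof -
    have "AE p in N2. summable (\<lambda>k. \<Delta> k p)"
    proof (rule AE_summable_of_summable_integral)
      show "integrable N2 (\<Delta> k)" for k
      proof (rule integrable_bounded)
        \<comment> \<open>Colours from \<open>4 ^ r k\<close> on are null and have oscillation 0, so
          the sum of the remaining finitely many values is a bound.\<close>
        define B where "B = (\<Sum>a\<le>4 ^ r k. \<Sum>b\<le>4 ^ r k. \<delta> k a b)"
        have \<delta>0: "\<delta> k a b = 0" if "a \<ge> 4 ^ r k \<or> b \<ge> 4 ^ r k" for a b
        proof -
          have "\<mu> (r k) c = 0" if "c \<ge> 4 ^ r k" for c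
          proof -
            have "AE x in N. x \<notin> {x\<in>space N. col (r k) x = c}"
              using col_less[of "r k"] by eventually_elim (use that in auto)
            then show ?thesis unfolding \<mu> by (subst (asm) AE_iff_measurable[OF _ refl]) (auto simp: measure_def)
          qed
          then show ?thesis using that by (auto simp: \<delta>_def)
        qed
        have "\<delta> k a b \<le> B" for a b
        proof (cases "a \<le> 4 ^ r k \<and> b \<le> 4 ^ r k")
          case True
          have "\<delta> k a b \<le> (\<Sum>b\<le>4 ^ r k. \<delta> k a b)"
            using True \<delta>_nonneg by (intro member_le_sum) auto
          also have "\<dots> \<le> B" unfolding B_def
            using True \<delta>_nonneg by (intro member_le_sum[of a _ "\<lambda>a. \<Sum>b\<le>4 ^ r k. \<delta> k a b"]) (auto intro!: sum_nonneg)
          finally show ?thesis .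
        next
          case False
          then have "\<delta> k a b = 0" by (intro \<delta>0) auto
          then show ?thesis unfolding B_def by (auto intro!: sum_nonneg \<delta>_nonneg)
        qed
        then show "\<bar>\<Delta> k p\<bar> \<le> B" for p using \<delta>_nonneg by (simp add: \<Delta>_def)
      qed simp
      show "summable (\<lambda>k. \<integral>p. \<Delta> k p \<partial>N2)"
      proof (rule summable_comparison_test'[OF geo, of 0])
        fix k
        have "0 \<le> (\<integral>p. \<Delta> k p \<partial>N2)" using \<delta>_nonneg by (intro Bochner_Integration.integral_nonneg) (simp add: \<Delta>_def)
        then show "norm (\<integral>p. \<Delta> k p \<partial>N2) \<le> (1 / 4) ^ k" using int_\<Delta>[of k] by simp
      qed
    qed (simp add: \<Delta>_def \<delta>_nonneg)
    then show ?thesis by eventually_elim (rule summable_LIMSEQ_zero)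
  qed
  have [measurable]: "Measurable.pred N2 (\<lambda>p. convergent (\<lambda>k. \<Delta> k p))"
    by (intro measurable_convergent_real \<Delta>_m)
  define W where "W p = (if convergent (\<lambda>k. \<Delta> k p) \<and> lim (\<lambda>k. \<Delta> k p) = 0 then V p else 0)" for p
  have W_m [measurable]: "W \<in> borel_measurable N2" unfolding W_def[abs_def] by measurable
  have W_V: "W p = V p" if "(\<lambda>k. \<Delta> k p) \<longlonglongrightarrow> 0" for p
    using that by (auto simp: W_def limI convergentI)
  have ae_eq: "AE p in N2. W p = V p" using \<Delta>_lim by eventually_elim (rule W_V)
  have W_range: "0 \<le> W p \<and> W p \<le> 1" for p using V_range by (simp add: W_def)
  have U_const: "cell l x y p * f (U l p) = cell l x y p * f (U l (x, y))" for l x y p and f :: "real \<Rightarrow> real"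
    by (simp add: cell_def U_def)
  have \<Delta>_eq: "vol (r k) x * vol (r k) y * \<Delta> k (x, y) = (\<integral>p. cell (r k) x y p * \<bar>V p - U (r k) p\<bar> \<partial>N2)"
    if "0 < vol (r k) x" "0 < vol (r k) y" for k x y
    using that by (simp add: \<Delta>_def \<delta>_def I_def vol_def cell_def)
  have int_cell: "integrable N2 (\<lambda>p. cell l x y p * f p)"
    if "f \<in> borel_measurable N2" "\<And>p. \<bar>f p\<bar> \<le> 2" for l x y and f :: "'a \<times> 'a \<Rightarrow> real"
    using that cell_range[of l x y] by (intro integrable_bounded[of _ 2]) (auto simp: abs_mult intro: mult_le_one order_trans[OF mult_left_le_one_le])
  have le2: "\<bar>\<bar>V p - W q\<bar>\<bar> \<le> 2" "\<bar>\<bar>V p - U l q\<bar>\<bar> \<le> 2" "\<bar>\<bar>U l p - W q\<bar>\<bar> \<le> 2" "\<bar>1 - V p\<bar> \<le> 2"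
    "\<bar>1 - U l p\<bar> \<le> 2" "\<bar>V p\<bar> \<le> 2" for p q l
    using V_range[of p] W_range[of q] U_range[of l p] U_range[of l q] by auto
  show thesis
  proof
    show "W \<in> borel_measurable N2" "0 \<le> W p \<and> W p \<le> 1" "k \<le> r k" for p k
      using W_m W_range r by auto
    show "AE p in N2. (\<lambda>k. U (r k) p) \<longlonglongrightarrow> W p"
      using conv ae_eq by eventually_elim (use V_lim in simp)
  next
    fix x y assume pos: "0 < W (x, y)"
    have c: "convergent (\<lambda>k. U (r k) (x, y))" and WV: "W (x, y) = V (x, y)"
      using pos by (auto simp: W_def V_def split: if_splits)
    have d0: "(\<lambda>k. \<Delta> k (x, y)) \<longlonglongrightarrow> 0"
      using pos by (auto simp: W_def convergent_LIMSEQ_iff split: if_splits)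
    have Ul: "(\<lambda>k. U (r k) (x, y)) \<longlonglongrightarrow> W (x, y)" using V_lim[OF c] WV by simp
    \<comment> \<open>Oscillation of \<open>V\<close> around the cell mean, plus the distance of the
      cell mean from the value at the point.\<close>
    define D where "D k = \<Delta> k (x, y) + \<bar>U (r k) (x, y) - W (x, y)\<bar>" for k
    have "D \<longlonglongrightarrow> 0 + \<bar>W (x, y) - W (x, y)\<bar>" unfolding D_def by (intro tendsto_intros d0 Ul)
    then have "D \<longlonglongrightarrow> 0" by simp
    moreover have "\<forall>\<^sub>F k in sequentially. 0 < vol (r k) x \<and> 0 < vol (r k) y \<and>
      (\<integral>p. cell (r k) x y p * \<bar>W p - W (x, y)\<bar> \<partial>N2) \<le> vol (r k) x * vol (r k) y * D k"
      using order_tendstoD(1)[OF Ul pos]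
    proof eventually_elim
      case (elim k)
      \<comment> \<open>Null cells have density 0 by division by zero, so the eventually positive
        \<open>U (r k) (x, y)\<close> excludes them.\<close>
      then have "\<mu> (r k) (col (r k) x) \<noteq> 0" "\<mu> (r k) (col (r k) y) \<noteq> 0" by (auto simp: U_def w_def)
      then have v: "0 < vol (r k) x" "0 < vol (r k) y" using \<mu>_nonneg by (auto simp: vol_def less_le)
      have "(\<integral>p. cell (r k) x y p * \<bar>W p - W (x, y)\<bar> \<partial>N2) = (\<integral>p. cell (r k) x y p * \<bar>V p - W (x, y)\<bar> \<partial>N2)"
        using ae_eq by (intro integral_cong_AE) auto
      also have "\<dots> \<le> (\<integral>p. cell (r k) x y p * \<bar>V p - U (r k) p\<bar> + cell (r k) x y p * \<bar>U (r k) (x, y) - W (x, y)\<bar> \<partial>N2)"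
      proof (rule integral_mono)
        show "integrable N2 (\<lambda>p. cell (r k) x y p * \<bar>V p - W (x, y)\<bar>)"
          by (intro int_cell le2) auto
        show "integrable N2 (\<lambda>p. cell (r k) x y p * \<bar>V p - U (r k) p\<bar> + cell (r k) x y p * \<bar>U (r k) (x, y) - W (x, y)\<bar>)"
          by (intro Bochner_Integration.integrable_add int_cell le2) auto
        fix p
        have "cell (r k) x y p * \<bar>V p - W (x, y)\<bar> \<le> cell (r k) x y p * (\<bar>V p - U (r k) p\<bar> + \<bar>U (r k) p - W (x, y)\<bar>)"
          using cell_range by (intro mult_left_mono) auto
        then show "cell (r k) x y p * \<bar>V p - W (x, y)\<bar> \<le> cell (r k) x y p * \<bar>V p - U (r k) p\<bar> + cell (r k) x y p * \<bar>U (r k) (x, y) - W (x, y)\<bar>"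
          using U_const[of "r k" x y p "\<lambda>t. \<bar>t - W (x, y)\<bar>"] by (simp add: distrib_left)
      qed
      also have "\<dots> = (\<integral>p. cell (r k) x y p * \<bar>V p - U (r k) p\<bar> \<partial>N2) + (\<integral>p. cell (r k) x y p * \<bar>U (r k) (x, y) - W (x, y)\<bar> \<partial>N2)"
        by (intro Bochner_Integration.integral_add int_cell le2) auto
      also have "\<dots> = vol (r k) x * vol (r k) y * D k"
        using \<Delta>_eq[OF v] by (simp add: D_def integral_cell distrib_left)
      finally show ?case using v by simp
    qed
    ultimately show "\<exists>D. D \<longlonglongrightarrow> 0 \<and> (\<forall>\<^sub>F k in sequentially. 0 < vol (r k) x \<and> 0 < vol (r k) y \<and>
      (\<integral>p. cell (r k) x y p * \<bar>W p - W (x, y)\<bar> \<partial>N2) \<le> vol (r k) x * vol (r k) y * D k)" by blast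
  next
    fix x y D assume D: "D \<longlonglongrightarrow> 0" and ev: "\<forall>\<^sub>F k in sequentially. 0 < vol (r k) x \<and> 0 < vol (r k) y \<and>
      (\<integral>p. cell (r k) x y p * (1 - W p) \<partial>N2) \<le> vol (r k) x * vol (r k) y * D k"
    \<comment> \<open>The martingale property in the limit: the mean of \<open>V\<close> over a cell
      is the value of \<open>U (r k)\<close> there.\<close>
    have mean: "(\<integral>p. cell (r k) x y p * V p \<partial>N2) = vol (r k) x * vol (r k) y * U (r k) (x, y)" for k
    proof (rule LIMSEQ_unique)
      show "(\<lambda>j. \<integral>p. cell (r k) x y p * U (r j) p \<partial>N2) \<longlonglongrightarrow> (\<integral>p. cell (r k) x y p * V p \<partial>N2)"
      proof (rule limit[of "\<lambda>t p. cell (r k) x y p * t"])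
        show "\<bar>cell (r k) x y p * t\<bar> \<le> 1" if "0 \<le> t" "t \<le> 1" for t p
          using that cell_range[of "r k" x y p] by (auto simp: abs_mult intro: mult_le_one)
      qed (auto intro!: continuous_intros)
      have "(\<integral>p. cell (r k) x y p * U (r j) p \<partial>N2) = vol (r k) x * vol (r k) y * U (r k) (x, y)" if "k \<le> j" for j
      proof -
        have "(\<integral>p. U (r j) p * cell (r k) x y p \<partial>N2) = (\<integral>p. U (r k) p * cell (r k) x y p \<partial>N2)"
          unfolding cell_def using martingale[of "r k" "r j" "\<lambda>a b. of_bool (a = col (r k) x \<and> b = col (r k) y)"]
            monoD[OF r(1) that] by simp
        also have "\<dots> = (\<integral>p. cell (r k) x y p * U (r k) (x, y) \<partial>N2)"
        proof (rule Bochner_Integration.integral_cong[OF refl])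
          show "U (r k) p * cell (r k) x y p = cell (r k) x y p * U (r k) (x, y)" for p
            using U_const[of "r k" x y p "\<lambda>t. t"] by (simp add: mult.commute)
        qed
        finally show ?thesis by (simp add: integral_cell mult.commute)
      qed
      then show "(\<lambda>j. \<integral>p. cell (r k) x y p * U (r j) p \<partial>N2) \<longlonglongrightarrow> vol (r k) x * vol (r k) y * U (r k) (x, y)"
        by (intro tendsto_eventually eventually_sequentiallyI[of k]) auto
    qed
    \<comment> \<open>At the top value 1 a mean controls the oscillation: \<open>1 - V p\<close> is
      non-negative with small mean, and \<open>\<bar>V p - U (r k) p\<bar>\<close> is at most
      \<open>(1 - V p) + (1 - U (r k) p)\<close>. So \<open>(x, y)\<close> becomes a Lebesgue point
      without any prior assumption on it.\<close>
    have key: "\<forall>\<^sub>F k in sequentially. 1 - U (r k) (x, y) \<le> D k \<and> \<Delta> k (x, y) \<le> 2 * D k"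
      using ev
    proof eventually_elim
      case (elim k)
      then have v: "0 < vol (r k) x" "0 < vol (r k) y" by auto
      have int1: "integrable N2 (\<lambda>p. cell (r k) x y p * (1 - V p))"
        by (intro int_cell le2) auto
      have int2: "integrable N2 (\<lambda>p. cell (r k) x y p * (1 - U (r k) (x, y)))"
        by (intro int_cell le2) auto
      have "(\<integral>p. cell (r k) x y p * (1 - V p) \<partial>N2) = (\<integral>p. cell (r k) x y p - cell (r k) x y p * V p \<partial>N2)"
        by (simp add: right_diff_distrib)
      also have "\<dots> = (\<integral>p. cell (r k) x y p \<partial>N2) - (\<integral>p. cell (r k) x y p * V p \<partial>N2)"
        using int_cell[of "\<lambda>_. 1" "r k" x y] int_cell[of V "r k" x y] le2(6)
        by (intro Bochner_Integration.integral_diff) auto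
      finally have eqV: "(\<integral>p. cell (r k) x y p * (1 - V p) \<partial>N2) = vol (r k) x * vol (r k) y * (1 - U (r k) (x, y))"
        by (simp add: mean integral_cell right_diff_distrib)
      have "(\<integral>p. cell (r k) x y p * (1 - W p) \<partial>N2) = (\<integral>p. cell (r k) x y p * (1 - V p) \<partial>N2)"
        using ae_eq by (intro integral_cong_AE) auto
      then have eqW: "(\<integral>p. cell (r k) x y p * (1 - W p) \<partial>N2) = vol (r k) x * vol (r k) y * (1 - U (r k) (x, y))"
        using eqV by simp
      have le: "1 - U (r k) (x, y) \<le> D k" using elim v eqW by (simp add: mult_le_cancel_left_pos)
      have "vol (r k) x * vol (r k) y * \<Delta> k (x, y) \<le> (\<integral>p. cell (r k) x y p * (1 - V p) + cell (r k) x y p * (1 - U (r k) (x, y)) \<partial>N2)"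
        unfolding \<Delta>_eq[OF v]
      proof (rule integral_mono)
        show "integrable N2 (\<lambda>p. cell (r k) x y p * \<bar>V p - U (r k) p\<bar>)"
          by (intro int_cell le2) auto
        show "integrable N2 (\<lambda>p. cell (r k) x y p * (1 - V p) + cell (r k) x y p * (1 - U (r k) (x, y)))"
          by (intro Bochner_Integration.integrable_add int1 int2)
        fix p
        have "cell (r k) x y p * \<bar>V p - U (r k) p\<bar> \<le> cell (r k) x y p * ((1 - V p) + (1 - U (r k) p))"
          using cell_range V_range[of p] U_range[of "r k" p] by (intro mult_left_mono) auto
        also have "\<dots> = cell (r k) x y p * (1 - V p) + cell (r k) x y p * (1 - U (r k) p)"
          by (rule distrib_left)
        also have "cell (r k) x y p * (1 - U (r k) p) = cell (r k) x y p * (1 - U (r k) (x, y))"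
          by (rule U_const[of "r k" x y p "\<lambda>t. 1 - t"])
        finally show "cell (r k) x y p * \<bar>V p - U (r k) p\<bar> \<le> cell (r k) x y p * (1 - V p) + cell (r k) x y p * (1 - U (r k) (x, y))" .
      qed
      also have "\<dots> = vol (r k) x * vol (r k) y * (2 * (1 - U (r k) (x, y)))"
        using int1 int2 eqV by (simp add: integral_cell)
      finally have "\<Delta> k (x, y) \<le> 2 * (1 - U (r k) (x, y))"
        using v by (simp add: mult_le_cancel_left_pos)
      then show ?case using le by auto
    qed
    have "(\<lambda>k. U (r k) (x, y)) \<longlonglongrightarrow> 1"
    proof (rule tendsto_sandwich)
      show "\<forall>\<^sub>F k in sequentially. 1 - D k \<le> U (r k) (x, y)" using key by eventually_elim auto
      show "\<forall>\<^sub>F k in sequentially. U (r k) (x, y) \<le> 1" using U_range by simp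
      have "(\<lambda>k. 1 - D k) \<longlonglongrightarrow> 1 - 0" by (intro tendsto_intros D)
      then show "(\<lambda>k. 1 - D k) \<longlonglongrightarrow> 1" by simp
    qed simp
    then have "V (x, y) = 1" using V_lim[of "(x, y)"] by (auto intro: LIMSEQ_unique convergentI)
    moreover have "(\<lambda>k. \<Delta> k (x, y)) \<longlonglongrightarrow> 0"
    proof (rule tendsto_sandwich)
      show "\<forall>\<^sub>F k in sequentially. 0 \<le> \<Delta> k (x, y)" using \<delta>_nonneg by (simp add: \<Delta>_def)
      show "\<forall>\<^sub>F k in sequentially. \<Delta> k (x, y) \<le> 2 * D k" using key by eventually_elim auto
      have "(\<lambda>k. 2 * D k) \<longlonglongrightarrow> 2 * 0" by (intro tendsto_intros D)
      then show "(\<lambda>k. 2 * D k) \<longlonglongrightarrow> 0" by simp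
    qed simp
    ultimately show "W (x, y) = 1" using W_V by simp
  qed
qed

end

section \<open>Kernel densities as integrals over product spaces\<close>

definition kint :: "'a measure \<Rightarrow> nat \<Rightarrow> (nat \<times> nat) set \<Rightarrow> ('a \<times> 'a \<Rightarrow> real) \<Rightarrow> real" where
  "kint M k E W = (\<integral>x. (\<Prod>e\<in>E. W (map_prod x x e)) \<partial>PiM {..<k} (\<lambda>_. M))"

lemma distr_PiM_pair:
  assumes "prob_space M" "i \<in> I" "j \<in> I" "i \<noteq> j"
  shows "distr (PiM I (\<lambda>_. M)) (M \<Otimes>\<^sub>M M) (\<lambda>x. (x i, x j)) = M \<Otimes>\<^sub>M M"
proof -
  interpret prob_space M by fact
  interpret P: product_prob_space "\<lambda>_. M" I ..
  show ?thesis
  proof (rule pair_measure_eqI[symmetric])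
    fix A B assume AB: "A \<in> sets M" "B \<in> sets M"
    define X where "X l = (if l = i then A else B)" for l
    have "emeasure (distr (PiM I (\<lambda>_. M)) (M \<Otimes>\<^sub>M M) (\<lambda>x. (x i, x j))) (A \<times> B)
      = emeasure (PiM I (\<lambda>_. M)) ((\<lambda>x. (x i, x j)) -` (A \<times> B) \<inter> space (PiM I (\<lambda>_. M)))"
      using assms AB by (intro emeasure_distr) auto
    also have "(\<lambda>x. (x i, x j)) -` (A \<times> B) \<inter> space (PiM I (\<lambda>_. M)) = prod_emb I (\<lambda>_. M) {i, j} (PiE {i, j} X)"
      using assms by (auto simp: prod_emb_def X_def space_PiM PiE_iff split: if_splits)
    also have "emeasure (PiM I (\<lambda>_. M)) \<dots> = (\<Prod>l\<in>{i, j}. emeasure M (X l))"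
      using assms AB by (intro P.emeasure_PiM_emb) (auto simp: X_def)
    also have "\<dots> = emeasure M A * emeasure M B" using assms by (simp add: X_def)
    finally show "emeasure M A * emeasure M B = emeasure (distr (PiM I (\<lambda>_. M)) (M \<Otimes>\<^sub>M M) (\<lambda>x. (x i, x j))) (A \<times> B)" ..
  qed (simp_all add: sigma_finite_measure_axioms)
qed

text \<open>Fubini in coordinate \<open>k\<close>; among the remaining coordinates, the pair at
  \<open>i\<close> and \<open>j\<close> is distributed as
  \<open>M \<Otimes>\<^sub>M M\<close>.\<close>

lemma integral_PiM_pair_times:
  fixes u :: "'a \<Rightarrow> real" and h :: "'a \<times> 'a \<Rightarrow> real"
  assumes "prob_space M" "finite I" "i \<in> I" "j \<in> I" "k \<in> I" "distinct [i, j, k]"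
    and u: "integrable M u" and [measurable]: "h \<in> borel_measurable (M \<Otimes>\<^sub>M M)"
    and int: "integrable (PiM I (\<lambda>_. M)) (\<lambda>x. u (x k) * h (x i, x j))"
  shows "(\<integral>x. u (x k) * h (x i, x j) \<partial>PiM I (\<lambda>_. M)) = (\<integral>x. u x \<partial>M) * (\<integral>p. h p \<partial>(M \<Otimes>\<^sub>M M))"
proof -
  interpret prob_space M by fact
  interpret P: product_sigma_finite "\<lambda>_. M" ..
  define J where "J = I - {k}"
  have J: "I = insert k J" "finite J" "k \<notin> J" "i \<in> J" "j \<in> J" using assms by (auto simp: J_def)
  have "(\<integral>x. u (x k) * h (x i, x j) \<partial>PiM I (\<lambda>_. M)) = (\<integral>x. (\<integral>y. u y * h (x i, x j) \<partial>M) \<partial>PiM J (\<lambda>_. M))"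
    using P.product_integral_insert[OF J(2,3) int[unfolded J(1)]] assms(6) unfolding J(1) by simp
  also have "\<dots> = (\<integral>x. u x \<partial>M) * (\<integral>x. h (x i, x j) \<partial>PiM J (\<lambda>_. M))"
    by simp
  also have "(\<integral>x. h (x i, x j) \<partial>PiM J (\<lambda>_. M)) = (\<integral>p. h p \<partial>distr (PiM J (\<lambda>_. M)) (M \<Otimes>\<^sub>M M) (\<lambda>x. (x i, x j)))"
    using J by (intro integral_distr[symmetric]) auto
  also have "\<dots> = (\<integral>p. h p \<partial>(M \<Otimes>\<^sub>M M))"
    using assms J by (subst distr_PiM_pair) auto
  finally show ?thesis .
qed

lemma measurable_edge_prod [measurable]:
  assumes "W \<in> borel_measurable (M \<Otimes>\<^sub>M M)" "E \<subseteq> I \<times> I"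
  shows "(\<lambda>x. \<Prod>e\<in>E. W (map_prod x x e) :: real) \<in> borel_measurable (PiM I (\<lambda>_. M))"
proof (intro borel_measurable_prod)
  fix e assume "e \<in> E"
  then have "(\<lambda>x. (x (fst e), x (snd e))) \<in> measurable (PiM I (\<lambda>_. M)) (M \<Otimes>\<^sub>M M)"
    using assms(2) by (cases e) auto
  from measurable_compose[OF this assms(1)]
  show "(\<lambda>x. W (map_prod x x e)) \<in> borel_measurable (PiM I (\<lambda>_. M))"
    by (simp add: map_prod_def case_prod_unfold)
qed

context nested_cells
begin

text \<open>The counterpart of \<open>edge_sum_step\<close> for finite posets: both sides of the
  limit become the same expression in class sizes and pair masses.\<close>

lemma kint_U:
  assumes E: "E \<subseteq> {..<k} \<times> {..<k}"
  shows "kint N k E (U l) = (\<Sum>s\<in>{..<k} \<rightarrow>\<^sub>E {..<4 ^ l}. (\<Prod>i<k. \<mu> l (s i)) * (\<Prod>e\<in>E. w l (s (fst e)) (s (snd e))))"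
proof -
  interpret T: finite_product_prob_space "\<lambda>_. N" "{..<k}" by standard simp
  define T where "T = PiM {..<k} (\<lambda>_. N)"
  define C where "C x = (\<lambda>i\<in>{..<k}. col l (x i))" for x :: "nat \<Rightarrow> 'a"
  define h where "h s = (\<Prod>e\<in>E. w l (s (fst e)) (s (snd e)))" for s
  have set_eq: "{x\<in>space T. C x = s} = PiE {..<k} (\<lambda>i. {y\<in>space N. col l y = s i})"
    if "s \<in> {..<k} \<rightarrow>\<^sub>E {..<4 ^ l}" for s
    using that by (auto simp: T_def C_def space_PiM PiE_iff fun_eq_iff extensional_def restrict_def)
  have hC: "h (C x) = (\<Prod>e\<in>E. U l (map_prod x x e))" for x
    unfolding h_def by (intro prod.cong) (use E in \<open>auto simp: U_def C_def\<close>)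
  have "kint N k E (U l) = (\<integral>x. h (C x) \<partial>T)"
    by (simp add: kint_def hC T_def)
  also have "\<dots> = (\<Sum>s\<in>{..<k} \<rightarrow>\<^sub>E {..<4 ^ l}. measure T {x\<in>space T. C x = s} * h s)"
  proof (rule prob_space.integral_finitely_valued)
    show "prob_space T" unfolding T_def by (rule T.prob_space_axioms)
    show "finite ({..<k} \<rightarrow>\<^sub>E {..<4 ^ l :: nat})" by (intro finite_PiE) auto
    show "{x\<in>space T. C x = s} \<in> sets T" if "s \<in> {..<k} \<rightarrow>\<^sub>E {..<4 ^ l}" for s
      unfolding set_eq[OF that] unfolding T_def by (intro sets_PiM_I_finite) auto
    have "AE x in T. \<forall>i\<in>{..<k}. col l (x i) < 4 ^ l"
      unfolding T_def using col_less[of l] prob_space_axioms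
      by (intro AE_finite_allI AE_PiM_component[where P="\<lambda>y. col l y < 4 ^ l"]) auto
    then show "AE x in T. C x \<in> {..<k} \<rightarrow>\<^sub>E {..<4 ^ l}"
      by eventually_elim (auto simp: C_def)
    show "(\<lambda>x. h (C x)) \<in> borel_measurable T"
      unfolding hC T_def using E by (intro measurable_edge_prod) auto
  qed
  also have "\<dots> = (\<Sum>s\<in>{..<k} \<rightarrow>\<^sub>E {..<4 ^ l}. (\<Prod>i<k. \<mu> l (s i)) * h s)"
  proof (intro sum.cong refl)
    fix s assume s: "s \<in> {..<k} \<rightarrow>\<^sub>E {..<4 ^ l :: nat}"
    have "measure T {x\<in>space T. C x = s} = (\<Prod>i<k. \<mu> l (s i))"
      unfolding set_eq[OF s] unfolding T_def by (subst T.finite_measure_PiM_emb) (auto simp: \<mu>)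
    then show "measure T {x\<in>space T. C x = s} * h s = (\<Prod>i<k. \<mu> l (s i)) * h s" by simp
  qed
  finally show ?thesis by (simp add: h_def)
qed

text \<open>For \<open>i \<noteq> j\<close> the pair of coordinates has law \<open>N2\<close>, so
  almost everywhere convergence transfers to each factor. A loop would evaluate the kernels on the
  diagonal, which can be a null set.\<close>

lemma kint_tendsto:
  assumes E: "E \<subseteq> {..<k} \<times> {..<k}" "\<And>i j. (i, j) \<in> E \<Longrightarrow> i \<noteq> j"
    and W: "W \<in> borel_measurable N2" and lim: "AE p in N2. (\<lambda>n. U (r n) p) \<longlonglongrightarrow> W p"
  shows "(\<lambda>n. kint N k E (U (r n))) \<longlonglongrightarrow> kint N k E W"
  unfolding kint_def
proof (rule integral_dominated_convergence[where w="\<lambda>_. 1"])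
  interpret T: finite_product_prob_space "\<lambda>_. N" "{..<k}" by standard simp
  have finE: "finite E" using E(1) by (rule finite_subset) auto
  show "integrable (PiM {..<k} (\<lambda>_. N)) (\<lambda>_. 1 :: real)" by simp
  have "AE x in PiM {..<k} (\<lambda>_. N). \<forall>e\<in>E. (\<lambda>n. U (r n) (map_prod x x e)) \<longlonglongrightarrow> W (map_prod x x e)"
  proof (rule AE_finite_allI[OF finE])
    fix e assume e: "e \<in> E"
    then have ij: "fst e \<in> {..<k}" "snd e \<in> {..<k}" "fst e \<noteq> snd e" using E by (cases e; auto)+
    have "AE x in PiM {..<k} (\<lambda>_. N). (\<lambda>n. U (r n) (x (fst e), x (snd e))) \<longlonglongrightarrow> W (x (fst e), x (snd e))"
    proof (rule AE_distrD[where P="\<lambda>p. (\<lambda>n. U (r n) p) \<longlonglongrightarrow> W p"])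
      show "(\<lambda>x. (x (fst e), x (snd e))) \<in> measurable (PiM {..<k} (\<lambda>_. N)) N2"
        using ij by simp
      show "AE p in distr (PiM {..<k} (\<lambda>_. N)) N2 (\<lambda>x. (x (fst e), x (snd e))). (\<lambda>n. U (r n) p) \<longlonglongrightarrow> W p"
        unfolding distr_PiM_pair[OF prob_space_axioms ij] by (rule lim)
    qed
    then show "AE x in PiM {..<k} (\<lambda>_. N). (\<lambda>n. U (r n) (map_prod x x e)) \<longlonglongrightarrow> W (map_prod x x e)"
      by (simp add: map_prod_def case_prod_unfold)
  qed
  then show "AE x in PiM {..<k} (\<lambda>_. N). (\<lambda>n. \<Prod>e\<in>E. U (r n) (map_prod x x e)) \<longlonglongrightarrow> (\<Prod>e\<in>E. W (map_prod x x e))"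
    by eventually_elim (intro tendsto_prod, auto)
  show "AE x in PiM {..<k} (\<lambda>_. N). norm (\<Prod>e\<in>E. U (r n) (map_prod x x e)) \<le> 1" for n
    using U_range by (intro AE_I2) (auto simp: abs_prod intro!: prod_le_1)
qed (use E W in \<open>auto intro!: measurable_edge_prod\<close>)

section \<open>Pointwise transitivity and irreflexivity of the limit kernel\<close>

text \<open>Averaging over a product of three small cells turns the almost everywhere statements about
  triples, encoded in the two density identities, into statements about all triples.\<close>

lemma kernel_pointwise:
  assumes W [measurable]: "W \<in> borel_measurable N2" and range: "\<And>p. 0 \<le> W p \<and> W p \<le> 1"
    and dense: "\<And>x y. 0 < W (x, y) \<Longrightarrow> \<exists>D. D \<longlonglongrightarrow> 0 \<and> (\<forall>\<^sub>F k in sequentially. 0 < vol (r k) x \<and> 0 < vol (r k) y \<and>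
      (\<integral>p. cell (r k) x y p * \<bar>W p - W (x, y)\<bar> \<partial>N2) \<le> vol (r k) x * vol (r k) y * D k)"
    and one: "\<And>x y D. D \<longlonglongrightarrow> 0 \<Longrightarrow> (\<forall>\<^sub>F k in sequentially. 0 < vol (r k) x \<and> 0 < vol (r k) y \<and>
      (\<integral>p. cell (r k) x y p * (1 - W p) \<partial>N2) \<le> vol (r k) x * vol (r k) y * D k) \<Longrightarrow> W (x, y) = 1"
    and path: "kint N 3 {(0, 1), (1, 2)} W = kint N 3 {(0, 1), (1, 2), (0, 2)} W"
    and cyc: "kint N 3 {(0, 1), (1, 2), (2, 0)} W = 0"
  shows "0 < W (x, y) \<Longrightarrow> 0 < W (y, z) \<Longrightarrow> W (x, z) = 1" and "W (x, x) = 0"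
proof -
  interpret T: finite_product_prob_space "\<lambda>_. N" "{..<3::nat}" by standard simp
  define T where "T = PiM {..<3::nat} (\<lambda>_. N)"
  have le3: "0 \<in> {..<3::nat}" "1 \<in> {..<3::nat}" "2 \<in> {..<3::nat}" by auto
  have mT [measurable]: "(\<lambda>t. t i) \<in> measurable T N" if "i \<in> {..<3}" for i
    unfolding T_def using that by simp
  have pair [measurable]: "(\<lambda>t. h (t i, t j)) \<in> borel_measurable T"
    if "i \<in> {..<3}" "j \<in> {..<3}" "h \<in> borel_measurable N2" for i j and h :: "'a \<times> 'a \<Rightarrow> real"
    using that by measurable
  interpret T': prob_space T unfolding T_def by (rule T.prob_space_axioms)
  define c where "c k v t = (of_bool (col k t = col k v) :: real)" for k v t
  have c_range: "0 \<le> c k v t" "c k v t \<le> 1" for k v t by (auto simp: c_def)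
  have c_m [measurable]: "c k v \<in> borel_measurable N" for k v unfolding c_def[abs_def] by measurable
  have cT [measurable]: "(\<lambda>t. c k v (t i)) \<in> borel_measurable T" if "i \<in> {..<3}" for k v i
    using that by measurable
  have cell: "cell k u v p = c k u (fst p) * c k v (snd p)" for k u v p by (simp add: cell_def c_def of_bool_conj)
  have int_c: "(\<integral>t. c k v t \<partial>N) = vol k v" for k v
  proof -
    have "(\<integral>t. c k v t \<partial>N) = (\<integral>t. indicator {t\<in>space N. col k t = col k v} t \<partial>N)"
      by (intro Bochner_Integration.integral_cong) (auto simp: c_def indicator_def)
    then show ?thesis by (simp add: Int_absorb2 subset_eq vol_def \<mu>)
  qed
  have intT: "integrable T f" if "f \<in> borel_measurable T" "\<And>t. \<bar>f t\<bar> \<le> B" for f :: "(nat \<Rightarrow> 'a) \<Rightarrow> real" and B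
    using that by (intro T'.integrable_const_bound[of _ B]) auto
  \<comment> \<open>Every error term lives on two of the three vertices; the free vertex contributes
    just the volume of its cell.\<close>
  have factor: "(\<integral>t. c k v (t l) * (cell k u u' (t i, t j) * h (t i, t j)) \<partial>T) = vol k v * (\<integral>p. cell k u u' p * h p \<partial>N2)"
    and factor_int: "integrable T (\<lambda>t. c k v (t l) * (cell k u u' (t i, t j) * h (t i, t j)))"
    if "i \<in> {..<3}" "j \<in> {..<3}" "l \<in> {..<3}" "distinct [i, j, l]" "h \<in> borel_measurable N2" "\<And>p. \<bar>h p\<bar> \<le> 1"
    for h k u u' v i j l
  proof -
    have b: "\<bar>c k v s * (cell k u u' p * h p)\<bar> \<le> 1" for s p
      using c_range[of k v s] cell_range[of k u u' p] that(6)[of p] by (auto simp: abs_mult intro!: mult_le_one)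
    have m: "(\<lambda>p. cell k u u' p * h p) \<in> borel_measurable N2" using that by measurable
    show int: "integrable T (\<lambda>t. c k v (t l) * (cell k u u' (t i, t j) * h (t i, t j)))"
      using that m pair[OF that(1,2) m] cT[OF that(3)] b by (intro intT[of _ 1]) auto
    have "(\<integral>t. c k v (t l) * (cell k u u' (t i, t j) * h (t i, t j)) \<partial>T) = (\<integral>t. c k v t \<partial>N) * (\<integral>p. cell k u u' p * h p \<partial>N2)"
      unfolding T_def using that m int[unfolded T_def] c_range
      by (intro integral_PiM_pair_times[OF prob_space_axioms, of _ i j l "c k v" "\<lambda>p. cell k u u' p * h p"] integrable_const_bound[of _ 1]) auto
    then show "(\<integral>t. c k v (t l) * (cell k u u' (t i, t j) * h (t i, t j)) \<partial>T) = vol k v * (\<integral>p. cell k u u' p * h p \<partial>N2)"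
      by (simp add: int_c)
  qed
  have Wb: "\<bar>\<bar>W p - W q\<bar>\<bar> \<le> 1" "\<bar>1 - W p\<bar> \<le> 1" for p q
    using range[of p] range[of q] by auto
  have WT [measurable]: "(\<lambda>t. W (t i, t j)) \<in> borel_measurable T" if "i \<in> {..<3}" "j \<in> {..<3}" for i j
    using pair[OF that W] .
  have prod_le: "\<bar>W p * W q\<bar> \<le> 1" "\<bar>W p * W q * W s\<bar> \<le> 1" "\<bar>W p * W q * (1 - W s)\<bar> \<le> 1" for p q s
    using range[of p] range[of q] range[of s] by (auto simp: abs_mult intro!: mult_le_one)
  \<comment> \<open>The integrand is non-negative, and its integral is the difference of the two
    densities that \<open>path\<close> equates.\<close>
  have ae_path: "AE t in T. W (t 0, t 1) * W (t 1, t 2) * (1 - W (t 0, t 2)) = 0"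
  proof -
    have "(\<integral>t. W (t 0, t 1) * W (t 1, t 2) * (1 - W (t 0, t 2)) \<partial>T)
      = (\<integral>t. W (t 0, t 1) * W (t 1, t 2) - W (t 0, t 1) * W (t 1, t 2) * W (t 0, t 2) \<partial>T)"
      by (simp add: right_diff_distrib)
    also have "\<dots> = (\<integral>t. W (t 0, t 1) * W (t 1, t 2) \<partial>T) - (\<integral>t. W (t 0, t 1) * W (t 1, t 2) * W (t 0, t 2) \<partial>T)"
      using le3 prod_le by (intro Bochner_Integration.integral_diff intT[of _ 1]) auto
    also have "\<dots> = 0"
      using path by (simp add: kint_def T_def mult_ac)
    finally have "(\<integral>t. W (t 0, t 1) * W (t 1, t 2) * (1 - W (t 0, t 2)) \<partial>T) = 0" .
    moreover have "integrable T (\<lambda>t. W (t 0, t 1) * W (t 1, t 2) * (1 - W (t 0, t 2)))"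
      using le3 prod_le by (intro intT[of _ 1]) auto
    ultimately show ?thesis
      using range by (subst (asm) integral_nonneg_eq_0_iff_AE) auto
  qed
  have ae_cyc: "AE t in T. W (t 0, t 1) * W (t 1, t 2) * W (t 2, t 0) = 0"
  proof -
    have "(\<integral>t. W (t 0, t 1) * W (t 1, t 2) * W (t 2, t 0) \<partial>T) = 0"
      using cyc by (simp add: kint_def T_def mult_ac)
    moreover have "integrable T (\<lambda>t. W (t 0, t 1) * W (t 1, t 2) * W (t 2, t 0))"
      using le3 prod_le by (intro intT[of _ 1]) auto
    ultimately show ?thesis
      using range by (subst (asm) integral_nonneg_eq_0_iff_AE) auto
  qed
  show "W (x, z) = 1" if xy: "0 < W (x, y)" and yz: "0 < W (y, z)"
  proof -
    define p where "p = W (x, y)"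
    define q where "q = W (y, z)"
    have pq: "0 < p" "0 < q" "p \<le> 1" "q \<le> 1" using xy yz range by (auto simp: p_def q_def)
    from dense[OF xy] obtain D1 where D1: "D1 \<longlonglongrightarrow> 0" and ev1: "\<forall>\<^sub>F k in sequentially. 0 < vol (r k) x \<and> 0 < vol (r k) y \<and>
      (\<integral>s. cell (r k) x y s * \<bar>W s - p\<bar> \<partial>N2) \<le> vol (r k) x * vol (r k) y * D1 k" unfolding p_def by auto
    from dense[OF yz] obtain D2 where D2: "D2 \<longlonglongrightarrow> 0" and ev2: "\<forall>\<^sub>F k in sequentially. 0 < vol (r k) y \<and> 0 < vol (r k) z \<and>
      (\<integral>s. cell (r k) y z s * \<bar>W s - q\<bar> \<partial>N2) \<le> vol (r k) y * vol (r k) z * D2 k" unfolding q_def by auto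
    \<comment> \<open>Here \<open>u\<close>, \<open>v\<close>, \<open>t\<close> stand for the values
      of \<open>W\<close> on a triple near \<open>x\<close>, \<open>y\<close>, \<open>z\<close>. As
      \<open>u * v * (1 - t)\<close> vanishes, \<open>p * q\<close> may be replaced by the small
      difference \<open>p * q - u * v\<close>.\<close>
    have ineq: "p * q * (1 - t) \<le> \<bar>u - p\<bar> + \<bar>v - q\<bar>"
      if "u * v * (1 - t) = 0" "0 \<le> u" "u \<le> 1" "0 \<le> v" "v \<le> 1" "0 \<le> t" "t \<le> 1" for u v t
    proof -
      have "p * q * (1 - t) = (p * q - u * v) * (1 - t)" using that(1) by (simp add: left_diff_distrib)
      also have "\<dots> \<le> \<bar>p * q - u * v\<bar> * 1" using that by (intro mult_mono) auto
      also have "p * q - u * v = (p - u) * q + u * (q - v)" by (simp add: algebra_simps)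
      also have "\<bar>(p - u) * q + u * (q - v)\<bar> \<le> \<bar>p - u\<bar> * \<bar>q\<bar> + \<bar>u\<bar> * \<bar>q - v\<bar>"
        by (rule order_trans[OF abs_triangle_ineq]) (simp add: abs_mult)
      also have "\<dots> \<le> \<bar>p - u\<bar> * 1 + 1 * \<bar>q - v\<bar>"
        using that pq by (intro add_mono mult_mono) auto
      finally show ?thesis by (simp add: abs_minus_commute)
    qed
    show ?thesis
    proof (rule one)
      have "(\<lambda>k. (D1 k + D2 k) / (p * q)) \<longlonglongrightarrow> (0 + 0) / (p * q)"
        using pq by (intro tendsto_intros D1 D2) auto
      then show "(\<lambda>k. (D1 k + D2 k) / (p * q)) \<longlonglongrightarrow> 0" by simp
      show "\<forall>\<^sub>F k in sequentially. 0 < vol (r k) x \<and> 0 < vol (r k) z \<and>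
        (\<integral>s. cell (r k) x z s * (1 - W s) \<partial>N2) \<le> vol (r k) x * vol (r k) z * ((D1 k + D2 k) / (p * q))"
        using ev1 ev2
      proof eventually_elim
        case (elim k)
        define l where "l = r k"
        \<comment> \<open>The extra factor \<open>vol l y\<close> turns both sides into integrals
          over triples in the product of the three cells; it is cancelled at the end.\<close>
        have "p * q * (vol l y * (\<integral>s. cell l x z s * (1 - W s) \<partial>N2))
          = (\<integral>t. p * q * (c l y (t 1) * (cell l x z (t 0, t 2) * (1 - W (t 0, t 2)))) \<partial>T)"
          using factor[of 0 2 1 "\<lambda>s. 1 - W s" l y x z] Wb by simp
        also have "\<dots> \<le> (\<integral>t. c l z (t 2) * (cell l x y (t 0, t 1) * \<bar>W (t 0, t 1) - p\<bar>)
          + c l x (t 0) * (cell l y z (t 1, t 2) * \<bar>W (t 1, t 2) - q\<bar>) \<partial>T)"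
        proof (rule integral_mono_AE)
          show "integrable T (\<lambda>t. p * q * (c l y (t 1) * (cell l x z (t 0, t 2) * (1 - W (t 0, t 2)))))"
            using factor_int[of 0 2 1 "\<lambda>s. 1 - W s" l y x z] Wb by simp
          show "integrable T (\<lambda>t. c l z (t 2) * (cell l x y (t 0, t 1) * \<bar>W (t 0, t 1) - p\<bar>)
            + c l x (t 0) * (cell l y z (t 1, t 2) * \<bar>W (t 1, t 2) - q\<bar>))"
            using Wb unfolding p_def q_def by (intro Bochner_Integration.integrable_add factor_int) auto
          show "AE t in T. p * q * (c l y (t 1) * (cell l x z (t 0, t 2) * (1 - W (t 0, t 2))))
            \<le> c l z (t 2) * (cell l x y (t 0, t 1) * \<bar>W (t 0, t 1) - p\<bar>)
            + c l x (t 0) * (cell l y z (t 1, t 2) * \<bar>W (t 1, t 2) - q\<bar>)"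
            using ae_path
          proof eventually_elim
            case (elim t)
            have "(c l x (t 0) * c l y (t 1) * c l z (t 2)) * (p * q * (1 - W (t 0, t 2)))
              \<le> (c l x (t 0) * c l y (t 1) * c l z (t 2)) * (\<bar>W (t 0, t 1) - p\<bar> + \<bar>W (t 1, t 2) - q\<bar>)"
              using elim range c_range by (intro mult_left_mono ineq) auto
            then show ?case by (simp add: cell algebra_simps)
          qed
        qed
        also have "\<dots> = vol l z * (\<integral>s. cell l x y s * \<bar>W s - p\<bar> \<partial>N2) + vol l x * (\<integral>s. cell l y z s * \<bar>W s - q\<bar> \<partial>N2)"
          using factor[of 0 1 2 "\<lambda>s. \<bar>W s - p\<bar>" l z x y] factor[of 1 2 0 "\<lambda>s. \<bar>W s - q\<bar>" l x y z]
            factor_int[of 0 1 2 "\<lambda>s. \<bar>W s - p\<bar>" l z x y] factor_int[of 1 2 0 "\<lambda>s. \<bar>W s - q\<bar>" l x y z] Wb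
          by (simp add: p_def q_def)
        also have "\<dots> \<le> vol l z * (vol l x * vol l y * D1 k) + vol l x * (vol l y * vol l z * D2 k)"
          using elim unfolding l_def by (intro add_mono mult_left_mono) auto
        also have "\<dots> = vol l y * (vol l x * vol l z * (D1 k + D2 k))" by (simp add: algebra_simps)
        finally have "vol l y * (p * q * (\<integral>s. cell l x z s * (1 - W s) \<partial>N2)) \<le> vol l y * (vol l x * vol l z * (D1 k + D2 k))"
          by (simp add: mult_ac)
        then have "p * q * (\<integral>s. cell l x z s * (1 - W s) \<partial>N2) \<le> vol l x * vol l z * (D1 k + D2 k)"
          using elim by (simp add: l_def mult_le_cancel_left_pos)
        then show ?case using elim pq by (simp add: l_def field_simps)
      qed
    qed
  qed
  show "W (x, x) = 0"
  proof (rule ccontr)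
    assume "W (x, x) \<noteq> 0"
    then have xx: "0 < W (x, x)" using range[of "(x, x)"] by auto
    define p where "p = W (x, x)"
    have p: "0 < p" "p \<le> 1" using xx range by (auto simp: p_def)
    from dense[OF xx] obtain D where D: "D \<longlonglongrightarrow> 0" and ev: "\<forall>\<^sub>F k in sequentially. 0 < vol (r k) x \<and>
      (\<integral>s. cell (r k) x x s * \<bar>W s - p\<bar> \<partial>N2) \<le> vol (r k) x * vol (r k) x * D k" unfolding p_def by auto
    \<comment> \<open>One of the three values is 0, so one of the distances equals \<open>p\<close>,
      and the cube of \<open>p\<close> is at most \<open>p\<close>.\<close>
    have ineq: "p * p * p \<le> \<bar>u - p\<bar> + \<bar>v - p\<bar> + \<bar>w - p\<bar>"
      if "u * v * w = 0" "0 \<le> u" "0 \<le> v" "0 \<le> w" for u v w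
    proof -
      have "(p * p) * p \<le> 1 * p" using p by (intro mult_right_mono mult_le_one) auto
      then have "p * p * p \<le> p" by linarith
      moreover have "u = 0 \<or> v = 0 \<or> w = 0" using that(1) by auto
      ultimately show ?thesis by (elim disjE; linarith)
    qed
    have "\<forall>\<^sub>F k in sequentially. p * p * p \<le> 3 * D k"
      using ev
    proof eventually_elim
      case (elim k)
      define l where "l = r k"
      \<comment> \<open>Error on the edge from \<open>i\<close> to \<open>j\<close>, with all three
        vertices confined to the cell of the single point \<open>x\<close>.\<close>
      define F where "F i j m t = c l x (t m) * (cell l x x (t i, t j) * \<bar>W (t i, t j) - p\<bar>)" for i j m and t :: "nat \<Rightarrow> 'a"
      have F_int: "integrable T (F i j m)" "(\<integral>t. F i j m t \<partial>T) = vol l x * (\<integral>s. cell l x x s * \<bar>W s - p\<bar> \<partial>N2)"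
        if "i \<in> {..<3}" "j \<in> {..<3}" "m \<in> {..<3}" "distinct [i, j, m]" for i j m
        unfolding F_def using factor_int[of i j m "\<lambda>s. \<bar>W s - p\<bar>" l x x x] factor[of i j m "\<lambda>s. \<bar>W s - p\<bar>" l x x x] that Wb
        by (simp_all add: p_def)
      have "p * p * p * (vol l x * (\<integral>s. cell l x x s * 1 \<partial>N2)) = (\<integral>t. p * p * p * (c l x (t 2) * (cell l x x (t 0, t 1) * 1)) \<partial>T)"
        using factor[of 0 1 2 "\<lambda>_. 1" l x x x] by simp
      also have "\<dots> \<le> (\<integral>t. F 0 1 2 t + F 1 2 0 t + F 2 0 1 t \<partial>T)"
      proof (rule integral_mono_AE)
        show "integrable T (\<lambda>t. p * p * p * (c l x (t 2) * (cell l x x (t 0, t 1) * 1)))"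
          using factor_int[of 0 1 2 "\<lambda>_. 1" l x x x] by simp
        show "integrable T (\<lambda>t. F 0 1 2 t + F 1 2 0 t + F 2 0 1 t)"
          by (intro Bochner_Integration.integrable_add F_int) auto
        show "AE t in T. p * p * p * (c l x (t 2) * (cell l x x (t 0, t 1) * 1)) \<le> F 0 1 2 t + F 1 2 0 t + F 2 0 1 t"
          using ae_cyc
        proof eventually_elim
          case (elim t)
          have "(c l x (t 0) * c l x (t 1) * c l x (t 2)) * (p * p * p)
            \<le> (c l x (t 0) * c l x (t 1) * c l x (t 2)) * (\<bar>W (t 0, t 1) - p\<bar> + \<bar>W (t 1, t 2) - p\<bar> + \<bar>W (t 2, t 0) - p\<bar>)"
            using elim range c_range by (intro mult_left_mono ineq) auto
          then show ?case by (simp add: cell F_def algebra_simps)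
        qed
      qed
      also have "\<dots> = 3 * (vol l x * (\<integral>s. cell l x x s * \<bar>W s - p\<bar> \<partial>N2))"
        using F_int[of 0 1 2] F_int[of 1 2 0] F_int[of 2 0 1] by simp
      also have "\<dots> \<le> 3 * (vol l x * (vol l x * vol l x * D k))"
        using elim unfolding l_def by (intro mult_left_mono) auto
      finally have "(vol l x * vol l x * vol l x) * (p * p * p) \<le> (vol l x * vol l x * vol l x) * (3 * D k)"
        by (simp add: integral_cell mult_ac)
      then show ?case using elim by (simp add: l_def mult_le_cancel_left_pos)
    qed
    moreover have "(\<lambda>k. 3 * D k) \<longlonglongrightarrow> 3 * 0" by (intro tendsto_intros D)
    ultimately have "p * p * p \<le> 3 * 0"
      by (intro tendsto_lowerbound[of "\<lambda>k. 3 * D k" _ sequentially]) auto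
    then show False using p by (simp add: mult_le_0_iff not_le)
  qed
qed

end

section \<open>Kernels of convergent sequences of posets\<close>

text \<open>Tychonoff, with countability of the index type making the product first countable, so
  that compactness is sequential. No explicit diagonal sequence has to be built.\<close>

lemma convergent_subsequence_unit_cube:
  fixes g :: "nat \<Rightarrow> 'i::countable \<Rightarrow> real"
  assumes "\<And>n i. 0 \<le> g n i \<and> g n i \<le> 1"
  obtains s g' where "strict_mono s" "\<And>i. (\<lambda>n. g (s n) i) \<longlonglongrightarrow> g' i"
proof -
  define S where "S = PiE UNIV (\<lambda>_::'i. {0..1::real})"
  have "compactin (product_topology (\<lambda>_::'i. euclidean) UNIV) S"
    unfolding S_def compactin_PiE by simp
  then have "compact S" by (simp add: euclidean_product_topology)
  then have "seq_compact S" by (rule compact_imp_seq_compact)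
  moreover have "\<forall>n. g n \<in> S" using assms by (auto simp: S_def)
  ultimately obtain g' s where s: "strict_mono s" "(g \<circ> s) \<longlonglongrightarrow> g'"
    unfolding seq_compact_def by metis
  have "(\<lambda>n. g (s n) i) \<longlonglongrightarrow> g' i" for i
    using continuous_on_tendsto_compose[OF continuous_on_product_coordinates[of i] s(2)] by (simp add: o_def)
  with s(1) show thesis by (rule that)
qed

text \<open>Interchange of limits. The bound is uniform in \<open>n\<close>, so a level
  \<open>r j\<close> can be fixed for the given accuracy before \<open>n\<close> is chosen.\<close>

lemma tendsto_of_uniform_approx:
  fixes a :: "nat \<Rightarrow> real"
  assumes ab: "\<And>n l. l > 0 \<Longrightarrow> \<bar>a n - b n l\<bar> \<le> C / sqrt (real l)"
    and b: "\<And>l. (\<lambda>n. b n l) \<longlonglongrightarrow> B l" and B: "(\<lambda>j. B (r j)) \<longlonglongrightarrow> L" and r: "\<And>j::nat. j \<le> r j"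
  shows "a \<longlonglongrightarrow> L"
proof (rule LIMSEQ_I)
  fix e :: real assume e: "e > 0"
  have "filterlim (\<lambda>j. sqrt (real (r j))) at_top sequentially"
    by (intro filterlim_compose[OF sqrt_at_top] filterlim_compose[OF filterlim_real_sequentially]
        filterlim_at_top_mono[OF filterlim_ident]) (use r in auto)
  then have "(\<lambda>j. C / sqrt (real (r j))) \<longlonglongrightarrow> 0" by (rule tendsto_divide_0[OF tendsto_const, OF filterlim_at_top_imp_at_infinity])
  then have "\<forall>\<^sub>F j in sequentially. C / sqrt (real (r j)) < e / 3"
    using e by (intro order_tendstoD(2)) auto
  moreover have "\<forall>\<^sub>F j in sequentially. dist (B (r j)) L < e / 3"
    using e by (intro tendstoD[OF B]) auto
  ultimately have "\<forall>\<^sub>F j in sequentially. 0 < j \<and> C / sqrt (real (r j)) < e / 3 \<and> dist (B (r j)) L < e / 3"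
    using eventually_gt_at_top[of 0] by eventually_elim auto
  then obtain j where j: "0 < j" "C / sqrt (real (r j)) < e / 3" "dist (B (r j)) L < e / 3"
    by (auto dest: eventually_happens)
  have "0 < r j" using r[of j] j(1) by simp
  have "\<forall>\<^sub>F n in sequentially. dist (b n (r j)) (B (r j)) < e / 3"
    using e by (intro tendstoD[OF b]) auto
  then obtain n0 where n0: "\<And>n. n \<ge> n0 \<Longrightarrow> dist (b n (r j)) (B (r j)) < e / 3"
    by (auto simp: eventually_sequentially)
  have "norm (a n - L) < e" if "n \<ge> n0" for n
    using n0[OF that] j ab[OF \<open>0 < r j\<close>, of n] unfolding dist_real_def real_norm_def by linarith
  then show "\<exists>n0. \<forall>n\<ge>n0. norm (a n - L) < e" by auto
qed

section \<open>Class sizes and pair masses of a coloured finite poset\<close>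

locale coloured_poset =
  fixes m :: nat and S :: "nat \<Rightarrow> nat \<Rightarrow> bool" and c :: "nat \<Rightarrow> nat \<Rightarrow> nat"
  assumes m: "1 \<le> m" and irr: "\<And>x. \<not> S x x" and tr: "\<And>x y z. S x y \<Longrightarrow> S y z \<Longrightarrow> S x z"
    and c0: "\<And>v. c 0 v = 0" and c_div: "\<And>l v. c l v = c (Suc l) v div 4"
begin

abbreviation "V \<equiv> {..<m}"
definition f :: "nat \<times> nat \<Rightarrow> real" where "f x = of_bool (S (fst x) (snd x))"
definition \<mu> :: "nat \<Rightarrow> nat \<Rightarrow> real" where "\<mu> l a = real (card {v\<in>V. c l v = a}) / real m"
text \<open>Masses rather than densities: they are additive under refinement, and their limits make
  sense even when a class becomes negligible.\<close>

definition \<nu> :: "nat \<Rightarrow> nat \<Rightarrow> nat \<Rightarrow> real" where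
  "\<nu> l a b = (\<Sum>u\<in>{u\<in>V. c l u = a}. \<Sum>v\<in>{v\<in>V. c l v = b}. f (u, v)) / (real m * real m)"

lemma f_range: "0 \<le> f x \<and> f x \<le> 1" by (simp add: f_def)

lemma c_less: "c l v < 4 ^ l"
proof (induction l)
  case (Suc l)
  then show ?case using c_div[of l v] by (simp add: div_less_iff_less_mult mult.commute)
qed (simp add: c0)

lemma class_split: "(\<Sum>u\<in>{u\<in>V. c l u = a}. g u) = (\<Sum>r<4. \<Sum>u\<in>{u\<in>V. c (Suc l) u = 4 * a + r}. g u)"
  for g :: "nat \<Rightarrow> real"
proof -
  have eq: "{u\<in>V. c l u = a} = (\<Union>r\<in>{..<4}. {u\<in>V. c (Suc l) u = 4 * a + r})"
  proof (intro set_eqI iffI)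
    fix u assume u: "u \<in> {u\<in>V. c l u = a}"
    then have "c (Suc l) u = 4 * a + c (Suc l) u mod 4" using c_div[of l u] mult_div_mod_eq[of 4 "c (Suc l) u"] by simp
    then show "u \<in> (\<Union>r\<in>{..<4}. {u\<in>V. c (Suc l) u = 4 * a + r})" using u by (intro UN_I[of "c (Suc l) u mod 4"]) auto
  qed (auto simp: c_div[of l])
  show ?thesis unfolding eq by (subst sum.UNION_disjoint) auto
qed

lemma \<mu>_split: "\<mu> l a = (\<Sum>r<4. \<mu> (Suc l) (4 * a + r))"
  using class_split[where g="\<lambda>_. 1" and l=l and a=a] by (simp add: \<mu>_def sum_divide_distrib[symmetric])

lemma \<nu>_split: "\<nu> l a b = (\<Sum>r<4. \<Sum>s<4. \<nu> (Suc l) (4 * a + r) (4 * b + s))"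
proof -
  have "(\<Sum>u\<in>{u\<in>V. c l u = a}. \<Sum>v\<in>{v\<in>V. c l v = b}. f (u, v))
    = (\<Sum>r<4. \<Sum>u\<in>{u\<in>V. c (Suc l) u = 4 * a + r}. \<Sum>s<4. \<Sum>v\<in>{v\<in>V. c (Suc l) v = 4 * b + s}. f (u, v))"
    by (simp only: class_split[where a=a and l=l] class_split[where a=b and l=l])
  also have "\<dots> = (\<Sum>r<4. \<Sum>s<4. \<Sum>u\<in>{u\<in>V. c (Suc l) u = 4 * a + r}. \<Sum>v\<in>{v\<in>V. c (Suc l) v = 4 * b + s}. f (u, v))"
    by (intro sum.cong refl sum.swap)
  finally show ?thesis by (simp only: \<nu>_def sum_divide_distrib)
qed

lemma \<mu>_sum: "(\<Sum>a<4 ^ l. \<mu> l a) = 1"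
proof -
  have "(\<Sum>a<4 ^ l. \<Sum>v\<in>{v\<in>V. c l v = a}. 1 :: real) = (\<Sum>v\<in>V. 1)"
    by (rule sum.group) (auto simp: c_less)
  then show ?thesis using m by (simp add: \<mu>_def sum_divide_distrib[symmetric])
qed

lemma \<nu>_range: "0 \<le> \<nu> l a b" "\<nu> l a b \<le> \<mu> l a * \<mu> l b"
proof -
  show "0 \<le> \<nu> l a b" unfolding \<nu>_def using f_range by (intro divide_nonneg_nonneg sum_nonneg) auto
  have "(\<Sum>u\<in>{u\<in>V. c l u = a}. \<Sum>v\<in>{v\<in>V. c l v = b}. f (u, v)) \<le> (\<Sum>u\<in>{u\<in>V. c l u = a}. \<Sum>v\<in>{v\<in>V. c l v = b}. 1)"
    using f_range by (intro sum_mono) auto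
  then show "\<nu> l a b \<le> \<mu> l a * \<mu> l b" unfolding \<nu>_def \<mu>_def using m by (simp add: divide_right_mono)
qed

lemma \<mu>_range: "0 \<le> \<mu> l a" "\<mu> l a \<le> 1"
proof -
  show "0 \<le> \<mu> l a" by (simp add: \<mu>_def)
  have "card {v\<in>V. c l v = a} \<le> card V" by (intro card_mono) auto
  then show "\<mu> l a \<le> 1" using m by (simp add: \<mu>_def)
qed

lemma \<nu>_zero: "4 ^ l \<le> a \<or> 4 ^ l \<le> b \<Longrightarrow> \<nu> l a b = 0"
proof -
  have e: "{v\<in>V. c l v = a} = {}" if "4 ^ l \<le> a" for a using that c_less[of l] by (auto simp: not_le[symmetric])
  show "4 ^ l \<le> a \<or> 4 ^ l \<le> b \<Longrightarrow> \<nu> l a b = 0" by (elim disjE; simp only: \<nu>_def e) simp_all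
qed

lemma pair_mean_eq: "pair_mean V (c l) f (u, v) = \<nu> l (c l u) (c l v) / (\<mu> l (c l u) * \<mu> l (c l v))"
proof -
  have eq: "{x \<in> V \<times> V. map_prod (c l) (c l) x = map_prod (c l) (c l) (u, v)} = {u'\<in>V. c l u' = c l u} \<times> {v'\<in>V. c l v' = c l v}"
    by auto
  show ?thesis
    unfolding cmean_def eq using m by (simp add: \<mu>_def \<nu>_def card_cartesian_product sum.cartesian_product)
qed

text \<open>For fixed \<open>k\<close>, \<open>E\<close> and \<open>l\<close> the right-hand side is
  one expression in finitely many sizes and masses, whatever the poset; this is what survives the
  passage to a subsequence.\<close>

lemma edge_sum_step:
  assumes E: "E \<subseteq> {..<k} \<times> {..<k}"
  shows "edge_sum V k E (\<lambda>_. pair_mean V (c l) f) / real m ^ k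
    = (\<Sum>s\<in>{..<k} \<rightarrow>\<^sub>E {..<4 ^ l}. (\<Prod>i<k. \<mu> l (s i)) *
        (\<Prod>e\<in>E. \<nu> l (s (fst e)) (s (snd e)) / (\<mu> l (s (fst e)) * \<mu> l (s (snd e)))))"
proof -
  define h where "h s = (\<Prod>e\<in>E. \<nu> l (s (fst e)) (s (snd e)) / (\<mu> l (s (fst e)) * \<mu> l (s (snd e))))" for s :: "nat \<Rightarrow> nat"
  have "edge_sum V k E (\<lambda>_. pair_mean V (c l) f) = (\<Sum>\<phi>\<in>{..<k} \<rightarrow>\<^sub>E V. h (\<lambda>i\<in>{..<k}. c l (\<phi> i)))"
    unfolding edge_sum_def h_def
  proof (intro sum.cong prod.cong refl)
    fix \<phi> e assume "e \<in> E"
    then have "fst e < k" "snd e < k" using E by auto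
    then show "pair_mean V (c l) f (map_prod \<phi> \<phi> e) = \<nu> l ((\<lambda>i\<in>{..<k}. c l (\<phi> i)) (fst e)) ((\<lambda>i\<in>{..<k}. c l (\<phi> i)) (snd e)) /
         (\<mu> l ((\<lambda>i\<in>{..<k}. c l (\<phi> i)) (fst e)) * \<mu> l ((\<lambda>i\<in>{..<k}. c l (\<phi> i)) (snd e)))"
      using pair_mean_eq[of l "\<phi> (fst e)" "\<phi> (snd e)"] by (simp add: map_prod_def case_prod_unfold)
  qed
  also have "\<dots> = (\<Sum>s\<in>{..<k} \<rightarrow>\<^sub>E {..<4 ^ l}. (\<Prod>i<k. real (card {v\<in>V. c l v = s i})) * h s)"
    by (rule sum_PiE_colours) (auto simp: c_less)
  finally have *: "edge_sum V k E (\<lambda>_. pair_mean V (c l) f) = \<dots>" .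
  have "(\<Prod>i<k. \<mu> l (s i)) = (\<Prod>i<k. real (card {v\<in>V. c l v = s i})) / real m ^ k" for s
    by (simp add: \<mu>_def prod_dividef)
  then show ?thesis unfolding * h_def[symmetric] by (simp add: sum_divide_distrib)
qed

lemma edge_sum_approx:
  assumes E: "oriented k E" and cut: "cut_bounded V (\<lambda>x. f x - pair_mean V (c l) f x) (2 * (real (card V))\<^sup>2 / sqrt (real l))"
  shows "\<bar>edge_sum V k E (\<lambda>_. f) / real m ^ k - edge_sum V k E (\<lambda>_. pair_mean V (c l) f) / real m ^ k\<bar> \<le> 2 * real (card E) / sqrt (real l)"
proof -
  have "\<bar>edge_sum V k E (\<lambda>_. f) - edge_sum V k E (\<lambda>_. pair_mean V (c l) f)\<bar> \<le> real (card E) * (2 / sqrt (real l)) * real (card V) ^ k"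
  proof (rule edge_sum_cut[OF _ E])
    show "0 \<le> pair_mean V (c l) f x \<and> pair_mean V (c l) f x \<le> 1" for x
      by (rule cmean_range) (rule f_range)
    show "cut_bounded V (\<lambda>x. f x - pair_mean V (c l) f x) (2 / sqrt (real l) * (real (card V))\<^sup>2)" using cut by simp
  qed (auto simp: f_range)
  then show ?thesis using m by (simp add: diff_divide_distrib[symmetric] abs_divide field_simps)
qed

text \<open>The closing edge is automatic by transitivity. Equality of densities passes to the
  limit, unlike the pointwise implication, and encodes transitivity of the limit kernel almost
  everywhere.\<close>

lemma edge_sum_path: "edge_sum V 3 {(0, 1), (1, 2)} (\<lambda>_. f) = edge_sum V 3 {(0, 1), (1, 2), (0, 2)} (\<lambda>_. f)"
  unfolding edge_sum_def
proof (intro sum.cong refl)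
  fix \<phi> :: "nat \<Rightarrow> nat"
  show "(\<Prod>e\<in>{(0, 1), (1, 2)}. f (map_prod \<phi> \<phi> e)) = (\<Prod>e\<in>{(0, 1), (1, 2), (0, 2)}. f (map_prod \<phi> \<phi> e))"
    using tr[of "\<phi> 0" "\<phi> 1" "\<phi> 2"] by (auto simp: f_def)
qed

lemma edge_sum_cycle: "edge_sum V 3 {(0, 1), (1, 2), (2, 0)} (\<lambda>_. f) = 0"
  unfolding edge_sum_def
proof (intro sum.neutral ballI)
  fix \<phi> :: "nat \<Rightarrow> nat"
  show "(\<Prod>e\<in>{(0, 1), (1, 2), (2, 0)}. f (map_prod \<phi> \<phi> e)) = 0"
    using tr[of "\<phi> 0" "\<phi> 1" "\<phi> 2"] tr[of "\<phi> 0" "\<phi> 2" "\<phi> 0"] irr[of "\<phi> 0"] by (auto simp: f_def)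
qed

end

section \<open>Homomorphism densities as edge sums\<close>

definition edges :: "lposet \<Rightarrow> (nat \<times> nat) set" where
  "edges Q = {(i, j). snd Q i j}"

lemma oriented_edges: "valid_poset Q \<Longrightarrow> oriented (fst Q) (edges Q)"
  unfolding oriented_def
proof (intro conjI subsetI ballI)
  assume "valid_poset Q"
  moreover obtain k R where Q: "Q = (k, R)" by (cases Q)
  ultimately have "(\<forall>x y. R x y \<longrightarrow> x < k \<and> y < k) \<and> (\<forall>x. \<not> R x x) \<and> (\<forall>x y z. R x y \<longrightarrow> R y z \<longrightarrow> R x z)"
    unfolding valid_poset_def by simp
  then have R: "\<And>x y. R x y \<Longrightarrow> x < k \<and> y < k" "\<And>x. \<not> R x x" "\<And>x y z. R x y \<Longrightarrow> R y z \<Longrightarrow> R x z"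
    by blast+
  show "e \<in> {..<fst Q} \<times> {..<fst Q}" if "e \<in> edges Q" for e
    using that R(1) by (auto simp: edges_def Q)
  show "case e of (i, j) \<Rightarrow> i \<noteq> j \<and> (j, i) \<notin> edges Q" if "e \<in> edges Q" for e
    using that R(2) R(3)[of "fst e" "snd e" "fst e"] by (auto simp: edges_def Q)
qed

lemma kernel_density_eq_kint:
  assumes "valid_poset Q"
  shows "kernel_density M (\<lambda>x y. W (x, y)) Q = kint M (fst Q) (edges Q) W"
proof -
  have "{(i, j). i < fst Q \<and> j < fst Q \<and> snd Q i j} = edges Q"
    using assms by (auto simp: edges_def valid_poset_def split: prod.splits)
  then show ?thesis
    by (cases Q) (simp add: kernel_density_def kint_def map_prod_def case_prod_unfold)
qed

lemma hom_density_eq_edge_sum: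
  assumes "valid_poset Q"
  shows "hom_density Q (m, S) = edge_sum {..<m} (fst Q) (edges Q) (\<lambda>_ x. of_bool (S (fst x) (snd x))) / real m ^ fst Q"
proof -
  obtain k R where Q: "Q = (k, R)" by (cases Q)
  have fin: "finite (edges Q)"
    using oriented_edges[OF assms] by (auto simp: oriented_def intro: finite_subset)
  have *: "(\<Prod>e\<in>edges Q. of_bool (S (\<phi> (fst e)) (\<phi> (snd e)))) = (of_bool (\<forall>x y. R x y \<longrightarrow> S (\<phi> x) (\<phi> y)) :: real)" for \<phi>
  proof (cases "\<forall>x y. R x y \<longrightarrow> S (\<phi> x) (\<phi> y)")
    case True
    then show ?thesis by (auto simp: edges_def Q intro!: prod.neutral)
  next
    case False
    then obtain x y where "R x y" "\<not> S (\<phi> x) (\<phi> y)" by auto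
    then have "\<exists>e\<in>edges Q. of_bool (S (\<phi> (fst e)) (\<phi> (snd e))) = (0::real)" by (intro bexI[of _ "(x, y)"]) (auto simp: edges_def Q)
    then have "(\<Prod>e\<in>edges Q. of_bool (S (\<phi> (fst e)) (\<phi> (snd e)))) = (0::real)" by (rule prod_zero[OF fin])
    then show ?thesis using False by simp
  qed
  have "real (card {\<phi> \<in> {..<k} \<rightarrow>\<^sub>E {..<m}. \<forall>x y. R x y \<longrightarrow> S (\<phi> x) (\<phi> y)}) = (\<Sum>\<phi>\<in>{..<k} \<rightarrow>\<^sub>E {..<m}. of_bool (\<forall>x y. R x y \<longrightarrow> S (\<phi> x) (\<phi> y)))"
    by (simp add: sum.If_cases finite_PiE of_bool_def Int_def)
  then show ?thesis
    using * by (simp add: hom_density_def Q edge_sum_def)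
qed

section \<open>Construction of the kernel of a sequence of posets\<close>

theorem kernel_of_poset_sequence:
  fixes P :: "nat \<Rightarrow> lposet"
  assumes valid: "\<And>n. valid_poset (P n)"
  obtains s N precN WN where "strict_mono s" "ordered_prob_space (N :: real measure) precN" "poset_kernel N precN WN"
    "\<And>Q. valid_poset Q \<Longrightarrow> (\<lambda>n. hom_density Q (P (s n))) \<longlonglongrightarrow> kernel_density N WN Q"
proof -
  define m where "m n = fst (P n)" for n
  define S where "S n = snd (P n)" for n
  define f where "f n x = (of_bool (S n (fst x) (snd x)) :: real)" for n and x :: "nat \<times> nat"
  have PS: "P n = (m n, S n)" for n by (simp add: m_def S_def)
  have v: "1 \<le> m n \<and> (\<forall>x y. S n x y \<longrightarrow> x < m n \<and> y < m n) \<and> (\<forall>x. \<not> S n x x) \<and> (\<forall>x y z. S n x y \<longrightarrow> S n y z \<longrightarrow> S n x z)" for n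
    using valid[of n] unfolding PS valid_poset_def prod.case .
  define good where "good n c \<longleftrightarrow> (\<forall>v. c 0 v = 0) \<and> (\<forall>l v. c l v = c (Suc l) v div 4) \<and>
    (\<forall>l>0. cut_bounded {..<m n} (\<lambda>x. f n x - pair_mean {..<m n} (c l) (f n) x) (2 * (real (card {..<m n}))\<^sup>2 / sqrt (real l)))"
    for n and c :: "nat \<Rightarrow> nat \<Rightarrow> nat"
  have "\<exists>c. good n c" for n
  proof (rule regular_colourings[of "{..<m n}" "f n"])
    show "finite {..<m n}" by simp
    show "0 \<le> f n x \<and> f n x \<le> 1" for x by (simp add: f_def)
    fix c :: "nat \<Rightarrow> nat \<Rightarrow> nat"
    assume "\<And>v. c 0 v = 0" "\<And>l v. c l v = c (Suc l) v div 4"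
      "\<And>l. l > 0 \<Longrightarrow> cut_bounded {..<m n} (\<lambda>x. f n x - pair_mean {..<m n} (c l) (f n) x) (2 * (real (card {..<m n}))\<^sup>2 / sqrt (real l))"
    then have "good n c" unfolding good_def by blast
    then show ?thesis by blast
  qed
  then obtain c where good: "\<And>n. good n (c n)" by metis
  have c: "\<And>n v. c n 0 v = (0::nat)" "\<And>n l v. c n l v = c n (Suc l) v div 4"
    and cut: "\<And>n l. l > 0 \<Longrightarrow> cut_bounded {..<m n} (\<lambda>x. f n x - pair_mean {..<m n} (c n l) (f n) x) (2 * (real (card {..<m n}))\<^sup>2 / sqrt (real l))"
    using good unfolding good_def by blast+
  have cp: "coloured_poset (m n) (S n) (c n)" for n
    proof
    show "S n x z" if "S n x y" "S n y z" for x y z using v[of n] that by blast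
    show "c n l v = c n (Suc l) v div 4" for l v by (rule c(2))
  qed (use v[of n] c(1) in auto)
  define \<mu> where "\<mu> n = coloured_poset.\<mu> (m n) (c n)" for n
  define \<nu> where "\<nu> n = coloured_poset.\<nu> (m n) (S n) (c n)" for n
  have f_eq: "f n = coloured_poset.f (S n)" for n
    by (rule ext) (simp add: coloured_poset.f_def[OF cp[of n]] f_def)
  \<comment> \<open>All sizes and masses of all levels form one countable family, so a single
    subsequence serves every level.\<close>
  define g where "g n i = (case i of Inl (l, a) \<Rightarrow> \<mu> n l a | Inr (l, a, b) \<Rightarrow> \<nu> n l a b)" for n i
  have "coloured_poset.\<nu> (m n) (S n) (c n) l a b \<le> 1" for n l a b
    by (rule order_trans[OF coloured_poset.\<nu>_range(2)[OF cp]]) (intro mult_le_one coloured_poset.\<mu>_range[OF cp])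
  then have g01: "0 \<le> g n i \<and> g n i \<le> 1" for n i
    using coloured_poset.\<mu>_range[OF cp[of n]] coloured_poset.\<nu>_range(1)[OF cp[of n]]
    by (auto simp: g_def \<mu>_def \<nu>_def split: sum.splits prod.splits)
  obtain s g' where s: "strict_mono s" and g': "\<And>i. (\<lambda>n. g (s n) i) \<longlonglongrightarrow> g' i"
    by (rule convergent_subsequence_unit_cube[of g, OF g01]) (rule that)
  define \<mu>' where "\<mu>' l a = g' (Inl (l, a))" for l a
  define \<nu>' where "\<nu>' l a b = g' (Inr (l, a, b))" for l a b
  have \<mu>_lim: "(\<lambda>n. \<mu> (s n) l a) \<longlonglongrightarrow> \<mu>' l a" and \<nu>_lim: "(\<lambda>n. \<nu> (s n) l a b) \<longlonglongrightarrow> \<nu>' l a b" for l a b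
    using g'[of "Inl (l, a)"] g'[of "Inr (l, a, b)"] by (simp_all add: g_def \<mu>'_def \<nu>'_def)
  have \<mu>'_nonneg: "0 \<le> \<mu>' l a" for l a
    by (rule LIMSEQ_le_const[OF \<mu>_lim]) (auto simp: \<mu>_def coloured_poset.\<mu>_range[OF cp])
  have \<mu>'_sum: "(\<Sum>a<4 ^ l. \<mu>' l a) = 1" for l
  proof (rule LIMSEQ_unique)
    show "(\<lambda>n. \<Sum>a<4 ^ l. \<mu> (s n) l a) \<longlonglongrightarrow> (\<Sum>a<4 ^ l. \<mu>' l a)" by (intro tendsto_sum \<mu>_lim)
    show "(\<lambda>n. \<Sum>a<4 ^ l. \<mu> (s n) l a) \<longlonglongrightarrow> 1" by (simp add: \<mu>_def coloured_poset.\<mu>_sum[OF cp])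
  qed
  have \<mu>'_split: "\<mu>' l a = (\<Sum>r<4. \<mu>' (Suc l) (4 * a + r))" for l a
  proof (rule LIMSEQ_unique[OF \<mu>_lim])
    have "\<mu> n l a = (\<Sum>r<4. \<mu> n (Suc l) (4 * a + r))" for n
      unfolding \<mu>_def by (rule coloured_poset.\<mu>_split[OF cp])
    then show "(\<lambda>n. \<mu> (s n) l a) \<longlonglongrightarrow> (\<Sum>r<4. \<mu>' (Suc l) (4 * a + r))"
      by (simp only:) (intro tendsto_sum \<mu>_lim)
  qed
  have \<nu>'_split: "\<nu>' l a b = (\<Sum>r<4. \<Sum>t<4. \<nu>' (Suc l) (4 * a + r) (4 * b + t))" for l a b
  proof (rule LIMSEQ_unique[OF \<nu>_lim])
    have "\<nu> n l a b = (\<Sum>r<4. \<Sum>t<4. \<nu> n (Suc l) (4 * a + r) (4 * b + t))" for n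
      unfolding \<nu>_def by (rule coloured_poset.\<nu>_split[OF cp])
    then show "(\<lambda>n. \<nu> (s n) l a b) \<longlonglongrightarrow> (\<Sum>r<4. \<Sum>t<4. \<nu>' (Suc l) (4 * a + r) (4 * b + t))"
      by (simp only:) (intro tendsto_sum \<nu>_lim)
  qed
  have \<nu>'_nonneg: "0 \<le> \<nu>' l a b" for l a b
    by (rule LIMSEQ_le_const[OF \<nu>_lim]) (auto simp: \<nu>_def coloured_poset.\<nu>_range[OF cp])
  have \<nu>'_le: "\<nu>' l a b \<le> \<mu>' l a * \<mu>' l b" for l a b
    by (rule LIMSEQ_le[OF \<nu>_lim tendsto_mult[OF \<mu>_lim \<mu>_lim]]) (auto simp: \<nu>_def \<mu>_def coloured_poset.\<nu>_range[OF cp])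
  have \<nu>'_zero: "\<nu>' l a b = 0" if "4 ^ l \<le> a \<or> 4 ^ l \<le> b" for l a b
    using \<nu>_lim[of l a b] that by (simp add: \<nu>_def coloured_poset.\<nu>_zero[OF cp] LIMSEQ_const_iff)
  define N where "N = uniform_measure lborel {0..<1::real}"
  have pN: "prob_space N" unfolding N_def by (rule prob_space_uniform_measure) auto
  have spN: "space N = UNIV" by (simp add: N_def)
  obtain col where col: "\<And>l. col l \<in> measurable N (count_space UNIV)" "\<And>l x. col l x = col (Suc l) x div 4"
    "\<And>l. AE x in N. col l x < 4 ^ l" "\<And>l a. a < 4 ^ l \<Longrightarrow> measure N {x. col l x = a} = \<mu>' l a"
    using interval_colouring[of \<mu>'] \<mu>'_nonneg \<mu>'_sum \<mu>'_split unfolding N_def by metis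
  interpret prob_space N by (rule pN)
  \<comment> \<open>The cells are measured at every colour, whereas their sizes are prescribed by
    \<open>\<mu>'\<close> only below \<open>4 ^ l\<close>; beyond that bound the masses
    \<open>\<nu>'\<close> vanish.\<close>
  define M where "M l a = measure N {x\<in>space N. col l x = a}" for l a
  have M: "M l a = \<mu>' l a" if "a < 4 ^ l" for l a using col(4)[OF that] by (simp add: M_def spN)
  interpret NC: nested_cells N col \<nu>' M
  proof
    show "\<nu>' l a b \<le> M l a * M l b" for l a b
    proof (cases "a < 4 ^ l \<and> b < 4 ^ l")
      case True
      then show ?thesis using \<nu>'_le[of l a b] M by simp
    next
      case False
      then have "\<nu>' l a b = 0" by (intro \<nu>'_zero) auto
      then show ?thesis by (simp add: M_def)
    qed
    show "\<nu>' l a b = (\<Sum>r<4. \<Sum>s<4. \<nu>' (Suc l) (4 * a + r) (4 * b + s))" for l a b by (rule \<nu>'_split)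
    show "col l x = col (Suc l) x div 4" for l x by (rule col(2))
  qed (simp_all add: M_def col(1,3) \<nu>'_nonneg)
  obtain W r where W: "W \<in> borel_measurable NC.N2" "\<And>p. 0 \<le> W p \<and> W p \<le> 1" "\<And>k. k \<le> r k"
    "AE p in NC.N2. (\<lambda>k. NC.U (r k) p) \<longlonglongrightarrow> W p"
    and dense: "\<And>x y. 0 < W (x, y) \<Longrightarrow> \<exists>D. D \<longlonglongrightarrow> 0 \<and> (\<forall>\<^sub>F k in sequentially. 0 < NC.vol (r k) x \<and> 0 < NC.vol (r k) y \<and>
      (\<integral>p. NC.cell (r k) x y p * \<bar>W p - W (x, y)\<bar> \<partial>NC.N2) \<le> NC.vol (r k) x * NC.vol (r k) y * D k)"
    and one: "\<And>x y D. D \<longlonglongrightarrow> 0 \<Longrightarrow> (\<forall>\<^sub>F k in sequentially. 0 < NC.vol (r k) x \<and> 0 < NC.vol (r k) y \<and>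
      (\<integral>p. NC.cell (r k) x y p * (1 - W p) \<partial>NC.N2) \<le> NC.vol (r k) x * NC.vol (r k) y * D k) \<Longrightarrow> W (x, y) = 1"
    by (rule NC.limit_kernel) (rule that)
  define a where "a n k E = edge_sum {..<m n} k E (\<lambda>_. f n) / real (m n) ^ k" for n k E
  have step_lim: "(\<lambda>n. edge_sum {..<m (s n)} k E (\<lambda>_. pair_mean {..<m (s n)} (c (s n) l) (f (s n))) / real (m (s n)) ^ k) \<longlonglongrightarrow> kint N k E (NC.U l)"
    if E: "E \<subseteq> {..<k} \<times> {..<k}" for k E l
  proof -
    define t where "t \<mu> \<nu> u = (\<Prod>i<k. \<mu> l (u i)) * (\<Prod>e\<in>E. \<nu> l (u (fst e)) (u (snd e)) / (\<mu> l (u (fst e)) * \<mu> l (u (snd e))))"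
      for \<mu> :: "nat \<Rightarrow> nat \<Rightarrow> real" and \<nu> :: "nat \<Rightarrow> nat \<Rightarrow> nat \<Rightarrow> real" and u :: "nat \<Rightarrow> nat"
    have finE: "finite E" using E by (rule finite_subset) auto
    have "(\<lambda>n. t (\<mu> (s n)) (\<nu> (s n)) u) \<longlonglongrightarrow> t \<mu>' \<nu>' u" for u
    proof (cases "\<exists>i<k. \<mu>' l (u i) = 0")
      case False
      have "(\<lambda>n. \<nu> (s n) l (u (fst e)) (u (snd e)) / (\<mu> (s n) l (u (fst e)) * \<mu> (s n) l (u (snd e)))) \<longlonglongrightarrow>
        \<nu>' l (u (fst e)) (u (snd e)) / (\<mu>' l (u (fst e)) * \<mu>' l (u (snd e)))" if "e \<in> E" for e
        using False E that by (intro tendsto_divide tendsto_mult \<nu>_lim \<mu>_lim) auto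
      then show ?thesis unfolding t_def by (intro tendsto_mult tendsto_prod \<mu>_lim)
    next
      case True
      \<comment> \<open>Some class disappears in the limit. The quotients may then fail to converge,
        but they stay in [0,1] while the product of the class sizes tends to 0.\<close>
      then have z: "(\<Prod>i<k. \<mu>' l (u i)) = 0" by auto
      have "(\<lambda>n. \<Prod>i<k. \<mu> (s n) l (u i)) \<longlonglongrightarrow> (\<Prod>i<k. \<mu>' l (u i))" by (intro tendsto_prod \<mu>_lim)
      then have p0: "(\<lambda>n. \<Prod>i<k. \<mu> (s n) l (u i)) \<longlonglongrightarrow> 0" using z by simp
      have "(\<lambda>n. t (\<mu> (s n)) (\<nu> (s n)) u) \<longlonglongrightarrow> 0"
      proof (rule tendsto_sandwich[OF _ _ tendsto_const p0])
        have q: "0 \<le> \<nu> n l a b / (\<mu> n l a * \<mu> n l b) \<and> \<nu> n l a b / (\<mu> n l a * \<mu> n l b) \<le> 1" for n a b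
        proof -
          have "0 \<le> x / y \<and> x / y \<le> 1" if "0 \<le> x" "x \<le> y" for x y :: real
            using that by (cases "y = 0") (auto simp: divide_le_eq_1)
          then show ?thesis unfolding \<mu>_def \<nu>_def using coloured_poset.\<nu>_range[OF cp[of n]] by blast
        qed
        have pm: "0 \<le> (\<Prod>i<k. \<mu> n l (u i))" for n
          unfolding \<mu>_def by (intro prod_nonneg) (simp add: coloured_poset.\<mu>_range[OF cp])
        show "\<forall>\<^sub>F n in sequentially. 0 \<le> t (\<mu> (s n)) (\<nu> (s n)) u"
          unfolding t_def using q by (intro always_eventually allI mult_nonneg_nonneg pm prod_nonneg) auto
        show "\<forall>\<^sub>F n in sequentially. t (\<mu> (s n)) (\<nu> (s n)) u \<le> (\<Prod>i<k. \<mu> (s n) l (u i))"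
          unfolding t_def using q by (intro always_eventually allI mult_left_le prod_le_1 pm) auto
      qed
      then show ?thesis by (simp add: t_def z)
    qed
    then have "(\<lambda>n. \<Sum>u\<in>{..<k} \<rightarrow>\<^sub>E {..<4 ^ l}. t (\<mu> (s n)) (\<nu> (s n)) u) \<longlonglongrightarrow> (\<Sum>u\<in>{..<k} \<rightarrow>\<^sub>E {..<4 ^ l}. t \<mu>' \<nu>' u)"
      by (intro tendsto_sum)
    moreover have "kint N k E (NC.U l) = (\<Sum>u\<in>{..<k} \<rightarrow>\<^sub>E {..<4 ^ l}. t \<mu>' \<nu>' u)"
      unfolding NC.kint_U[OF E] NC.w_def t_def
    proof (intro sum.cong refl arg_cong2[where f="(*)"] prod.cong)
      fix u i assume "u \<in> {..<k} \<rightarrow>\<^sub>E {..<4 ^ l :: nat}" "i \<in> {..<k}"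
      then show "M l (u i) = \<mu>' l (u i)" by (intro M) auto
    next
      fix u e assume "u \<in> {..<k} \<rightarrow>\<^sub>E {..<4 ^ l :: nat}" "e \<in> E"
      then have "u (fst e) < 4 ^ l" "u (snd e) < 4 ^ l" using E by (auto simp: PiE_iff)
      then show "\<nu>' l (u (fst e)) (u (snd e)) / (M l (u (fst e)) * M l (u (snd e))) =
        \<nu>' l (u (fst e)) (u (snd e)) / (\<mu>' l (u (fst e)) * \<mu>' l (u (snd e)))" by (simp add: M)
    qed
    ultimately show ?thesis
      using coloured_poset.edge_sum_step[OF cp E] by (simp add: f_eq t_def \<mu>_def \<nu>_def)
  qed
  have a_lim: "(\<lambda>n. a (s n) k E) \<longlonglongrightarrow> kint N k E W" if E: "oriented k E" for k E
  proof (rule tendsto_of_uniform_approx[where r=r and C="2 * real (card E)"])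
    have E': "E \<subseteq> {..<k} \<times> {..<k}" "\<And>i j. (i, j) \<in> E \<Longrightarrow> i \<noteq> j" using E by (auto simp: oriented_def)
    show "(\<lambda>n. edge_sum {..<m (s n)} k E (\<lambda>_. pair_mean {..<m (s n)} (c (s n) l) (f (s n))) / real (m (s n)) ^ k) \<longlonglongrightarrow> kint N k E (NC.U l)" for l
      by (rule step_lim[OF E'(1)])
    show "(\<lambda>j. kint N k E (NC.U (r j))) \<longlonglongrightarrow> kint N k E W" by (rule NC.kint_tendsto[OF E' W(1,4)])
    show "\<bar>a (s n) k E - edge_sum {..<m (s n)} k E (\<lambda>_. pair_mean {..<m (s n)} (c (s n) l) (f (s n))) / real (m (s n)) ^ k\<bar> \<le> 2 * real (card E) / sqrt (real l)"
      if "l > 0" for n l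
      unfolding a_def using cut[OF that, of "s n"] unfolding f_eq by (intro coloured_poset.edge_sum_approx[OF cp E])
    show "j \<le> r j" for j by (rule W(3))
  qed
  have path: "kint N 3 {(0, 1), (1, 2)} W = kint N 3 {(0, 1), (1, 2), (0, 2)} W"
  proof (rule LIMSEQ_unique)
    show "(\<lambda>n. a (s n) 3 {(0, 1), (1, 2)}) \<longlonglongrightarrow> kint N 3 {(0, 1), (1, 2)} W"
      by (rule a_lim) (auto simp: oriented_def)
    have "a n 3 {(0, 1), (1, 2)} = a n 3 {(0, 1), (1, 2), (0, 2)}" for n
      unfolding a_def f_eq by (simp only: coloured_poset.edge_sum_path[OF cp])
    then show "(\<lambda>n. a (s n) 3 {(0, 1), (1, 2)}) \<longlonglongrightarrow> kint N 3 {(0, 1), (1, 2), (0, 2)} W"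
      using a_lim[of 3 "{(0, 1), (1, 2), (0, 2)}"] by (simp add: oriented_def)
  qed
  have cyc: "kint N 3 {(0, 1), (1, 2), (2, 0)} W = 0"
  proof (rule LIMSEQ_unique)
    show "(\<lambda>n. a (s n) 3 {(0, 1), (1, 2), (2, 0)}) \<longlonglongrightarrow> kint N 3 {(0, 1), (1, 2), (2, 0)} W"
      by (rule a_lim) (auto simp: oriented_def)
    show "(\<lambda>n. a (s n) 3 {(0, 1), (1, 2), (2, 0)}) \<longlonglongrightarrow> 0"
      unfolding a_def f_eq coloured_poset.edge_sum_cycle[OF cp] by simp
  qed
  have trans: "W (x, z) = 1" if "0 < W (x, y)" "0 < W (y, z)" for x y z
    by (rule NC.kernel_pointwise(1)[OF W(1,2) dense one path cyc that])
  have irrefl: "W (x, x) = 0" for x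
    by (rule NC.kernel_pointwise(2)[OF W(1,2) dense one path cyc])
  have [measurable]: "W \<in> borel_measurable (N \<Otimes>\<^sub>M N)" by (rule W(1))
  show thesis
  proof
    show "strict_mono s" by (rule s)
    have "{(x, y) \<in> space N \<times> space N. 0 < W (x, y)} = {p \<in> space (N \<Otimes>\<^sub>M N). 0 < W p}"
      by (auto simp: space_pair_measure)
    then show "ordered_prob_space N (\<lambda>x y. 0 < W (x, y))"
      unfolding ordered_prob_space_def using pN irrefl trans by auto
    show "poset_kernel N (\<lambda>x y. 0 < W (x, y)) (\<lambda>x y. W (x, y))"
      unfolding poset_kernel_def using W(1,2) trans by (auto simp: case_prod_eta)
    fix Q assume Q: "valid_poset Q"
    have "hom_density Q (P n) = a n (fst Q) (edges Q)" for n
      unfolding PS hom_density_eq_edge_sum[OF Q] a_def f_def by simp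
    then show "(\<lambda>n. hom_density Q (P (s n))) \<longlonglongrightarrow> kernel_density N (\<lambda>x y. W (x, y)) Q"
      using a_lim[OF oriented_edges[OF Q]] by (simp add: kernel_density_eq_kint[OF Q])
  qed
qed

section \<open>Sampling from a kernel\<close>

text \<open>Overwriting the value at \<open>j\<close> by an arbitrary \<open>v\<close> loses
  nothing, because the old value can be read off at \<open>i\<close>. The resulting map into all
  functions is injective.\<close>

lemma card_coincidence:
  assumes "i \<in> I" "j \<in> I" "finite I" "i \<noteq> j"
  shows "card {\<phi>\<in>I \<rightarrow>\<^sub>E {..<n}. \<phi> i = \<phi> j} * n \<le> n ^ card I"
proof -
  let ?B = "{\<phi>\<in>I \<rightarrow>\<^sub>E {..<n}. \<phi> i = \<phi> j}"
  have "inj_on (\<lambda>(\<phi>, v). \<phi>(j := v)) (?B \<times> {..<n})"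
  proof (rule inj_onI, clarify)
    fix \<phi> v \<psi> w assume *: "\<phi> i = \<phi> j" "\<psi> i = \<psi> j" "\<phi>(j := v) = \<psi>(j := w)"
    have ne: "\<phi> x = \<psi> x" if "x \<noteq> j" for x
      using fun_cong[OF *(3), of x] that by simp
    have "\<phi> x = \<psi> x" for x
      using ne[of x] ne[OF assms(4)] *(1,2) by (cases "x = j") simp_all
    moreover have "v = w" using fun_cong[OF *(3), of j] by simp
    ultimately show "\<phi> = \<psi> \<and> v = w" by auto
  qed
  then have "card (?B \<times> {..<n}) \<le> card (I \<rightarrow>\<^sub>E {..<n})"
    using assms by (intro card_inj_on_le) (auto simp: PiE_iff extensional_def intro: finite_PiE)
  then show ?thesis using assms by (simp add: card_cartesian_product card_PiE)
qed

lemma card_not_inj: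
  assumes "finite I"
  shows "card {\<phi>\<in>I \<rightarrow>\<^sub>E {..<n}. \<not> inj_on \<phi> I} * n \<le> (card I)\<^sup>2 * n ^ card I"
proof -
  define B where "B p = {\<phi>\<in>I \<rightarrow>\<^sub>E {..<n}. \<phi> (fst p) = \<phi> (snd p)}" for p
  define D where "D = {p\<in>I \<times> I. fst p \<noteq> snd p}"
  have fin: "finite D" "finite (B p)" for p using assms by (auto simp: D_def B_def finite_PiE)
  have "{\<phi>\<in>I \<rightarrow>\<^sub>E {..<n}. \<not> inj_on \<phi> I} \<subseteq> (\<Union>p\<in>D. B p)"
    by (fastforce simp: inj_on_def B_def D_def)
  then have "card {\<phi>\<in>I \<rightarrow>\<^sub>E {..<n}. \<not> inj_on \<phi> I} \<le> (\<Sum>p\<in>D. card (B p))"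
    using fin by (intro order_trans[OF card_mono card_UN_le]) auto
  then have "card {\<phi>\<in>I \<rightarrow>\<^sub>E {..<n}. \<not> inj_on \<phi> I} * n \<le> (\<Sum>p\<in>D. card (B p) * n)"
    unfolding sum_distrib_right[symmetric] by (rule mult_right_mono) simp
  also have "\<dots> \<le> (\<Sum>p\<in>D. n ^ card I)"
    using assms unfolding B_def D_def by (intro sum_mono card_coincidence) auto
  also have "\<dots> \<le> (card I)\<^sup>2 * n ^ card I"
  proof -
    have "card D \<le> card (I \<times> I)" using assms by (intro card_mono) (auto simp: D_def)
    then show ?thesis by (simp add: card_cartesian_product power2_eq_square)
  qed
  finally show ?thesis .
qed

text \<open>With \<open>s\<close> the integer part of the square root of \<open>n\<close>,
  monotonicity places \<open>T n\<close> between its values at the squares of \<open>s\<close> and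
  \<open>s + 1\<close>, and the ratio of consecutive squares tends to 1.\<close>

lemma tendsto_of_square_subsequence:
  fixes T :: "nat \<Rightarrow> real"
  assumes mono: "\<And>m n. m \<le> n \<Longrightarrow> T m \<le> T n" and nn: "\<And>n. 0 \<le> T n"
    and lim: "(\<lambda>m. T ((Suc m)\<^sup>2) / real ((Suc m)\<^sup>2) ^ k) \<longlonglongrightarrow> t"
  shows "(\<lambda>n. T n / real n ^ k) \<longlonglongrightarrow> t"
proof -
  define u where "u m = T (m\<^sup>2) / real (m\<^sup>2) ^ k" for m
  have u: "u \<longlonglongrightarrow> t" using lim unfolding u_def[symmetric] by (rule LIMSEQ_imp_Suc)
  define s where "s n = nat \<lfloor>sqrt (real n)\<rfloor>" for n
  have s_real: "real (s n) = of_int \<lfloor>sqrt (real n)\<rfloor>" for n by (simp add: s_def)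
  have s_le: "(s n)\<^sup>2 \<le> n" for n
  proof -
    have "real (s n) \<le> sqrt (real n)" unfolding s_real by linarith
    then have "(real (s n))\<^sup>2 \<le> (sqrt (real n))\<^sup>2" by (intro power_mono) auto
    then have "real ((s n)\<^sup>2) \<le> real n" by simp
    then show ?thesis by (simp only: of_nat_le_iff)
  qed
  have s_ge: "n \<le> (Suc (s n))\<^sup>2" for n
  proof -
    have "sqrt (real n) \<le> real (Suc (s n))" using s_real[of n] by simp linarith
    then have "(sqrt (real n))\<^sup>2 \<le> (real (Suc (s n)))\<^sup>2" by (intro power_mono) auto
    then have "real n \<le> real ((Suc (s n))\<^sup>2)" by simp
    then show ?thesis by (simp only: of_nat_le_iff)
  qed
  have s_top: "filterlim s at_top sequentially"
    unfolding s_def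
    by (intro filterlim_compose[OF filterlim_nat_sequentially] filterlim_compose[OF filterlim_floor_sequentially]
        filterlim_compose[OF sqrt_at_top filterlim_real_sequentially])
  have ratio: "(\<lambda>m. real m / real (Suc m)) \<longlonglongrightarrow> 1" by (rule LIMSEQ_n_over_Suc_n)
  have ratio': "(\<lambda>m. real (Suc m) / real m) \<longlonglongrightarrow> 1" by (rule LIMSEQ_Suc_n_over_n)
  have low: "(\<lambda>m. u m * ((real m / real (Suc m))\<^sup>2) ^ k) \<longlonglongrightarrow> t"
    using tendsto_mult[OF u tendsto_power[OF tendsto_power[OF ratio, of 2], of k]] by simp
  have up: "(\<lambda>m. u (Suc m) * ((real (Suc m) / real m)\<^sup>2) ^ k) \<longlonglongrightarrow> t"
    using tendsto_mult[OF LIMSEQ_Suc[OF u] tendsto_power[OF tendsto_power[OF ratio', of 2], of k]] by simp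
  show ?thesis
  proof (rule tendsto_sandwich)
    show "(\<lambda>n. u (s n) * ((real (s n) / real (Suc (s n)))\<^sup>2) ^ k) \<longlonglongrightarrow> t"
      by (rule filterlim_compose[OF low s_top])
    show "(\<lambda>n. u (Suc (s n)) * ((real (Suc (s n)) / real (s n))\<^sup>2) ^ k) \<longlonglongrightarrow> t"
      by (rule filterlim_compose[OF up s_top])
    have ev: "\<forall>\<^sub>F n in sequentially. 1 \<le> s n \<and> 1 \<le> n"
      by (intro eventually_conj eventually_ge_at_top) (use s_top in \<open>unfold filterlim_at_top, blast\<close>)
    show "\<forall>\<^sub>F n in sequentially. u (s n) * ((real (s n) / real (Suc (s n)))\<^sup>2) ^ k \<le> T n / real n ^ k"
      using ev
    proof eventually_elim
      case (elim n)
      have "u (s n) * ((real (s n) / real (Suc (s n)))\<^sup>2) ^ k = T ((s n)\<^sup>2) / real ((Suc (s n))\<^sup>2) ^ k"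
        using elim by (simp add: u_def power_divide)
      also have "\<dots> \<le> T n / real n ^ k"
        using elim by (intro frac_le power_mono nn mono s_le of_nat_mono s_ge) auto
      finally show ?case .
    qed
    show "\<forall>\<^sub>F n in sequentially. T n / real n ^ k \<le> u (Suc (s n)) * ((real (Suc (s n)) / real (s n))\<^sup>2) ^ k"
      using ev
    proof eventually_elim
      case (elim n)
      have "T n / real n ^ k \<le> T ((Suc (s n))\<^sup>2) / real ((s n)\<^sup>2) ^ k"
        using elim by (intro frac_le power_mono nn mono s_ge of_nat_mono s_le) auto
      also have "\<dots> = u (Suc (s n)) * ((real (Suc (s n)) / real (s n))\<^sup>2) ^ k"
        using elim by (simp add: u_def power_divide del: of_nat_Suc)
      finally show ?case .
    qed
  qed
qed

text \<open>The two copies use disjoint blocks of coordinates, so Fubini separates them; a shift by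
  \<open>k\<close> identifies the second integral with the first.\<close>

lemma kint_double:
  assumes "prob_space M" and E: "E \<subseteq> {..<k} \<times> {..<k}" and W [measurable]: "W \<in> borel_measurable (M \<Otimes>\<^sub>M M)"
    and range: "\<And>p. p \<in> space (M \<Otimes>\<^sub>M M) \<Longrightarrow> 0 \<le> W p \<and> W p \<le> 1"
  defines "E' \<equiv> map_prod ((+) k) ((+) k) ` E"
  shows "kint M (k + k) (E \<union> E') W = (kint M k E W)\<^sup>2"
proof -
  interpret prob_space M by fact
  interpret product_sigma_finite "\<lambda>_. M" ..
  define K where "K = {k..<k + k}"
  have un: "{..<k + k} = {..<k} \<union> K" "{..<k} \<inter> K = {}" "finite K" by (auto simp: K_def)
  have finE: "finite E" using E by (rule finite_subset) auto
  have E': "E' \<subseteq> K \<times> K" "finite E'" "E \<inter> E' = {}"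
    using E finE by (auto simp: E'_def K_def)
  define F where "F E x = (\<Prod>e\<in>E. W (map_prod x x e))" for E and x :: "nat \<Rightarrow> 'a"
  have F_m: "F D \<in> borel_measurable (PiM I (\<lambda>_. M))" if "D \<subseteq> I \<times> I" for D I
    unfolding F_def[abs_def] using W that by (rule measurable_edge_prod)
  have F_b: "\<bar>F D x\<bar> \<le> 1" if "D \<subseteq> I \<times> I" "x \<in> space (PiM I (\<lambda>_. M))" for D I x
  proof -
    have "0 \<le> W (map_prod x x e) \<and> W (map_prod x x e) \<le> 1" if "e \<in> D" for e
      using \<open>D \<subseteq> I \<times> I\<close> \<open>x \<in> _\<close> that by (intro range) (auto simp: space_pair_measure space_PiM PiE_iff)
    then show ?thesis unfolding F_def abs_prod by (intro prod_le_1) auto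
  qed
  interpret PK: prob_space "PiM {..<k + k} (\<lambda>_. M)" by (intro prob_space_PiM prob_space_axioms)
  have sub: "E \<union> E' \<subseteq> {..<k + k} \<times> {..<k + k}" using E E' by (auto simp: K_def)
  have int: "integrable (PiM ({..<k} \<union> K) (\<lambda>_. M)) (F (E \<union> E'))"
    unfolding un(1)[symmetric] using F_b[OF sub] F_m[OF sub] by (intro PK.integrable_const_bound[of _ 1]) auto
  have FU: "F (E \<union> E') x = F E x * F E' x" for x
    unfolding F_def using finE E' by (intro prod.union_disjoint) auto
  have mg: "F (E \<union> E') (merge {..<k} K (x, y)) = F E x * F E' y" for x y
  proof -
    have "F E (merge {..<k} K (x, y)) = F E x"
      unfolding F_def using E by (intro prod.cong refl arg_cong[where f=W]) (auto simp: merge_def)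
    moreover have "F E' (merge {..<k} K (x, y)) = F E' y"
      unfolding F_def using E'(1) un(2) by (intro prod.cong refl arg_cong[where f=W]) (auto simp: merge_def)
    ultimately show ?thesis by (simp add: FU)
  qed
  have "kint M (k + k) (E \<union> E') W = (\<integral>x. (\<integral>y. F (E \<union> E') (merge {..<k} K (x, y)) \<partial>PiM K (\<lambda>_. M)) \<partial>PiM {..<k} (\<lambda>_. M))"
    unfolding kint_def F_def[symmetric] un(1) using un int by (intro product_integral_fold) auto
  also have "\<dots> = (\<integral>x. (\<integral>y. F E x * F E' y \<partial>PiM K (\<lambda>_. M)) \<partial>PiM {..<k} (\<lambda>_. M))"
    by (simp only: mg)
  also have "\<dots> = kint M k E W * (\<integral>y. F E' y \<partial>PiM K (\<lambda>_. M))"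
    by (simp add: kint_def F_def)
  also have "(\<integral>y. F E' y \<partial>PiM K (\<lambda>_. M)) = (\<integral>y. F E (\<lambda>i\<in>{..<k}. y (k + i)) \<partial>PiM K (\<lambda>_. M))"
  proof (intro Bochner_Integration.integral_cong refl)
    fix y
    have "F E' y = (\<Prod>e\<in>E. W (map_prod y y (map_prod ((+) k) ((+) k) e)))"
      unfolding F_def E'_def by (subst prod.reindex) (auto simp: inj_on_def)
    also have "\<dots> = F E (\<lambda>i\<in>{..<k}. y (k + i))"
      unfolding F_def using E by (intro prod.cong refl arg_cong[where f=W]) auto
    finally show "F E' y = F E (\<lambda>i\<in>{..<k}. y (k + i))" .
  qed
  also have "\<dots> = (\<integral>x. F E x \<partial>distr (PiM K (\<lambda>_. M)) (PiM {..<k} (\<lambda>_. M)) (\<lambda>y. \<lambda>i\<in>{..<k}. y (k + i)))"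
    using F_m[OF E] by (intro integral_distr[symmetric] measurable_restrict) (auto simp: K_def)
  also have "\<dots> = kint M k E W"
    unfolding kint_def F_def[symmetric]
    by (subst distr_PiM_reindex[where M="\<lambda>_. M"]) (auto simp: K_def prob_space_axioms)
  finally show ?thesis by (simp add: power2_eq_square)
qed

section \<open>The random array and its second moments\<close>

abbreviation unit_measure :: "real measure" where "unit_measure \<equiv> uniform_measure lborel {0..1}"

lemma prob_space_unit_measure: "prob_space unit_measure"
  by (rule prob_space_uniform_measure) auto

lemma measure_unit_measure_lessThan:
  assumes "0 \<le> w" "w \<le> 1"
  shows "measure unit_measure {..<w} = w"
proof -
  have "{0..1} \<inter> {..<w} = (if w = 1 then {0..<1} else {0..<w})" using assms by auto
  then show ?thesis using assms by (subst measure_uniform_measure) auto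
qed

locale random_array = prob_space M for M :: "'a measure" +
  fixes W :: "'a \<times> 'a \<Rightarrow> real"
  assumes W [measurable]: "W \<in> borel_measurable (M \<Otimes>\<^sub>M M)"
    and W_range: "\<And>p. p \<in> space (M \<Otimes>\<^sub>M M) \<Longrightarrow> 0 \<le> W p \<and> W p \<le> 1"
begin

abbreviation "PX \<equiv> PiM UNIV (\<lambda>_::nat. M)"
abbreviation "PZ \<equiv> PiM UNIV (\<lambda>_::nat \<times> nat. unit_measure)"
abbreviation "R \<equiv> PX \<Otimes>\<^sub>M PZ"

sublocale X: product_prob_space "\<lambda>_::nat. M" UNIV ..
sublocale Z: product_prob_space "\<lambda>_::nat \<times> nat. unit_measure" UNIV
proof -
  interpret L: prob_space unit_measure by (rule prob_space_unit_measure)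
  show "product_prob_space (\<lambda>_::nat \<times> nat. unit_measure)" ..
qed
sublocale P: pair_prob_space PX PZ ..

definition edge :: "(nat \<Rightarrow> 'a) \<times> (nat \<times> nat \<Rightarrow> real) \<Rightarrow> nat \<times> nat \<Rightarrow> real" where
  "edge \<omega> d = of_bool (snd \<omega> d < W (map_prod (fst \<omega>) (fst \<omega>) d))"

text \<open>Indicator of the event that \<open>\<theta>\<close> is a homomorphism into the random
  relation. It does not refer to \<open>n\<close>, since all sample sizes share one array; this
  makes \<open>T\<close> monotone in \<open>n\<close>.\<close>

definition H :: "(nat \<times> nat) set \<Rightarrow> (nat \<Rightarrow> nat) \<Rightarrow> (nat \<Rightarrow> 'a) \<times> (nat \<times> nat \<Rightarrow> real) \<Rightarrow> real" where
  "H E \<theta> \<omega> = (\<Prod>e\<in>E. edge \<omega> (map_prod \<theta> \<theta> e))"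

lemma edge_measurable [measurable]: "(\<lambda>\<omega>. edge \<omega> d) \<in> borel_measurable R"
proof -
  obtain i j where d: "d = (i, j)" by (cases d)
  have "(\<lambda>\<omega>. snd \<omega> d) \<in> measurable R unit_measure" by measurable
  then have [measurable]: "(\<lambda>\<omega>. snd \<omega> d) \<in> borel_measurable R" by simp
  have [measurable]: "(\<lambda>\<omega>. W (fst \<omega> i, fst \<omega> j)) \<in> borel_measurable R" by measurable
  have "(\<lambda>\<omega>. if snd \<omega> d < W (fst \<omega> i, fst \<omega> j) then 1 else 0 :: real) \<in> borel_measurable R" by measurable
  then show ?thesis by (simp add: edge_def of_bool_def d)
qed

lemma H_measurable [measurable]: "H E \<theta> \<in> borel_measurable R"
  unfolding H_def[abs_def] by measurable

lemma edge_range: "0 \<le> edge \<omega> d \<and> edge \<omega> d \<le> 1" by (simp add: edge_def)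

lemma H_range: "0 \<le> H E \<theta> \<omega> \<and> H E \<theta> \<omega> \<le> 1"
  unfolding H_def by (intro conjI prod_nonneg prod_le_1 edge_range edge_range[THEN conjunct1])

lemma H_integrable [simp]: "integrable R (H E \<theta>)"
  using H_range by (intro P.integrable_const_bound[of _ 1]) auto

text \<open>The integrand is the indicator of a cylinder set over the finitely many coordinates in
  \<open>D\<close>.\<close>

lemma integral_threshold:
  assumes "finite D" and w: "\<And>d. d \<in> D \<Longrightarrow> 0 \<le> w d \<and> w d \<le> 1"
  shows "(\<integral>z. (\<Prod>d\<in>D. of_bool (z d < w d)) \<partial>PZ) = (\<Prod>d\<in>D. w d)"
proof -
  have "(\<integral>z. (\<Prod>d\<in>D. of_bool (z d < w d)) \<partial>PZ) = (\<integral>z. indicator (Z.emb UNIV D (PiE D (\<lambda>d. {..<w d}))) z \<partial>PZ :: real)"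
  proof (intro Bochner_Integration.integral_cong refl)
    fix z
    show "(\<Prod>d\<in>D. of_bool (z d < w d)) = (indicator (Z.emb UNIV D (PiE D (\<lambda>d. {..<w d}))) z :: real)"
      using assms(1) by (induction D) (auto simp: prod_emb_def indicator_def PiE_iff space_PiM)
  qed
  also have "\<dots> = measure PZ (Z.emb UNIV D (PiE D (\<lambda>d. {..<w d})))"
    by (simp add: space_PiM)
  also have "\<dots> = (\<Prod>d\<in>D. measure unit_measure {..<w d})"
    using assms(1) by (intro Z.measure_PiM_emb) auto
  also have "\<dots> = (\<Prod>d\<in>D. w d)"
    using w by (intro prod.cong refl measure_unit_measure_lessThan) auto
  finally show ?thesis .
qed

text \<open>Injectivity of \<open>\<theta>\<close> enters twice: distinct edges then use distinct
  thresholds, and distinct vertices use independent sample points.\<close>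

lemma expectation_H:
  assumes E: "E \<subseteq> {..<k} \<times> {..<k}" and inj: "inj_on \<theta> {..<k}"
  shows "(\<integral>\<omega>. H E \<theta> \<omega> \<partial>R) = kint M k E W"
proof -
  define D where "D = map_prod \<theta> \<theta> ` E"
  have finE: "finite E" using E by (rule finite_subset) auto
  have injE: "inj_on (map_prod \<theta> \<theta>) E"
    using map_prod_inj_on[OF inj inj] E by (rule inj_on_subset)
  have "(\<integral>\<omega>. H E \<theta> \<omega> \<partial>R) = (\<integral>x. (\<integral>z. H E \<theta> (x, z) \<partial>PZ) \<partial>PX)"
    by (rule P.integral_fst'[symmetric]) simp
  also have "\<dots> = (\<integral>x. (\<Prod>e\<in>E. W (map_prod (\<lambda>i\<in>{..<k}. x (\<theta> i)) (\<lambda>i\<in>{..<k}. x (\<theta> i)) e)) \<partial>PX)"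
  proof (intro Bochner_Integration.integral_cong refl)
    fix x assume x: "x \<in> space PX"
    have "(\<integral>z. H E \<theta> (x, z) \<partial>PZ) = (\<integral>z. (\<Prod>d\<in>D. of_bool (z d < W (map_prod x x d))) \<partial>PZ)"
      unfolding H_def edge_def D_def by (simp add: prod.reindex[OF injE])
    also have "\<dots> = (\<Prod>d\<in>D. W (map_prod x x d))"
    proof (rule integral_threshold)
      show "finite D" using finE by (simp add: D_def)
      show "0 \<le> W (map_prod x x d) \<and> W (map_prod x x d) \<le> 1" for d
        using x by (cases d) (auto simp: space_pair_measure space_PiM PiE_iff intro!: W_range)
    qed
    also have "\<dots> = (\<Prod>e\<in>E. W (map_prod (\<lambda>i\<in>{..<k}. x (\<theta> i)) (\<lambda>i\<in>{..<k}. x (\<theta> i)) e))"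
      unfolding D_def prod.reindex[OF injE] using E by (intro prod.cong) auto
    finally show "(\<integral>z. H E \<theta> (x, z) \<partial>PZ) = (\<Prod>e\<in>E. W (map_prod (\<lambda>i\<in>{..<k}. x (\<theta> i)) (\<lambda>i\<in>{..<k}. x (\<theta> i)) e))" .
  qed
  also have "\<dots> = (\<integral>x. (\<Prod>e\<in>E. W (map_prod x x e)) \<partial>distr PX (PiM {..<k} (\<lambda>_. M)) (\<lambda>x. \<lambda>i\<in>{..<k}. x (\<theta> i)))"
    using measurable_edge_prod[OF W E] by (intro integral_distr[symmetric] measurable_restrict) auto
  also have "\<dots> = kint M k E W"
    unfolding kint_def using inj by (subst distr_PiM_reindex[where M="\<lambda>_. M"]) (auto simp: prob_space_axioms)
  finally show ?thesis .
qed

definition T :: "nat \<Rightarrow> (nat \<times> nat) set \<Rightarrow> nat \<Rightarrow> (nat \<Rightarrow> 'a) \<times> (nat \<times> nat \<Rightarrow> real) \<Rightarrow> real" where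
  "T k E n \<omega> = (\<Sum>\<phi>\<in>{..<k} \<rightarrow>\<^sub>E {..<n}. H E \<phi> \<omega>)"

lemma kint_range: "E \<subseteq> {..<k} \<times> {..<k} \<Longrightarrow> 0 \<le> kint M k E W \<and> kint M k E W \<le> 1"
  using expectation_H[of E k "\<lambda>i. i"] H_range[of E "\<lambda>i. i"]
    P.integral_ge_const[of "H E (\<lambda>i. i)" 0] P.integral_le_const[of "H E (\<lambda>i. i)" 1] by auto

text \<open>Injective maps have exactly the expectation \<open>kint M k E W\<close>. Each of the
  others is off by at most 1, and \<open>card_not_inj\<close> bounds their number.\<close>

lemma expectation_T:
  assumes E: "E \<subseteq> {..<k} \<times> {..<k}" and n: "0 < n"
  shows "\<bar>(\<integral>\<omega>. T k E n \<omega> \<partial>R) - real n ^ k * kint M k E W\<bar> \<le> real (k\<^sup>2) * real n ^ k / real n"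
proof -
  define A where "A = {..<k} \<rightarrow>\<^sub>E {..<n}"
  have finA: "finite A" by (simp add: A_def finite_PiE)
  have "(\<integral>\<omega>. T k E n \<omega> \<partial>R) - real n ^ k * kint M k E W = (\<Sum>\<phi>\<in>A. (\<integral>\<omega>. H E \<phi> \<omega> \<partial>R) - kint M k E W)"
    unfolding T_def A_def by (simp add: sum_subtractf card_PiE)
  also have "\<bar>\<dots>\<bar> \<le> (\<Sum>\<phi>\<in>A. \<bar>(\<integral>\<omega>. H E \<phi> \<omega> \<partial>R) - kint M k E W\<bar>)" by (rule sum_abs)
  also have "\<dots> \<le> (\<Sum>\<phi>\<in>A. if inj_on \<phi> {..<k} then 0 else 1)"
  proof (intro sum_mono)
    fix \<phi>
    have "0 \<le> (\<integral>\<omega>. H E \<phi> \<omega> \<partial>R)" "(\<integral>\<omega>. H E \<phi> \<omega> \<partial>R) \<le> 1"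
      using H_range P.integral_ge_const[of "H E \<phi>" 0] P.integral_le_const[of "H E \<phi>" 1] by auto
    then show "\<bar>(\<integral>\<omega>. H E \<phi> \<omega> \<partial>R) - kint M k E W\<bar> \<le> (if inj_on \<phi> {..<k} then 0 else 1)"
      using expectation_H[OF E, of \<phi>] kint_range[OF E] by auto
  qed
  also have "\<dots> = real (card {\<phi>\<in>A. \<not> inj_on \<phi> {..<k}})"
    using finA by (simp add: sum.If_cases Int_def)
  also have "\<dots> \<le> real (k\<^sup>2) * real n ^ k / real n"
  proof -
    have "real (card {\<phi>\<in>A. \<not> inj_on \<phi> {..<k}} * n) \<le> real (k\<^sup>2 * n ^ k)"
      unfolding of_nat_le_iff A_def using card_not_inj[of "{..<k}" n] by simp
    then show ?thesis using n by (simp add: field_simps)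
  qed
  finally show ?thesis .
qed

lemma T_square:
  assumes E: "E \<subseteq> {..<k} \<times> {..<k}"
  defines "E' \<equiv> map_prod ((+) k) ((+) k) ` E"
  shows "(T k E n \<omega>)\<^sup>2 = T (k + k) (E \<union> E') n \<omega>"
proof -
  define A where "A = {..<k} \<rightarrow>\<^sub>E {..<n}"
  define A2 where "A2 = {..<k + k} \<rightarrow>\<^sub>E {..<n}"
  have fin: "finite E" "finite E'" "E \<inter> E' = {}"
    using E finite_subset[OF E] by (auto simp: E'_def)
  have injs: "inj_on (map_prod ((+) k) ((+) k)) E" by (auto simp: inj_on_def)
  \<comment> \<open>Glues two maps into one; the value \<open>undefined\<close> keeps the result
    extensional.\<close>
  define j where "j p i = (if i < k then fst p i else if i < k + k then snd p (i - k) else undefined)" for p :: "(nat \<Rightarrow> nat) \<times> (nat \<Rightarrow> nat)" and i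
  have "(T k E n \<omega>)\<^sup>2 = (\<Sum>p\<in>A \<times> A. H E (fst p) \<omega> * H E (snd p) \<omega>)"
    by (simp add: T_def A_def power2_eq_square sum_product sum.cartesian_product case_prod_unfold)
  also have "\<dots> = (\<Sum>\<theta>\<in>A2. H (E \<union> E') \<theta> \<omega>)"
  proof (rule sum.reindex_bij_witness[where i="\<lambda>\<theta>. (\<lambda>i\<in>{..<k}. \<theta> i, \<lambda>i\<in>{..<k}. \<theta> (k + i))" and j=j])
    fix p assume p: "p \<in> A \<times> A"
    show "j p \<in> A2" using p by (auto simp: j_def A_def A2_def PiE_iff extensional_def mem_Times_iff)
    show "(\<lambda>i\<in>{..<k}. j p i, \<lambda>i\<in>{..<k}. j p (k + i)) = p"
      using p by (cases p) (auto simp: j_def A_def fun_eq_iff PiE_iff extensional_def)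
    have "H E' (j p) \<omega> = H E (snd p) \<omega>"
      unfolding H_def E'_def prod.reindex[OF injs] using E by (intro prod.cong) (auto simp: j_def)
    moreover have "H E (j p) \<omega> = H E (fst p) \<omega>"
      unfolding H_def using E by (intro prod.cong) (auto simp: j_def)
    moreover have "H (E \<union> E') (j p) \<omega> = H E (j p) \<omega> * H E' (j p) \<omega>"
      unfolding H_def using fin by (intro prod.union_disjoint)
    ultimately show "H (E \<union> E') (j p) \<omega> = H E (fst p) \<omega> * H E (snd p) \<omega>" by simp
  next
    fix \<theta> assume \<theta>: "\<theta> \<in> A2"
    then show "(\<lambda>i\<in>{..<k}. \<theta> i, \<lambda>i\<in>{..<k}. \<theta> (k + i)) \<in> A \<times> A"
      by (auto simp: A_def A2_def PiE_iff)
    show "j (\<lambda>i\<in>{..<k}. \<theta> i, \<lambda>i\<in>{..<k}. \<theta> (k + i)) = \<theta>"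
      using \<theta> by (auto simp: j_def A2_def fun_eq_iff PiE_iff extensional_def)
  qed
  finally show ?thesis by (simp add: T_def A2_def)
qed

lemma T_integrable [simp]: "integrable R (T k E n)"
  unfolding T_def[abs_def] by (intro Bochner_Integration.integrable_sum H_integrable)

text \<open>Write \<open>c\<close> for \<open>k\<^sup>2 / n\<close>. The square of the density has
  expectation \<open>t\<^sup>2\<close> up to \<open>4 * c\<close>, because the doubled graph has
  \<open>2 * k\<close> vertices, and the mixed term contributes at most \<open>2 * c\<close>; hence
  the constant 6.\<close>

lemma second_moment:
  assumes E: "E \<subseteq> {..<k} \<times> {..<k}" and n: "0 < n"
  shows "(\<integral>\<omega>. (T k E n \<omega> / real n ^ k - kint M k E W)\<^sup>2 \<partial>R) \<le> 6 * real (k\<^sup>2) / real n"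
    and "integrable R (\<lambda>\<omega>. (T k E n \<omega> / real n ^ k - kint M k E W)\<^sup>2)"
proof -
  define E' where "E' = map_prod ((+) k) ((+) k) ` E"
  define t where "t = kint M k E W"
  define N where "N = real n ^ k"
  have N: "0 < N" using n by (simp add: N_def)
  have sub: "E \<union> E' \<subseteq> {..<k + k} \<times> {..<k + k}" using E by (auto simp: E'_def)
  have sq: "(T k E n \<omega>)\<^sup>2 = T (k + k) (E \<union> E') n \<omega>" for \<omega>
    unfolding E'_def by (rule T_square[OF E])
  have t2: "kint M (k + k) (E \<union> E') W = t\<^sup>2"
    unfolding E'_def t_def by (rule kint_double[OF prob_space_axioms E W W_range])
  have eq: "(T k E n \<omega> / N - t)\<^sup>2 = T (k + k) (E \<union> E') n \<omega> / N\<^sup>2 - (2 * t / N) * T k E n \<omega> + t\<^sup>2" for \<omega>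
    unfolding sq[symmetric] by (simp add: power2_diff power_divide)
  show "integrable R (\<lambda>\<omega>. (T k E n \<omega> / real n ^ k - kint M k E W)\<^sup>2)"
    unfolding N_def[symmetric] t_def[symmetric] eq by simp
  have t: "0 \<le> t" "t \<le> 1" using kint_range[OF E] by (auto simp: t_def)
  define c where "c = real (k\<^sup>2) / real n"
  have c: "0 \<le> c" by (simp add: c_def)
  have 1: "\<bar>(\<integral>\<omega>. T k E n \<omega> \<partial>R) - N * t\<bar> \<le> N * c"
    using expectation_T[OF E n] by (simp add: N_def t_def c_def mult.commute)
  have 2: "\<bar>(\<integral>\<omega>. T (k + k) (E \<union> E') n \<omega> \<partial>R) - N\<^sup>2 * t\<^sup>2\<bar> \<le> N\<^sup>2 * (4 * c)"
    using expectation_T[OF sub n] unfolding t2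
    by (simp add: N_def c_def power_add power2_eq_square mult_ac)
  have "(\<integral>\<omega>. (T k E n \<omega> / N - t)\<^sup>2 \<partial>R) = (\<integral>\<omega>. T (k + k) (E \<union> E') n \<omega> \<partial>R) / N\<^sup>2 - (2 * t / N) * (\<integral>\<omega>. T k E n \<omega> \<partial>R) + t\<^sup>2"
    unfolding eq by (simp add: P.prob_space)
  also have "\<dots> = ((\<integral>\<omega>. T (k + k) (E \<union> E') n \<omega> \<partial>R) - N\<^sup>2 * t\<^sup>2) / N\<^sup>2 + 2 * t * ((N * t - (\<integral>\<omega>. T k E n \<omega> \<partial>R)) / N)"
    using N by (simp add: field_simps power2_eq_square)
  also have "\<dots> \<le> 4 * c + 2 * 1 * c"
  proof (intro add_mono)
    show "((\<integral>\<omega>. T (k + k) (E \<union> E') n \<omega> \<partial>R) - N\<^sup>2 * t\<^sup>2) / N\<^sup>2 \<le> 4 * c"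
      using 2 N by (simp add: divide_le_eq mult.commute)
    have "(N * t - (\<integral>\<omega>. T k E n \<omega> \<partial>R)) / N \<le> c"
      using 1 N by (simp add: divide_le_eq mult.commute)
    then have "2 * t * ((N * t - (\<integral>\<omega>. T k E n \<omega> \<partial>R)) / N) \<le> 2 * t * c"
      using t by (intro mult_left_mono) auto
    also have "\<dots> \<le> 2 * 1 * c" using t c by (intro mult_right_mono) auto
    finally show "2 * t * ((N * t - (\<integral>\<omega>. T k E n \<omega> \<partial>R)) / N) \<le> 2 * 1 * c" .
  qed
  finally show "(\<integral>\<omega>. (T k E n \<omega> / real n ^ k - kint M k E W)\<^sup>2 \<partial>R) \<le> 6 * real (k\<^sup>2) / real n"
    by (simp add: N_def t_def c_def)
qed

lemma AE_T_tendsto: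
  assumes E: "E \<subseteq> {..<k} \<times> {..<k}"
  shows "AE \<omega> in R. (\<lambda>n. T k E n \<omega> / real n ^ k) \<longlonglongrightarrow> kint M k E W"
proof -
  define t where "t = kint M k E W"
  \<comment> \<open>Along squares the second moments are summable. The shift by \<open>Suc\<close>
    avoids the sample size 0.\<close>
  define g where "g m \<omega> = (T k E ((Suc m)\<^sup>2) \<omega> / real ((Suc m)\<^sup>2) ^ k - t)\<^sup>2" for m \<omega>
  have pos: "0 < (Suc m)\<^sup>2" for m by simp
  have "AE \<omega> in R. summable (\<lambda>m. g m \<omega>)"
  proof (rule AE_summable_of_summable_integral)
    show "integrable R (g m)" for m
      unfolding g_def t_def by (rule second_moment(2)[OF E pos])
    show "summable (\<lambda>m. \<integral>\<omega>. g m \<omega> \<partial>R)"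
    proof (rule summable_comparison_test'[where N=0])
      show "summable (\<lambda>m. 6 * real (k\<^sup>2) * (1 / real ((Suc m)\<^sup>2)))"
      proof (rule summable_mult)
        have "summable (\<lambda>n. inverse (real n ^ 2))" by (rule inverse_power_summable) simp
        then have "summable (\<lambda>m. inverse (real (Suc m) ^ 2))" by (rule summable_Suc_iff[THEN iffD2])
        then show "summable (\<lambda>m. 1 / real ((Suc m)\<^sup>2))" by (simp only: inverse_eq_divide of_nat_power)
      qed
      fix m
      have "0 \<le> (\<integral>\<omega>. g m \<omega> \<partial>R)" by (intro Bochner_Integration.integral_nonneg) (simp add: g_def)
      moreover have "(\<integral>\<omega>. g m \<omega> \<partial>R) \<le> 6 * real (k\<^sup>2) / real ((Suc m)\<^sup>2)"
        unfolding g_def t_def by (rule second_moment(1)[OF E pos])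
      ultimately show "norm (\<integral>\<omega>. g m \<omega> \<partial>R) \<le> 6 * real (k\<^sup>2) * (1 / real ((Suc m)\<^sup>2))" by simp
    qed
  qed (simp add: g_def)
  then show ?thesis
  proof eventually_elim
    case (elim \<omega>)
    then have "(\<lambda>m. sqrt (g m \<omega>)) \<longlonglongrightarrow> sqrt 0" by (intro tendsto_real_sqrt summable_LIMSEQ_zero)
    then have "(\<lambda>m. T k E ((Suc m)\<^sup>2) \<omega> / real ((Suc m)\<^sup>2) ^ k - t) \<longlonglongrightarrow> 0"
      unfolding g_def real_sqrt_abs real_sqrt_zero by (rule tendsto_rabs_zero_cancel)
    then have "(\<lambda>m. T k E ((Suc m)\<^sup>2) \<omega> / real ((Suc m)\<^sup>2) ^ k) \<longlonglongrightarrow> t" by (rule LIM_zero_cancel)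
    then show ?case
      unfolding t_def
    proof (rule tendsto_of_square_subsequence[rotated 2])
      show "T k E m \<omega> \<le> T k E n \<omega>" if "m \<le> n" for m n
        unfolding T_def using that H_range by (intro sum_mono2 PiE_mono finite_PiE) auto
      show "0 \<le> T k E n \<omega>" for n unfolding T_def using H_range by (intro sum_nonneg) auto
    qed
  qed
qed

end

section \<open>Poset limits\<close>

text \<open>The type \<open>lposet\<close> is uncountable, but a valid relation has finite support
  and is coded by a number and a finite set of pairs. Countability later permits a common null set
  for all \<open>Q\<close>.\<close>

lemma countable_valid_posets: "countable {Q. valid_poset Q}"
proof -
  define c where "c Q = (fst Q, {p. snd Q (fst p) (snd p)})" for Q :: lposet
  have "c ` {Q. valid_poset Q} \<subseteq> UNIV \<times> {A. finite A}"
  proof (clarsimp simp: c_def)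
    fix n R assume "valid_poset (n, R)"
    then have "{p. R (fst p) (snd p)} \<subseteq> {..<n} \<times> {..<n}" by (auto simp: valid_poset_def)
    then show "finite {p. R (fst p) (snd p)}" by (rule finite_subset) auto
  qed
  then have "countable (c ` {Q. valid_poset Q})"
    by (rule countable_subset) (intro countable_SIGMA countableI_type countable_Collect_finite)
  moreover have "inj_on c {Q. valid_poset Q}"
    by (rule inj_onI) (auto simp: c_def set_eq_iff fun_eq_iff prod_eq_iff)
  ultimately show ?thesis by (rule countable_image_inj_on)
qed

lemma tendsto_poset_pt:
  fixes p :: "nat \<Rightarrow> poset_pt"
  assumes "\<And>Q. (\<lambda>n. fst (p n) Q) \<longlonglongrightarrow> fst q Q" "(\<lambda>n. snd (p n)) \<longlonglongrightarrow> snd q"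
  shows "p \<longlonglongrightarrow> q"
proof -
  have "limitin (product_topology (\<lambda>_. euclidean) UNIV) (\<lambda>n. fst (p n)) (fst q) sequentially"
    unfolding limitin_componentwise using assms(1) by (auto simp: limitin_canonical_iff)
  then have "(\<lambda>n. fst (p n)) \<longlonglongrightarrow> fst q"
    by (simp add: euclidean_product_topology limitin_canonical_iff)
  from tendsto_Pair[OF this assms(2)] show ?thesis by simp
qed

text \<open>Almost surely all thresholds lie in [0,1). Being non-negative, they make every sampled
  relation come from a positive kernel value; being below 1, they make a kernel value 1 enforce the
  relation. One null set works for all \<open>n\<close>.\<close>

lemma (in random_array) valid_rposet:
  assumes W_tr: "\<And>x y z. x \<in> space M \<Longrightarrow> y \<in> space M \<Longrightarrow> z \<in> space M \<Longrightarrow> 0 < W (x, y) \<Longrightarrow> 0 < W (y, z) \<Longrightarrow> W (x, z) = 1"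
    and W_irr: "\<And>x. x \<in> space M \<Longrightarrow> W (x, x) = 0"
  shows "AE \<omega> in R. \<forall>n\<ge>1. valid_poset (rposet (\<lambda>x y. W (x, y)) n \<omega>)"
proof -
  have "AE z in unit_measure. 0 \<le> z \<and> z < 1"
  proof -
    have "AE z in lborel. z \<noteq> (1::real)" by (rule AE_lborel_singleton)
    then have "AE z in lborel. z \<in> {0..1::real} \<longrightarrow> 0 \<le> z \<and> z < 1" by eventually_elim auto
    then show ?thesis by (intro AE_uniform_measureI) auto
  qed
  then have "AE z in PZ. 0 \<le> z d \<and> z d < 1" for d
    by (intro AE_PiM_component[where P="\<lambda>z. 0 \<le> z \<and> z < 1"] prob_space_unit_measure) auto
  then have "AE z in PZ. \<forall>d. 0 \<le> z d \<and> z d < 1" by (simp add: AE_all_countable)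
  then have "AE \<omega> in R. \<forall>d. 0 \<le> snd \<omega> d \<and> snd \<omega> d < 1"
    by (intro P.AE_pair_measure) auto
  then show ?thesis
  proof (rule AE_mp, intro AE_I2 impI allI)
    fix \<omega> n assume \<omega>: "\<omega> \<in> space R" and z: "\<forall>d. 0 \<le> snd \<omega> d \<and> snd \<omega> d < 1" and n: "1 \<le> (n::nat)"
    have X: "fst \<omega> i \<in> space M" for i
      using \<omega> by (auto simp: space_pair_measure space_PiM PiE_iff)
    have pos: "0 < W (fst \<omega> i, fst \<omega> j)" if "snd \<omega> (i, j) < W (fst \<omega> i, fst \<omega> j)" for i j
      using z that by (metis order_le_less_trans)
    have "snd \<omega> (i, l) < W (fst \<omega> i, fst \<omega> l)"
      if "snd \<omega> (i, j) < W (fst \<omega> i, fst \<omega> j)" "snd \<omega> (j, l) < W (fst \<omega> j, fst \<omega> l)" for i j l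
      using W_tr[OF X X X pos[OF that(1)] pos[OF that(2)]] z by simp
    then show "valid_poset (rposet (\<lambda>x y. W (x, y)) n \<omega>)"
      unfolding valid_poset_def rposet_def using n pos W_irr[OF X] by fastforce
  qed
qed

lemma (in random_array) AE_hom_density_tendsto:
  assumes "valid_poset Q"
  shows "AE \<omega> in R. (\<lambda>n. hom_density Q (rposet (\<lambda>x y. W (x, y)) n \<omega>)) \<longlonglongrightarrow> kernel_density M (\<lambda>x y. W (x, y)) Q"
proof -
  have E: "edges Q \<subseteq> {..<fst Q} \<times> {..<fst Q}" using oriented_edges[OF assms] by (simp add: oriented_def)
  have eq: "hom_density Q (rposet (\<lambda>x y. W (x, y)) n \<omega>) = T (fst Q) (edges Q) n \<omega> / real n ^ fst Q" for n \<omega>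
  proof -
    have "edge_sum {..<n} (fst Q) (edges Q) (\<lambda>_ x. of_bool (fst x < n \<and> snd x < n \<and> snd \<omega> (fst x, snd x) < W (fst \<omega> (fst x), fst \<omega> (snd x))))
      = T (fst Q) (edges Q) n \<omega>"
      unfolding edge_sum_def T_def H_def
    proof (intro sum.cong prod.cong refl)
      fix \<phi> e assume "\<phi> \<in> {..<fst Q} \<rightarrow>\<^sub>E {..<n}" "e \<in> edges Q"
      moreover from this have "fst e < fst Q" "snd e < fst Q" using E by auto
      ultimately have "\<phi> (fst e) < n" "\<phi> (snd e) < n" by (auto simp: PiE_iff)
      then show "of_bool (fst (map_prod \<phi> \<phi> e) < n \<and> snd (map_prod \<phi> \<phi> e) < n \<and>
          snd \<omega> (fst (map_prod \<phi> \<phi> e), snd (map_prod \<phi> \<phi> e)) < W (fst \<omega> (fst (map_prod \<phi> \<phi> e)), fst \<omega> (snd (map_prod \<phi> \<phi> e))))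
        = edge \<omega> (map_prod \<phi> \<phi> e)"
        by (simp add: edge_def map_prod_def case_prod_unfold)
    qed
    then show ?thesis unfolding rposet_def hom_density_eq_edge_sum[OF assms] by simp
  qed
  show ?thesis unfolding eq kernel_density_eq_kint[OF assms] by (rule AE_T_tendsto[OF E])
qed

lemma sampling_limit:
  fixes M :: "'a measure" and prec :: "'a \<Rightarrow> 'a \<Rightarrow> bool" and W :: "'a \<Rightarrow> 'a \<Rightarrow> real"
  assumes ops: "ordered_prob_space M prec" and ker: "poset_kernel M prec W"
  shows "\<exists>Lim \<in> proper_poset_limits.
    (AE \<omega> in rposet_space M. ((\<lambda>n. poset_point (rposet W n \<omega>)) \<longlongrightarrow> Lim) sequentially) \<and>
    (\<forall>Q. valid_poset Q \<longrightarrow> fst Lim Q = kernel_density M W Q)"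
proof -
  define W2 where "W2 p = W (fst p) (snd p)" for p
  have W2: "(\<lambda>x y. W2 (x, y)) = W" by (simp add: W2_def)
  interpret prob_space M using ops by (simp add: ordered_prob_space_def)
  interpret random_array M W2
  proof
    show "W2 \<in> borel_measurable (M \<Otimes>\<^sub>M M)"
      using ker by (simp add: poset_kernel_def W2_def[abs_def] case_prod_unfold)
    show "0 \<le> W2 p \<and> W2 p \<le> 1" if "p \<in> space (M \<Otimes>\<^sub>M M)" for p
      using ker that by (cases p) (auto simp: poset_kernel_def W2_def space_pair_measure)
  qed
  have R_eq: "rposet_space M = R" by (simp add: rposet_space_def)
  \<comment> \<open>The value 0 at invalid indices agrees with \<open>poset_point\<close>, and the
    second component is the limit of the inverse sizes.\<close>
  define Lim :: poset_pt where "Lim = ((\<lambda>Q. if valid_poset Q then kernel_density M W Q else 0), 0)"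
  have valid: "AE \<omega> in R. \<forall>n\<ge>1. valid_poset (rposet W n \<omega>)"
  proof -
    have tr: "W2 (x, z) = 1" if "x \<in> space M" "y \<in> space M" "z \<in> space M" "0 < W2 (x, y)" "0 < W2 (y, z)" for x y z
      using ker that unfolding poset_kernel_def W2_def fst_conv snd_conv by blast
    have irr: "W2 (x, x) = 0" if "x \<in> space M" for x
    proof (rule ccontr)
      assume "W2 (x, x) \<noteq> 0"
      moreover have "0 \<le> W2 (x, x)" using W_range[of "(x, x)"] that by (simp add: space_pair_measure)
      ultimately have "0 < W x x" by (simp add: W2_def)
      then have "prec x x" using ker that unfolding poset_kernel_def by blast
      then show False using ops that unfolding ordered_prob_space_def by blast
    qed
    show ?thesis using valid_rposet[OF tr irr] unfolding W2 .
  qed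
  have "AE \<omega> in R. \<forall>Q\<in>{Q. valid_poset Q}. (\<lambda>n. hom_density Q (rposet W n \<omega>)) \<longlonglongrightarrow> kernel_density M W Q"
    using AE_hom_density_tendsto unfolding W2 by (subst AE_ball_countable[OF countable_valid_posets]) auto
  then have conv: "AE \<omega> in R. (\<lambda>n. poset_point (rposet W n \<omega>)) \<longlonglongrightarrow> Lim"
  proof eventually_elim
    case (elim \<omega>)
    show ?case
    proof (rule tendsto_poset_pt)
      show "(\<lambda>n. fst (poset_point (rposet W n \<omega>)) Q) \<longlonglongrightarrow> fst Lim Q" for Q
        using bspec[OF elim, of Q] by (cases "valid_poset Q") (simp_all add: poset_point_def Lim_def)
      show "(\<lambda>n. snd (poset_point (rposet W n \<omega>))) \<longlonglongrightarrow> snd Lim"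
        using lim_1_over_n by (simp add: poset_point_def Lim_def rposet_def)
    qed
  qed
  \<comment> \<open>One sample path outside the null sets exhibits \<open>Lim\<close> as a limit of
    finite posets. Size 0 is excluded because a poset is nonempty.\<close>
  have "\<exists>\<omega>. (\<forall>n\<ge>1. valid_poset (rposet W n \<omega>)) \<and> (\<lambda>n. poset_point (rposet W n \<omega>)) \<longlonglongrightarrow> Lim"
  proof -
    have "AE \<omega> in R. (\<forall>n\<ge>1. valid_poset (rposet W n \<omega>)) \<and> (\<lambda>n. poset_point (rposet W n \<omega>)) \<longlonglongrightarrow> Lim"
      using valid conv by eventually_elim blast
    then show ?thesis using eventually_happens'[OF P.ae_filter_bot] by blast
  qed
  then obtain \<omega> where \<omega>: "\<And>n. n \<ge> 1 \<Longrightarrow> valid_poset (rposet W n \<omega>)" "(\<lambda>n. poset_point (rposet W n \<omega>)) \<longlonglongrightarrow> Lim"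
    by blast
  have "Lim \<in> closure finite_poset_points"
  proof (rule Lim_in_closed_set[OF closed_closure _ _ \<omega>(2)])
    show "\<forall>\<^sub>F n in sequentially. poset_point (rposet W n \<omega>) \<in> closure finite_poset_points"
      using eventually_ge_at_top[of 1]
      by eventually_elim (use \<omega>(1) in \<open>auto simp: finite_poset_points_def intro!: subsetD[OF closure_subset]\<close>)
  qed simp
  \<comment> \<open>The last component separates: it is 0 for \<open>Lim\<close> and an inverse size
    for a finite poset.\<close>
  moreover have "Lim \<notin> finite_poset_points"
    by (auto simp: finite_poset_points_def poset_point_def Lim_def valid_poset_def)
  ultimately have "Lim \<in> proper_poset_limits" by (simp add: proper_poset_limits_def)
  moreover have "\<forall>Q. valid_poset Q \<longrightarrow> fst Lim Q = kernel_density M W Q" by (simp add: Lim_def)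
  ultimately show ?thesis unfolding R_eq using conv by blast
qed

text \<open>Finite posets are themselves represented by kernels (equal blocks, with no relations inside
  a block), which is why the sizes of the approximating posets do not matter here.\<close>

lemma limit_representation:
  fixes L :: poset_pt
  assumes "L \<in> closure finite_poset_points"
  shows "\<exists>(N :: real measure) precN WN. ordered_prob_space N precN \<and> poset_kernel N precN WN \<and>
    (\<forall>Q. valid_poset Q \<longrightarrow> fst L Q = kernel_density N WN Q)"
proof -
  define q where "q = from_nat_into {Q. valid_poset Q}"
  have "\<exists>P. valid_poset P \<and> (\<forall>i<n. \<bar>fst (poset_point P) (q i) - fst L (q i)\<bar> < 1 / real (Suc n))" for n
  proof -
    \<comment> \<open>A basic neighbourhood of \<open>L\<close> in the first \<open>n\<close>
      coordinates of an enumeration of the valid posets; shrinking it with \<open>n\<close> turns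
      membership in the closure into a sequence.\<close>
    define U where "U = (\<Inter>i\<in>{..<n}. {p :: poset_pt. \<bar>fst p (q i) - fst L (q i)\<bar> < 1 / real (Suc n)})"
    have cont: "continuous_on UNIV (\<lambda>p :: poset_pt. fst p Q)" for Q
      by (rule continuous_on_compose2[OF continuous_on_product_coordinates[of Q]]) (auto intro: continuous_intros)
    have "open U"
      unfolding U_def
      by (intro open_INT ballI open_Collect_less continuous_intros cont) auto
    moreover have "L \<in> U" by (simp add: U_def)
    ultimately obtain p where "p \<in> finite_poset_points" "p \<in> U"
      using open_Int_closure_eq_empty[of U finite_poset_points] assms by blast
    then show ?thesis by (auto simp: finite_poset_points_def U_def)
  qed
  then obtain P where P: "\<And>n. valid_poset (P n)"
    and close: "\<And>n i. i < n \<Longrightarrow> \<bar>fst (poset_point (P n)) (q i) - fst L (q i)\<bar> < 1 / real (Suc n)" by metis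
  have lim: "(\<lambda>n. hom_density Q (P n)) \<longlonglongrightarrow> fst L Q" if Q: "valid_poset Q" for Q
  proof -
    obtain i where i: "q i = Q"
      using from_nat_into_surj[OF countable_valid_posets, of Q] Q by (auto simp: q_def)
    have "(\<lambda>n. hom_density Q (P n) - fst L Q) \<longlonglongrightarrow> 0"
    proof (rule Lim_null_comparison)
      show "\<forall>\<^sub>F n in sequentially. norm (hom_density Q (P n) - fst L Q) \<le> 1 / real (Suc n)"
        using eventually_gt_at_top[of i]
      proof eventually_elim
        case (elim n)
        then show ?case using close[OF elim] Q by (simp add: i poset_point_def del: of_nat_Suc)
      qed
      show "(\<lambda>n. 1 / real (Suc n)) \<longlonglongrightarrow> 0" by (rule LIMSEQ_Suc[OF lim_1_over_n])
    qed
    then show ?thesis by (rule LIM_zero_cancel)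
  qed
  obtain s N precN WN where s: "strict_mono s" and N: "ordered_prob_space (N :: real measure) precN" "poset_kernel N precN WN"
    and kd: "\<And>Q. valid_poset Q \<Longrightarrow> (\<lambda>n. hom_density Q (P (s n))) \<longlonglongrightarrow> kernel_density N WN Q"
    by (rule kernel_of_poset_sequence[OF P]) (rule that)
  have "fst L Q = kernel_density N WN Q" if "valid_poset Q" for Q
    using LIMSEQ_unique[OF LIMSEQ_subseq_LIMSEQ[OF lim[OF that] s], of "kernel_density N WN Q"] kd[OF that]
    by (simp add: o_def)
  with N show ?thesis by blast
qed

theorem theorem1p7:
  fixes M :: "'a measure" and prec :: "'a \<Rightarrow> 'a \<Rightarrow> bool" and W :: "'a \<Rightarrow> 'a \<Rightarrow> real"
  assumes "ordered_prob_space M prec" and "poset_kernel M prec W"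
  shows "(\<exists>Lim \<in> proper_poset_limits.
            (AE \<omega> in rposet_space M. ((\<lambda>n. poset_point (rposet W n \<omega>)) \<longlongrightarrow> Lim) sequentially) \<and>
            (\<forall>Q. valid_poset Q \<longrightarrow> fst Lim Q = kernel_density M W Q))
       \<and> (\<forall>Lim \<in> proper_poset_limits. \<exists>(N :: real measure) precN WN.
            ordered_prob_space N precN \<and> poset_kernel N precN WN \<and>
            (\<forall>Q. valid_poset Q \<longrightarrow> fst Lim Q = kernel_density N WN Q))"
  using sampling_limit[OF assms] limit_representation by (simp add: proper_poset_limits_def)

end
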